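(* Let $U$ be a bounded open subset of $\mathbb{R}^d$ with $d \geq 3$. Let $\hat{A}=(\hat{a}_{ij})$ be a matrix of measurable functions with $\langle \hat A(x) \xi, \xi \rangle \geq \lambda \| \xi \|^2$ and $\max_{i,j} |\hat a_{ij}(x)| \leq M$ for a.e. $x$ and all $\xi\in\mathbb R^d$ (constants $\lambda,M>0$). Let $\hat{\mathbf{B}} \in L^2(U,\mathbb{R}^d)$ satisfy $\int_{U} \langle \hat{\mathbf{B}}, \nabla \varphi \rangle\,dx \geq 0$ for all $\varphi \in C_0^{\infty}(U)$ with $\varphi \geq 0$. Let $\hat{c} \in L^{\frac{2d}{d+2}}(U)$ with $\hat{c} \ge 0$. Then: (i) If $\hat{v} \in H^{1,2}_0(U)$ satisfies $\int_{U} \langle \hat{A} \nabla \hat{v}, \nabla \varphi \rangle \,dx + \int_{U} \langle \hat{\mathbf{B}}, \nabla \hat{v} \rangle \varphi\,dx + \int_{U} \hat{c} \hat{v} \varphi\,dx = 0$ for all $\varphi \in C_0^{\infty}(U)$, then $\hat{v}=0$ a.e. in $U$. (ii) If $\hat{f} \in L^{\frac{2d}{d+2}}(U)$, then there exists $\hat u\in H^{1,2}_0(U)$ with $\int_{U} \langle \hat{A} \nabla \hat{u}, \nabla \varphi \rangle \,dx + \int_{U} \langle \hat{\mathbf{B}}, \nabla \hat{u} \rangle \varphi\,dx + \int_{U} \hat{c} \hat{u} \varphi\,dx = \int_U \hat f\varphi\,dx$ for all $\varphi \in C_0^{\infty}(U)$, such that $\| \nabla \hat{u} \|_{L^2(U)}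 \le \hat{C}_1 \|\hat{f}\|_{L^{\frac{2d}{d+2}}(U)}$, where $\hat{C}_1>0$ depends only on $d$ and $\lambda$. (iii) If $\hat{f} \in L^{\frac{\hat{p}d}{d+\hat{p}}}(U)$ for some $\hat{p} \in (d, \infty)$, then the (unique) weak solution $\hat{u}$ from (ii) satisfies $\hat{u} \in L^{\infty}(U)$ and $\|\hat{u}\|_{L^{\infty}(U)} \leq \hat{C}_2 \| \hat{f} \|_{L^{\frac{\hat{p}d}{d+\hat{p}}}(U)}$, where $\hat{C}_2>0$ depends only on $\lambda$, $d$, $\hat{p}$ and $|U|$.
   Context: $H^{1,2}_0(U)$ is the closure of $C_0^\infty(U)$ in $W^{1,2}(U)$; $|U|$ is the Lebesgue measure of $U$. *)

theory Defs
  imports "HOL-Analysis.Analysis"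
begin

text \<open>Ambient space: R^d is modelled as real^'n with d = CARD('n).\<close>

definition partial_deriv :: "'n::finite \<Rightarrow> (real^'n \<Rightarrow> real) \<Rightarrow> real^'n \<Rightarrow> real" where
  "partial_deriv i f x = frechet_derivative f (at x) (axis i 1)"

definition grad :: "(real^'n::finite \<Rightarrow> real) \<Rightarrow> real^'n \<Rightarrow> real^'n" where
  "grad f x = (\<chi> i. partial_deriv i f x)"

fun Ck :: "nat \<Rightarrow> (real^'n::finite \<Rightarrow> real) \<Rightarrow> bool" where
  "Ck 0 f = continuous_on UNIV f"
| "Ck (Suc k) f = (continuous_on UNIV f \<and> f differentiable_on UNIV \<and> (\<forall>i. Ck k (partial_deriv i f)))"

definition test_fun :: "(real^'n::finite) set \<Rightarrow> (real^'n \<Rightarrow> real) \<Rightarrow> bool" where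
  "test_fun U \<phi> \<longleftrightarrow> (\<forall>k. Ck k \<phi>) \<and> compact (closure {x. \<phi> x \<noteq> 0})
      \<and> closure {x. \<phi> x \<noteq> 0} \<subseteq> U"

definition Lp :: "(real^'n::finite) set \<Rightarrow> real \<Rightarrow> (real^'n \<Rightarrow> real) \<Rightarrow> bool" where
  "Lp U p f \<longleftrightarrow> f \<in> borel_measurable (lebesgue_on U)
      \<and> integrable (lebesgue_on U) (\<lambda>x. \<bar>f x\<bar> powr p)"

definition Lp_norm :: "(real^'n::finite) set \<Rightarrow> real \<Rightarrow> (real^'n \<Rightarrow> real) \<Rightarrow> real" where
  "Lp_norm U p f = (\<integral>x. \<bar>f x\<bar> powr p \<partial>lebesgue_on U) powr (1 / p)"

definition L2_vec :: "(real^'n::finite) set \<Rightarrow> (real^'n \<Rightarrow> real^'n) \<Rightarrow> bool" where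
  "L2_vec U F \<longleftrightarrow> F \<in> borel_measurable (lebesgue_on U)
      \<and> integrable (lebesgue_on U) (\<lambda>x. (norm (F x))\<^sup>2)"

definition L2_vec_norm :: "(real^'n::finite) set \<Rightarrow> (real^'n \<Rightarrow> real^'n) \<Rightarrow> real" where
  "L2_vec_norm U F = sqrt (\<integral>x. (norm (F x))\<^sup>2 \<partial>lebesgue_on U)"

text \<open>H0 U u Du: u belongs to H^{1,2}_0(U) (closure of C_0^infinity(U) in W^{1,2}(U)),
  and Du is its (weak) gradient: there are test functions converging to u in L^2
  whose classical gradients converge to Du in L^2.\<close>
definition H0 :: "(real^'n::finite) set \<Rightarrow> (real^'n \<Rightarrow> real) \<Rightarrow> (real^'n \<Rightarrow> real^'n) \<Rightarrow> bool" where
  "H0 U u Du \<longleftrightarrow> Lp U 2 u \<and> L2_vec U Du \<and>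
     (\<exists>\<phi>s. (\<forall>n. test_fun U (\<phi>s n))
        \<and> (\<lambda>n. \<integral>x. (\<phi>s n x - u x)\<^sup>2 \<partial>lebesgue_on U) \<longlonglongrightarrow> 0
        \<and> (\<lambda>n. \<integral>x. (norm (grad (\<phi>s n) x - Du x))\<^sup>2 \<partial>lebesgue_on U) \<longlonglongrightarrow> 0)"

definition admissible ::
  "(real^'n::finite) set \<Rightarrow> real \<Rightarrow> real \<Rightarrow> (real^'n \<Rightarrow> real^'n^'n) \<Rightarrow> (real^'n \<Rightarrow> real^'n)
     \<Rightarrow> (real^'n \<Rightarrow> real) \<Rightarrow> bool" where
  "admissible U lam M A B c \<longleftrightarrow>
     bounded U \<and> open U \<and> lam > 0 \<and> M > 0
     \<and> (\<forall>i j. (\<lambda>x. A x $ i $ j) \<in> borel_measurable (lebesgue_on U))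
     \<and> (AE x in lebesgue_on U. \<forall>\<xi>. (A x *v \<xi>) \<bullet> \<xi> \<ge> lam * (norm \<xi>)\<^sup>2)
     \<and> (AE x in lebesgue_on U. \<forall>i j. \<bar>A x $ i $ j\<bar> \<le> M)
     \<and> L2_vec U B
     \<and> (\<forall>\<phi>. test_fun U \<phi> \<and> (\<forall>x. \<phi> x \<ge> 0) \<longrightarrow>
           (\<integral>x. B x \<bullet> grad \<phi> x \<partial>lebesgue_on U) \<ge> 0)
     \<and> Lp U (2 * real CARD('n) / (real CARD('n) + 2)) c
     \<and> (AE x in lebesgue_on U. c x \<ge> 0)"

text \<open>Weak formulation of  -div(A grad u) + <B, grad u> + c u = f  on U.\<close>
definition weak_sol ::
  "(real^'n::finite) set \<Rightarrow> (real^'n \<Rightarrow> real^'n^'n) \<Rightarrow> (real^'n \<Rightarrow> real^'n)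
     \<Rightarrow> (real^'n \<Rightarrow> real) \<Rightarrow> (real^'n \<Rightarrow> real) \<Rightarrow> (real^'n \<Rightarrow> real^'n) \<Rightarrow> (real^'n \<Rightarrow> real) \<Rightarrow> bool" where
  "weak_sol U A B c u Du f \<longleftrightarrow>
     (\<forall>\<phi>. test_fun U \<phi> \<longrightarrow>
        (\<integral>x. (A x *v Du x) \<bullet> grad \<phi> x \<partial>lebesgue_on U)
        + (\<integral>x. (B x \<bullet> Du x) * \<phi> x \<partial>lebesgue_on U)
        + (\<integral>x. c x * u x * \<phi> x \<partial>lebesgue_on U)
        = (\<integral>x. f x * \<phi> x \<partial>lebesgue_on U))"

end

theory Submission
  imports Defs
begin

text \<open>
  Testing the equation formally with a nondecreasing function \<open>P u\<close>, \<open>P 0 = 0\<close>, the drift term is harmless: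
  with a primitive \<open>S \<ge> 0\<close> of \<open>P\<close> it equals \<open>\<integral> \<langle>B, \<nabla>(S u)\<rangle>\<close>, which is nonnegative by assumption.
  If moreover \<open>0 \<le> P' \<le> 1\<close>, ellipticity and the Sobolev inequality bound the square of the
  \<open>2d/(d-2)\<close>-norm of \<open>P u\<close> by a multiple of \<open>\<integral> f P(u)\<close>. Letting \<open>P\<close> tend to \<open>s \<mapsto> (s - k)\<^sup>+\<close> gives
  uniqueness (\<open>f = 0\<close>, \<open>k = 0\<close>) and, by Stampacchia's iteration over the level sets \<open>{u > k}\<close>, the
  \<open>L\<^sup>\<infinity>\<close> estimate. As \<open>B\<close> is only square integrable, the bilinear form is unbounded on
  \<open>H\<^sub>0\<close>; existence follows from Lions' projection theorem, which needs coercivity only on test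
  functions, where it comes from \<open>2 \<phi> \<nabla>\<phi> = \<nabla>(\<phi>\<^sup>2)\<close>. The Sobolev inequality is proved by Gagliardo's method.
\<close>

section \<open>Gagliardo's inequality\<close>

text \<open>As \<open>B\<close> is only in \<open>L^2\<close>, the product
  \<open>B \<bullet> Du\<close> is merely integrable and can be paired only with bounded functions,
  while the equation itself admits only smooth test functions with compact support. This dictates
  what may be inserted for \<open>P\<close>: it is bounded, for dominated convergence; smooth with
  \<open>P 0 = 0\<close>, so that it maps test functions to test functions; and its derivative lies
  between 0 and 1, so that \<open>P'^2 \<le> P'\<close> turns ellipticity into a bound for the
  gradient of \<open>P u\<close>. The positive part \<open>(s - k)^+\<close> is none of this and is
  reached only as a limit; the bound on \<open>P\<close> may blow up on the way because it is absent
  from the estimate. All constants can be traced. \<open>2 * (d - 1) / (d - 2)\<close> is the power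
  to which a test function is raised in Gagliardo's method and becomes the Sobolev constant. Divided
  by \<open>lam\<close> it bounds the gradient; its square over \<open>lam\<close>, times a factor
  produced by the iteration from the measure, \<open>d\<close> and \<open>p\<close>, bounds the
  supremum. The bound on the entries of \<open>A\<close> serves qualitative purposes: square
  integrability of \<open>A Du\<close> and continuity of the form.\<close>

lemma prod_le_mean_power:
  fixes x :: "'i \<Rightarrow> real"
  assumes "finite S" "S \<noteq> {}" and nonneg: "\<And>i. i \<in> S \<Longrightarrow> 0 \<le> x i"
  shows "(\<Prod>i\<in>S. x i) \<le> ((\<Sum>i\<in>S. x i) / card S) ^ card S"
proof -
  have pos: "card S > 0"
    using assms by (simp add: card_gt_0_iff)
  have "(\<Prod>i\<in>S. x i) powr (1 / card S) \<le> (\<Sum>i\<in>S. x i) / card S"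
    using arith_geom_mean[of S x] assms by (simp add: sum_divide_distrib)
  then have "((\<Prod>i\<in>S. x i) powr (1 / card S)) ^ card S \<le> ((\<Sum>i\<in>S. x i) / card S) ^ card S"
    by (intro power_mono) auto
  moreover have "((\<Prod>i\<in>S. x i) powr (1 / card S)) ^ card S = (\<Prod>i\<in>S. x i)"
  proof (cases "(\<Prod>i\<in>S. x i) = 0")
    case True
    then show ?thesis using pos by simp
  next
    case False
    then have "(\<Prod>i\<in>S. x i) > 0"
      by (simp add: nonneg order_less_le prod_nonneg)
    then show ?thesis
      using pos by (subst powr_realpow[symmetric]) (auto simp: powr_powr)
  qed
  ultimately show ?thesis by simp
qed

text \<open>The generalised Hoelder inequality for \<open>card S\<close> functions, raised to the power \<open>card S\<close> so that
  no fractional powers of extended reals occur.\<close>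

lemma nn_integral_prod_power_le:
  fixes G :: "'i \<Rightarrow> 'a \<Rightarrow> ennreal" and g :: "'a \<Rightarrow> ennreal"
  assumes S: "finite S" "S \<noteq> {}"
    and gm: "g \<in> borel_measurable M"
    and Gm: "\<And>i. i \<in> S \<Longrightarrow> G i \<in> borel_measurable M"
    and le: "\<And>x. x \<in> space M \<Longrightarrow> g x ^ card S \<le> c * (\<Prod>i\<in>S. G i x)"
  shows "(\<integral>\<^sup>+x. g x \<partial>M) ^ card S \<le> c * (\<Prod>i\<in>S. \<integral>\<^sup>+x. G i x \<partial>M)"
proof -
  define m where "m = card S"
  have m: "m > 0"
    using S by (simp add: m_def card_gt_0_iff)
  have zero: ?thesis if "AE x in M. g x = 0"
  proof -
    have "(\<integral>\<^sup>+x. g x \<partial>M) = 0"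
      using that gm by (simp add: nn_integral_0_iff_AE)
    then show ?thesis using m by (simp add: m_def zero_power)
  qed
  \<comment> \<open>Zero factors are separated off because \<open>0 * top = 0\<close> in
    \<open>ennreal\<close>: there \<open>g\<close> vanishes almost everywhere. If all factors are
    nonzero, an infinite one makes the right side \<open>top\<close>, and only the last case needs
    an inequality between reals.\<close>
  consider (c0) "c = 0" | (i0) i where "i \<in> S" "(\<integral>\<^sup>+x. G i x \<partial>M) = 0"
    | (top) "c \<noteq> 0" "\<And>i. i \<in> S \<Longrightarrow> (\<integral>\<^sup>+x. G i x \<partial>M) \<noteq> 0"
        "c = top \<or> (\<exists>i\<in>S. (\<integral>\<^sup>+x. G i x \<partial>M) = top)"
    | (fin) "c \<noteq> 0" "\<And>i. i \<in> S \<Longrightarrow> (\<integral>\<^sup>+x. G i x \<partial>M) \<noteq> 0"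
        "c \<noteq> top" "\<And>i. i \<in> S \<Longrightarrow> (\<integral>\<^sup>+x. G i x \<partial>M) \<noteq> top"
    by metis
  then show ?thesis
  proof cases
    case c0
    then show ?thesis
      using le m by (intro zero) (auto simp: m_def)
  next
    case i0
    then have "AE x in M. G i x = 0"
      using Gm by (simp add: nn_integral_0_iff_AE)
    then have "AE x in M. g x = 0"
      using AE_space
    proof eventually_elim
      case (elim x)
      then have "(\<Prod>i\<in>S. G i x) = 0"
        using i0 S by auto
      then have "g x ^ card S \<le> 0"
        using le[of x] elim by (metis mult_zero_right)
      then show ?case
        using m by (simp add: m_def)
    qed
    then show ?thesis by (rule zero)
  next
    case top
    have "c * (\<Prod>i\<in>S. \<integral>\<^sup>+x. G i x \<partial>M) = top"
    proof (cases "c = top")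
      case True
      then show ?thesis using top S by (simp add: ennreal_top_mult)
    next
      case False
      then obtain i where i: "i \<in> S" "(\<integral>\<^sup>+x. G i x \<partial>M) = top" using top by auto
      have "(\<Prod>i\<in>S. \<integral>\<^sup>+x. G i x \<partial>M) = top * (\<Prod>i\<in>S - {i}. \<integral>\<^sup>+x. G i x \<partial>M)"
        using i S by (subst prod.remove[of S i]) auto
      also have "\<dots> = top"
        using top S by (simp add: ennreal_top_mult)
      finally show ?thesis
        using top by (simp add: ennreal_mult_top)
    qed
    then show ?thesis by simp
  next
    case fin
    define a where "a i = enn2real (\<integral>\<^sup>+x. G i x \<partial>M)" for i
    define c' where "c' = enn2real c"
    have a: "(\<integral>\<^sup>+x. G i x \<partial>M) = ennreal (a i)" "a i > 0" if "i \<in> S" for i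
      using fin(2,4)[OF that] by (auto simp: a_def enn2real_positive_iff less_top zero_less_iff_neq_zero)
    have c': "c = ennreal c'" "c' > 0"
      using fin by (auto simp: c'_def enn2real_positive_iff less_top zero_less_iff_neq_zero)
    \<comment> \<open>\<open>R\<close> is the m-th root of the right side. After normalising each
      \<open>G i\<close> to integral 1, the mean inequality bounds \<open>g\<close> by
      \<open>R\<close> times the average of the normalised functions, and that average has integral
      1.\<close>
    define R where "R = root m (c' * (\<Prod>i\<in>S. a i))"
    have P: "(\<Prod>i\<in>S. a i) > 0"
      by (rule prod_pos) (use a in auto)
    have R: "R > 0" "R ^ m = c' * (\<Prod>i\<in>S. a i)"
      using P c' m by (auto simp: R_def)
    have "AE x in M. \<forall>i\<in>S. G i x \<noteq> top"
      using S fin(4) Gm by (intro AE_finite_allI) (auto intro!: nn_integral_PInf_AE simp flip: infinity_ennreal_def)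
    then have ae: "AE x in M. g x \<le> ennreal (R / m) * (\<Sum>i\<in>S. ennreal (1 / a i) * G i x)"
      using AE_space
    proof eventually_elim
      case (elim x)
      define y where "y i = enn2real (G i x)" for i
      have y: "G i x = ennreal (y i)" "y i \<ge> 0" if "i \<in> S" for i
        using elim that by (auto simp: y_def less_top)
      have ya: "0 \<le> y i / a i" if "i \<in> S" for i
        using y[OF that] a[OF that] by simp
      have "g x ^ m \<le> c * (\<Prod>i\<in>S. G i x)"
        using le elim by (simp add: m_def)
      also have "\<dots> = ennreal (c' * (\<Prod>i\<in>S. y i))"
        using y c' by (simp add: prod_ennreal ennreal_mult prod_nonneg)
      finally have gx: "g x ^ m \<le> ennreal (c' * (\<Prod>i\<in>S. y i))" .
      then have "g x \<noteq> top"
        using m by (auto simp: power_top_ennreal top_unique)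
      then obtain z where z: "g x = ennreal z" "z \<ge> 0"
        by (metis ennreal_cases)
      have "z ^ m \<le> c' * (\<Prod>i\<in>S. y i)"
        using gx z c' y by (simp add: ennreal_power prod_nonneg)
      also have "\<dots> = R ^ m * (\<Prod>i\<in>S. y i / a i)"
        using R P by (simp add: prod_dividef)
      also have "\<dots> \<le> R ^ m * ((\<Sum>i\<in>S. y i / a i) / m) ^ m"
        unfolding m_def using R ya S
        by (intro mult_left_mono prod_le_mean_power) auto
      also have "\<dots> = (R / m * (\<Sum>i\<in>S. y i / a i)) ^ m"
        by (simp add: power_mult_distrib power_divide)
      finally have "z \<le> R / m * (\<Sum>i\<in>S. y i / a i)"
        using m R sum_nonneg[OF ya, of S] by (intro power_le_imp_le_base[of z "m - 1"]) auto
      then have "g x \<le> ennreal (R / m * (\<Sum>i\<in>S. y i / a i))"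
        using z by (simp add: ennreal_leI)
      also have "\<dots> = ennreal (R / m) * (\<Sum>i\<in>S. ennreal (y i / a i))"
        using R ya by (subst ennreal_mult) (auto simp: sum_nonneg sum_ennreal less_imp_le)
      also have "(\<Sum>i\<in>S. ennreal (y i / a i)) = (\<Sum>i\<in>S. ennreal (1 / a i) * G i x)"
        using a y by (intro sum.cong) (auto simp: ennreal_mult[symmetric] less_imp_le)
      finally show ?case .
    qed
    have "(\<integral>\<^sup>+x. g x \<partial>M) \<le> (\<integral>\<^sup>+x. ennreal (R / m) * (\<Sum>i\<in>S. ennreal (1 / a i) * G i x) \<partial>M)"
      by (rule nn_integral_mono_AE[OF ae])
    also have "\<dots> = ennreal (R / m) * (\<Sum>i\<in>S. ennreal (1 / a i) * (\<integral>\<^sup>+x. G i x \<partial>M))"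
      using Gm by (simp add: nn_integral_cmult nn_integral_sum)
    also have "(\<Sum>i\<in>S. ennreal (1 / a i) * (\<integral>\<^sup>+x. G i x \<partial>M)) = (\<Sum>i\<in>S. 1)"
    proof (rule sum.cong)
      fix i assume i: "i \<in> S"
      show "ennreal (1 / a i) * (\<integral>\<^sup>+x. G i x \<partial>M) = 1"
        using a[OF i] by (simp add: ennreal_mult[symmetric] less_imp_le)
    qed simp
    also have "ennreal (R / m) * (\<Sum>i\<in>S. 1) = ennreal R"
      using m R by (simp add: m_def[symmetric] ennreal_of_nat_eq_real_of_nat ennreal_mult[symmetric] less_imp_le)
    finally have "(\<integral>\<^sup>+x. g x \<partial>M) ^ m \<le> ennreal R ^ m"
      by (intro power_mono) auto
    also have "\<dots> = ennreal (c' * (\<Prod>i\<in>S. a i))"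
      using R by (simp add: ennreal_power less_imp_le)
    also have "\<dots> = c * (\<Prod>i\<in>S. \<integral>\<^sup>+x. G i x \<partial>M)"
      using a c' P by (simp add: ennreal_mult less_imp_le prod_ennreal)
    finally show ?thesis by (simp add: m_def)
  qed
qed

text \<open>Replacing the coordinate of \<open>x\<close> along a basis vector \<open>b\<close> by
  the integration variable keeps the result a function on the whole space, constant along
  \<open>b\<close>. Partial integrals can thus be iterated in any order without splitting the space
  into a product.\<close>

definition line_integral :: "'a::euclidean_space \<Rightarrow> ('a \<Rightarrow> ennreal) \<Rightarrow> 'a \<Rightarrow> ennreal" where
  "line_integral b f x = (\<integral>\<^sup>+t. f (x + (t - x \<bullet> b) *\<^sub>R b) \<partial>lborel)"

fun iter_integral :: "'a::euclidean_space list \<Rightarrow> ('a \<Rightarrow> ennreal) \<Rightarrow> 'a \<Rightarrow> ennreal" where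
  "iter_integral [] f = f"
| "iter_integral (b # L) f = line_integral b (iter_integral L f)"

lemma borel_measurable_line_integral [measurable]:
  assumes [measurable]: "f \<in> borel_measurable borel"
  shows "line_integral b f \<in> borel_measurable borel"
  unfolding line_integral_def by measurable

lemma borel_measurable_iter_integral [measurable]:
  "f \<in> borel_measurable borel \<Longrightarrow> iter_integral L f \<in> borel_measurable borel"
  by (induction L) auto

lemma line_integral_commute:
  fixes f :: "'a::euclidean_space \<Rightarrow> ennreal"
  assumes [measurable]: "f \<in> borel_measurable borel" and "a \<in> Basis" "b \<in> Basis" "a \<noteq> b"
  shows "line_integral a (line_integral b f) x = line_integral b (line_integral a f) x"
proof -
  have ab: "a \<bullet> b = 0" "b \<bullet> a = 0"
    using assms by (auto simp: inner_Basis)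
  have "line_integral a (line_integral b f) x =
      (\<integral>\<^sup>+s. \<integral>\<^sup>+t. f (x + (s - x \<bullet> a) *\<^sub>R a + (t - x \<bullet> b) *\<^sub>R b) \<partial>lborel \<partial>lborel)"
    by (simp add: line_integral_def inner_simps ab)
  also have "\<dots> = (\<integral>\<^sup>+t. \<integral>\<^sup>+s. f (x + (s - x \<bullet> a) *\<^sub>R a + (t - x \<bullet> b) *\<^sub>R b) \<partial>lborel \<partial>lborel)"
    by (rule lborel_pair.Fubini') measurable
  also have "\<dots> = line_integral b (line_integral a f) x"
    by (simp add: line_integral_def inner_simps ab add_ac)
  finally show ?thesis .
qed

lemma line_integral_iter_commute:
  fixes f :: "'a::euclidean_space \<Rightarrow> ennreal"
  assumes f: "f \<in> borel_measurable borel" and "a \<in> Basis" "set L \<subseteq> Basis" "a \<notin> set L"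
  shows "line_integral a (iter_integral L f) = iter_integral L (line_integral a f)"
  using assms(3,4)
proof (induction L)
  case (Cons b L)
  have "line_integral a (line_integral b (iter_integral L f))
      = line_integral b (line_integral a (iter_integral L f))"
    by (rule ext, rule line_integral_commute) (use Cons.prems assms in auto)
  then show ?case using Cons by simp
qed simp

lemma line_integral_shift:
  assumes "b \<in> Basis"
  shows "line_integral b f (x + t *\<^sub>R b) = line_integral b f x"
  using assms by (simp add: line_integral_def inner_simps algebra_simps)

text \<open>Bridge to Lebesgue measure: \<open>lborel\<close> is the image of a finite product of
  one-dimensional measures. Each list element adds one factor of that product, and coordinates not
  yet integrated keep their value from \<open>x\<close>.\<close>

lemma iter_integral_eq_PiM:
  fixes f :: "'a::euclidean_space \<Rightarrow> ennreal"
  assumes [measurable]: "f \<in> borel_measurable borel" and "distinct L" "set L \<subseteq> Basis"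
  shows "iter_integral L f x =
    (\<integral>\<^sup>+y. f (\<Sum>b\<in>Basis. (if b \<in> set L then y b else x \<bullet> b) *\<^sub>R b) \<partial>PiM (set L) (\<lambda>_. lborel))"
  using assms(2,3)
proof (induction L arbitrary: x)
  case Nil
  then show ?case
    by (simp add: PiM_empty nn_integral_count_space_finite euclidean_representation)
next
  case (Cons a L)
  interpret product_sigma_finite "\<lambda>_::'a. lborel :: real measure"
    by standard
  have a: "a \<in> Basis" "a \<notin> set L" using Cons by auto
  have "iter_integral (a # L) f x = (\<integral>\<^sup>+t. (\<integral>\<^sup>+y. f (\<Sum>b\<in>Basis.
      (if b \<in> set L then y b else (x + (t - x \<bullet> a) *\<^sub>R a) \<bullet> b) *\<^sub>R b) \<partial>PiM (set L) (\<lambda>_. lborel)) \<partial>lborel)"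
    using Cons by (simp add: line_integral_def)
  also have "\<dots> = (\<integral>\<^sup>+t. (\<integral>\<^sup>+y. f (\<Sum>b\<in>Basis.
      (if b \<in> set (a # L) then (y(a := t)) b else x \<bullet> b) *\<^sub>R b) \<partial>PiM (set L) (\<lambda>_. lborel)) \<partial>lborel)"
    using a by (intro nn_integral_cong arg_cong[where f = f] sum.cong) (auto simp: inner_simps inner_Basis)
  also have "\<dots> = (\<integral>\<^sup>+y. f (\<Sum>b\<in>Basis.
      (if b \<in> set (a # L) then y b else x \<bullet> b) *\<^sub>R b) \<partial>PiM (insert a (set L)) (\<lambda>_. lborel))"
  proof (subst product_nn_integral_insert_rev)
    have "(\<lambda>y. (if b \<in> set (a # L) then y b else x \<bullet> b) *\<^sub>R b)
        \<in> borel_measurable (PiM (insert a (set L)) (\<lambda>_. lborel))" for b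
      by (cases "b \<in> set (a # L)") (auto intro!: borel_measurable_scaleR measurable_component_singleton)
    then show "(\<lambda>y. f (\<Sum>b\<in>Basis. (if b \<in> set (a # L) then y b else x \<bullet> b) *\<^sub>R b))
        \<in> borel_measurable (PiM (insert a (set L)) (\<lambda>_. lborel))"
      by (intro measurable_compose[OF _ assms(1)] borel_measurable_sum)
  qed (use a in auto)
  finally show ?case by simp
qed

lemma iter_integral_full:
  fixes f :: "'a::euclidean_space \<Rightarrow> ennreal"
  assumes [measurable]: "f \<in> borel_measurable borel" and L: "distinct L" "set L = Basis"
  shows "iter_integral L f x = (\<integral>\<^sup>+y. f y \<partial>lborel)"
proof -
  have "iter_integral L f x = (\<integral>\<^sup>+y. f (\<Sum>b\<in>Basis. y b *\<^sub>R b) \<partial>PiM Basis (\<lambda>_. lborel))"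
    using L by (simp add: iter_integral_eq_PiM)
  also have "\<dots> = (\<integral>\<^sup>+y. f y \<partial>lborel)"
    by (subst lborel_eq) (simp add: nn_integral_distr)
  finally show ?thesis .
qed

text \<open>Working with the power \<open>DIM('a) - 1\<close> avoids roots of extended reals. The
  coordinates are integrated one at a time: the factor belonging to the current coordinate is
  constant along it and leaves the integral, and the other \<open>DIM('a) - 1\<close> factors are
  exactly as many as the generalised Hoelder inequality separates.\<close>

theorem gagliardo_inequality:
  fixes g :: "'a::euclidean_space \<Rightarrow> ennreal" and h :: "'a \<Rightarrow> 'a \<Rightarrow> ennreal"
  assumes dim: "DIM('a) \<ge> 2"
    and g [measurable]: "g \<in> borel_measurable borel"
    and h [measurable]: "\<And>b. h b \<in> borel_measurable borel"
    and le: "\<And>x. g x ^ (DIM('a) - 1) \<le> (\<Prod>b\<in>Basis. line_integral b (h b) x)"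
  shows "(\<integral>\<^sup>+x. g x \<partial>lborel) ^ (DIM('a) - 1) \<le> (\<Prod>b\<in>Basis. \<integral>\<^sup>+x. h b x \<partial>lborel)"
proof -
  \<comment> \<open>Induction invariant: in every factor \<open>h b\<close> is integrated over the
    directions in \<open>L\<close> and over \<open>b\<close>. If \<open>b\<close> already lies in
    \<open>L\<close>, this is no extra integration, so adding \<open>a\<close> to \<open>L\<close>
    leaves the factor of \<open>a\<close> unchanged.\<close>
  define H where "H L b = iter_integral L (if b \<in> set L then h b else line_integral b (h b))" for L b
  have Hm [measurable]: "H L b \<in> borel_measurable borel" for L b
    by (simp add: H_def)
  have main: "iter_integral L g x ^ (DIM('a) - 1) \<le> (\<Prod>b\<in>Basis. H L b x)"
    if "distinct L" "set L \<subseteq> Basis" for L x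
    using that
  proof (induction L arbitrary: x)
    case Nil
    then show ?case using le by (simp add: H_def)
  next
    case (Cons a L)
    have a: "a \<in> Basis" "a \<notin> set L" using Cons by auto
    let ?p = "\<lambda>t. x + (t - x \<bullet> a) *\<^sub>R a"
    have card: "card (Basis - {a}) = DIM('a) - 1"
      using a by simp
    have ne: "Basis - {a} \<noteq> {}"
      using card dim by (metis One_nat_def card.empty diff_is_0_eq not_less_eq_eq numeral_2_eq_2)
    have Ha: "H L a = line_integral a (iter_integral L (h a))"
      using a Cons by (simp add: H_def line_integral_iter_commute)
    have const: "H L a (?p t) = H (a # L) a x" for t
      using a Ha line_integral_shift[OF a(1)] by (simp add: H_def)
    have "(\<integral>\<^sup>+t. iter_integral L g (?p t) \<partial>lborel) ^ card (Basis - {a})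
        \<le> H (a # L) a x * (\<Prod>b\<in>Basis - {a}. \<integral>\<^sup>+t. H L b (?p t) \<partial>lborel)"
    proof (rule nn_integral_prod_power_le)
      fix t
      have "iter_integral L g (?p t) ^ (DIM('a) - 1) \<le> (\<Prod>b\<in>Basis. H L b (?p t))"
        using Cons by simp
      also have "\<dots> = H (a # L) a x * (\<Prod>b\<in>Basis - {a}. H L b (?p t))"
        using a const by (subst prod.remove[of Basis a]) auto
      finally show "iter_integral L g (?p t) ^ card (Basis - {a})
          \<le> H (a # L) a x * (\<Prod>b\<in>Basis - {a}. H L b (?p t))"
        using card by simp
    qed (use ne in \<open>auto simp: g\<close>)
    moreover have "(\<integral>\<^sup>+t. H L b (?p t) \<partial>lborel) = H (a # L) b x" if "b \<in> Basis - {a}" for b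
      using that by (simp add: H_def line_integral_def)
    ultimately have "iter_integral (a # L) g x ^ (DIM('a) - 1)
        \<le> H (a # L) a x * (\<Prod>b\<in>Basis - {a}. H (a # L) b x)"
      using card by (simp add: line_integral_def)
    also have "\<dots> = (\<Prod>b\<in>Basis. H (a # L) b x)"
      using a by (subst prod.remove[of Basis a]) auto
    finally show ?case .
  qed
  obtain L :: "'a list" where L: "distinct L" "set L = Basis"
    using finite_distinct_list[OF finite_Basis] by blast
  have "(\<Prod>b\<in>Basis. H L b 0) = (\<Prod>b\<in>Basis. \<integral>\<^sup>+x. h b x \<partial>lborel)"
    using L by (intro prod.cong) (auto simp: H_def iter_integral_full)
  then show ?thesis
    using main[of L 0] L iter_integral_full[of g L 0] by simp
qed

section \<open>The Sobolev inequality\<close>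

text \<open>In the form \<open>s * \<bar>s\<bar> powr (p - 2)\<close> the derivative needs no case
  distinction on the sign and is visibly continuous at 0, where \<open>p > 2\<close> makes the
  difference quotient vanish.\<close>

lemma DERIV_abs_powr:
  fixes s p :: real
  assumes "p > 2"
  shows "((\<lambda>s. \<bar>s\<bar> powr p) has_real_derivative p * (s * \<bar>s\<bar> powr (p - 2))) (at s)"
proof (cases "s = 0")
  case True
  have lim: "((\<lambda>h::real. h * \<bar>h\<bar> powr (p - 2)) \<longlongrightarrow> 0 * \<bar>0\<bar> powr (p - 2)) (at 0)"
    using assms by (intro tendsto_intros) (auto simp: eventually_at_filter)
  have "\<bar>h\<bar> powr p / h = h * \<bar>h\<bar> powr (p - 2)" if "h \<noteq> 0" for h :: real
  proof -
    have "\<bar>h\<bar> powr p = \<bar>h\<bar> powr (p - 2) * \<bar>h\<bar> powr 2"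
      by (subst powr_add[symmetric]) simp
    also have "\<bar>h\<bar> powr 2 = h * h"
      using that by (simp add: powr_numeral power2_eq_square)
    finally show ?thesis using that by simp
  qed
  then have "((\<lambda>h::real. \<bar>h\<bar> powr p / h) \<longlongrightarrow> 0) (at 0)"
    using lim by (auto intro: Lim_transform_eventually simp: eventually_at_filter)
  then show ?thesis
    using True assms by (simp add: DERIV_def)
next
  case False
  have "((\<lambda>s. \<bar>s\<bar> powr p) has_real_derivative p * \<bar>s\<bar> powr (p - 1) * sgn s) (at s)"
  proof (cases "s > 0")
    case True
    have "((\<lambda>s. s powr p) has_real_derivative p * s powr (p - 1)) (at s)"
      using True by (auto intro!: derivative_eq_intros)
    then have "((\<lambda>s. \<bar>s\<bar> powr p) has_real_derivative p * s powr (p - 1)) (at s)"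
      by (rule has_field_derivative_transform_within[where d = s]) (use True in \<open>auto simp: dist_real_def\<close>)
    then show ?thesis using True by simp
  next
    case False
    have "((\<lambda>s. (- s) powr p) has_real_derivative - p * (- s) powr (p - 1)) (at s)"
      using False \<open>s \<noteq> 0\<close> by (auto intro!: derivative_eq_intros)
    then have "((\<lambda>s. \<bar>s\<bar> powr p) has_real_derivative - p * (- s) powr (p - 1)) (at s)"
      by (rule has_field_derivative_transform_within[where d = "- s"])
         (use False \<open>s \<noteq> 0\<close> in \<open>auto simp: dist_real_def\<close>)
    then show ?thesis using False \<open>s \<noteq> 0\<close> by simp
  qed
  moreover have "p * \<bar>s\<bar> powr (p - 1) * sgn s = p * (s * \<bar>s\<bar> powr (p - 2))"
  proof -
    have "\<bar>s\<bar> powr (p - 1) = \<bar>s\<bar> powr (p - 2) * \<bar>s\<bar> powr 1"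
      by (subst powr_add[symmetric]) simp
    then show ?thesis using False by (simp add: mult_ac abs_mult_sgn)
  qed
  ultimately show ?thesis by simp
qed

text \<open>Fundamental theorem of calculus for \<open>\<bar>\<phi>\<bar> powr p\<close> along the
  line through \<open>x\<close>, started where \<phi> vanishes. Extending the integral of the
  absolute derivative to the whole line makes the bound independent of the coordinate along
  \<open>b\<close>.\<close>

lemma abs_powr_le_line_integral:
  fixes \<phi> :: "'a::euclidean_space \<Rightarrow> real"
  assumes b: "b \<in> Basis" and p: "p > 2"
    and contD: "continuous_on UNIV (D b)"
    and deriv: "\<And>x t. ((\<lambda>t. \<phi> (x + t *\<^sub>R b)) has_real_derivative D b (x + t *\<^sub>R b)) (at t)"
    and supp: "\<And>x. norm x > R \<Longrightarrow> \<phi> x = 0"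
  shows "ennreal (\<bar>\<phi> x\<bar> powr p) \<le> line_integral b (\<lambda>y. ennreal (p * \<bar>\<phi> y\<bar> powr (p - 1) * \<bar>D b y\<bar>)) x"
proof -
  let ?l = "\<lambda>t. x + (t - x \<bullet> b) *\<^sub>R b"
  define \<psi> where "\<psi> t = \<phi> (?l t)" for t
  define \<psi>' where "\<psi>' t = D b (?l t)" for t
  define F' where "F' t = p * (\<psi> t * \<bar>\<psi> t\<bar> powr (p - 2)) * \<psi>' t" for t
  have d\<psi>: "(\<psi> has_real_derivative \<psi>' t) (at t)" for t
    using deriv[of "x - (x \<bullet> b) *\<^sub>R b" t] by (simp add: \<psi>_def[abs_def] \<psi>'_def algebra_simps)
  then have c\<psi>: "continuous_on UNIV \<psi>"
    by (meson DERIV_isCont continuous_at_imp_continuous_on)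
  have c\<psi>': "continuous_on UNIV \<psi>'"
    unfolding \<psi>'_def by (intro continuous_on_compose2[OF contD] continuous_intros) auto
  have dF: "((\<lambda>t. \<bar>\<psi> t\<bar> powr p) has_real_derivative F' t) (at t)" for t
    unfolding F'_def by (rule DERIV_chain2[OF DERIV_abs_powr[OF p] d\<psi>])
  have cF: "continuous_on UNIV F'"
    unfolding F'_def using p by (intro continuous_intros c\<psi> c\<psi>' continuous_on_powr') auto
  \<comment> \<open>Below \<open>x \<bullet> b\<close>, so that the interval is oriented correctly,
    and below \<open>- \<bar>R\<bar>\<close>, so that the starting point lies outside the
    support.\<close>
  define a where "a = min (x \<bullet> b) (- \<bar>R\<bar> - 1)"
  have "norm (?l a) \<ge> \<bar>?l a \<bullet> b\<bar>"
    using b by (intro Basis_le_norm) auto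
  then have "norm (?l a) > R"
    using b by (auto simp: inner_simps a_def)
  then have \<psi>a: "\<psi> a = 0"
    by (simp add: \<psi>_def supp)
  have F: "has_bochner_integral lborel (\<lambda>t. F' t * indicator {a..x \<bullet> b} t) (\<bar>\<psi> (x \<bullet> b)\<bar> powr p - \<bar>\<psi> a\<bar> powr p)"
    by (rule has_bochner_integral_FTC_Icc_real)
      (use dF cF in \<open>auto simp: a_def continuous_on_eq_continuous_at\<close>)
  then have "(\<integral>t. F' t * indicator {a..x \<bullet> b} t \<partial>lborel) = \<bar>\<phi> x\<bar> powr p"
    by (simp add: has_bochner_integral_iff \<psi>a, simp add: \<psi>_def)
  then have "ennreal (\<bar>\<phi> x\<bar> powr p) = ennreal (norm (\<integral>t. F' t * indicator {a..x \<bullet> b} t \<partial>lborel))"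
    by simp
  also have "\<dots> \<le> (\<integral>\<^sup>+t. norm (F' t * indicator {a..x \<bullet> b} t) \<partial>lborel)"
    using F by (intro integral_norm_bound_ennreal) (simp add: has_bochner_integral_iff)
  also have "\<dots> \<le> (\<integral>\<^sup>+t. ennreal (p * \<bar>\<psi> t\<bar> powr (p - 1) * \<bar>\<psi>' t\<bar>) \<partial>lborel)"
  proof (intro nn_integral_mono ennreal_leI)
    fix t
    have "\<bar>\<psi> t\<bar> powr (p - 1) = \<bar>\<psi> t\<bar> powr 1 * \<bar>\<psi> t\<bar> powr (p - 2)"
      by (subst powr_add[symmetric]) simp
    then have "p * \<bar>\<psi> t\<bar> powr (p - 1) * \<bar>\<psi>' t\<bar> = \<bar>F' t\<bar>"
      using p by (simp add: F'_def abs_mult)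
    then show "norm (F' t * indicator {a..x \<bullet> b} t) \<le> p * \<bar>\<psi> t\<bar> powr (p - 1) * \<bar>\<psi>' t\<bar>"
      by (simp add: indicator_def)
  qed
  finally show ?thesis
    by (simp add: line_integral_def \<psi>_def \<psi>'_def)
qed

lemma prod_mono_ennreal:
  fixes f g :: "'i \<Rightarrow> ennreal"
  assumes "\<And>i. i \<in> A \<Longrightarrow> f i \<le> g i"
  shows "prod f A \<le> prod g A"
  using assms by (induction A rule: infinite_finite_induct) (auto intro!: mult_mono)

text \<open>Gagliardo's inequality is applied to \<open>\<bar>\<phi>\<bar> powr q\<close>, bounded
  through the derivative of \<open>\<bar>\<phi>\<bar> powr p\<close>. The exponents solve two
  equations: \<open>q * (d - 1) = p * d\<close> matches the powers in that inequality, and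
  \<open>2 * (p - 1) = q\<close> makes Cauchy-Schwarz reproduce the integral of
  \<open>\<bar>\<phi>\<bar> powr q\<close>, which is then cancelled. The result is left as a power;
  its 2d-th root is the usual inequality with constant \<open>p\<close>.\<close>

theorem sobolev_inequality:
  fixes \<phi> :: "'a::euclidean_space \<Rightarrow> real"
  assumes dim: "DIM('a) \<ge> 3"
    and cont: "continuous_on UNIV \<phi>"
    and contD: "\<And>b. b \<in> Basis \<Longrightarrow> continuous_on UNIV (D b)"
    and deriv: "\<And>b x t. b \<in> Basis \<Longrightarrow> ((\<lambda>t. \<phi> (x + t *\<^sub>R b)) has_real_derivative D b (x + t *\<^sub>R b)) (at t)"
    and supp: "\<And>x. norm x > R \<Longrightarrow> \<phi> x = 0"
    and q: "q = 2 * DIM('a) / (DIM('a) - 2)" and p: "p = 2 * (DIM('a) - 1) / (DIM('a) - 2)"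
  shows "(\<integral>\<^sup>+x. ennreal (\<bar>\<phi> x\<bar> powr q) \<partial>lborel) < top"
    and "(\<integral>\<^sup>+x. ennreal (\<bar>\<phi> x\<bar> powr q) \<partial>lborel) ^ (DIM('a) - 2)
      \<le> (ennreal (p\<^sup>2) * (\<integral>\<^sup>+x. ennreal (\<Sum>b\<in>Basis. (D b x)\<^sup>2) \<partial>lborel)) ^ DIM('a)"
proof -
  define d where "d = DIM('a)"
  define X where "X = (\<integral>\<^sup>+x. ennreal (\<bar>\<phi> x\<bar> powr q) \<partial>lborel)"
  define Y where "Y = (\<integral>\<^sup>+x. ennreal (\<Sum>b\<in>Basis. (D b x)\<^sup>2) \<partial>lborel)"
  have d: "d \<ge> 3" using dim by (simp add: d_def)
  have p2: "p > 2" and q1: "q > 1" and pq: "2 * (p - 1) = q" "q * (real d - 1) = p * real d"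
    using d by (auto simp: p q d_def field_simps of_nat_diff)
  have [measurable]: "\<phi> \<in> borel_measurable borel"
    using cont by (rule borel_measurable_continuous_onI)
  define D' where "D' b = (if b \<in> Basis then D b else (\<lambda>_. 0))" for b
  have [measurable]: "D' b \<in> borel_measurable borel" for b
    using contD[of b] by (auto simp: D'_def intro: borel_measurable_continuous_onI)
  have "integrable lborel (\<lambda>x. indicator (cball 0 R) x *\<^sub>R (\<bar>\<phi> x\<bar> powr q))"
    using q1 by (intro borel_integrable_compact continuous_intros continuous_on_powr' continuous_on_subset[OF cont]) auto
  also have "(\<lambda>x. indicator (cball 0 R) x *\<^sub>R (\<bar>\<phi> x\<bar> powr q)) = (\<lambda>x. \<bar>\<phi> x\<bar> powr q)"
    using supp by (auto simp: indicator_def fun_eq_iff not_le[symmetric])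
  finally show fin: "(\<integral>\<^sup>+x. ennreal (\<bar>\<phi> x\<bar> powr q) \<partial>lborel) < top"
    by (simp add: integrable_iff_bounded)
  define h where "h b x = ennreal (p * \<bar>\<phi> x\<bar> powr (p - 1) * \<bar>D' b x\<bar>)" for b x
  have [measurable]: "h b \<in> borel_measurable borel" for b
    unfolding h_def[abs_def] by measurable
  have gag: "X ^ (DIM('a) - 1) \<le> (\<Prod>b\<in>Basis. \<integral>\<^sup>+x. h b x \<partial>lborel)"
    unfolding X_def
  proof (rule gagliardo_inequality)
    fix x
    have "(\<bar>\<phi> x\<bar> powr q) ^ (d - 1) = (\<bar>\<phi> x\<bar> powr p) ^ d"
      using d by (cases "\<phi> x = 0") (auto simp: powr_realpow[symmetric] powr_powr pq(2) zero_power of_nat_diff)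
    then have "ennreal (\<bar>\<phi> x\<bar> powr q) ^ (DIM('a) - 1) = (\<Prod>b\<in>(Basis :: 'a set). ennreal (\<bar>\<phi> x\<bar> powr p))"
      by (simp add: ennreal_power d_def)
    also have "\<dots> \<le> (\<Prod>b\<in>Basis. line_integral b (h b) x)"
      unfolding h_def
      by (intro prod_mono_ennreal abs_powr_le_line_integral[where R = R])
         (use p2 contD deriv supp in \<open>auto simp: D'_def\<close>)
    finally show "ennreal (\<bar>\<phi> x\<bar> powr q) ^ (DIM('a) - 1) \<le> (\<Prod>b\<in>Basis. line_integral b (h b) x)" .
  qed (use d in \<open>auto simp: d_def\<close>)
  have "(d - 1) * 2 = d + (d - 2)" using d by simp
  then have sq: "(X ^ (d - 1))\<^sup>2 = X ^ (d + (d - 2))"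
    by (metis power_mult)
  have "(X ^ (d - 1))\<^sup>2 \<le> (\<Prod>b\<in>Basis. \<integral>\<^sup>+x. h b x \<partial>lborel)\<^sup>2"
    using gag by (intro power_mono) (auto simp: d_def)
  also have "\<dots> = (\<Prod>b\<in>Basis. (\<integral>\<^sup>+x. h b x \<partial>lborel)\<^sup>2)"
    by (simp add: prod_power_distrib)
  also have "\<dots> \<le> (\<Prod>b\<in>(Basis :: 'a set). ennreal (p\<^sup>2) * Y * X)"
  proof (intro prod_mono_ennreal)
    fix b :: 'a assume b: "b \<in> Basis"
    have "(\<integral>\<^sup>+x. h b x \<partial>lborel)\<^sup>2 = (\<integral>\<^sup>+x. ennreal (p * \<bar>D' b x\<bar>) * ennreal (\<bar>\<phi> x\<bar> powr (p - 1)) \<partial>lborel)\<^sup>2"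
      unfolding h_def using p2
      by (intro arg_cong[where f = "\<lambda>x. x\<^sup>2"] nn_integral_cong) (simp add: ennreal_mult[symmetric] mult_ac)
    also have "\<dots> \<le> (\<integral>\<^sup>+x. (ennreal (p * \<bar>D' b x\<bar>))\<^sup>2 \<partial>lborel) * (\<integral>\<^sup>+x. (ennreal (\<bar>\<phi> x\<bar> powr (p - 1)))\<^sup>2 \<partial>lborel)"
      by (rule Cauchy_Schwarz_nn_integral) auto
    also have "(\<integral>\<^sup>+x. (ennreal (\<bar>\<phi> x\<bar> powr (p - 1)))\<^sup>2 \<partial>lborel) = X"
      unfolding X_def
    proof (intro nn_integral_cong)
      fix x
      have "(\<bar>\<phi> x\<bar> powr (p - 1))\<^sup>2 = \<bar>\<phi> x\<bar> powr q"
        unfolding pq(1)[symmetric] by (simp add: power2_eq_square powr_add[symmetric])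
      then show "(ennreal (\<bar>\<phi> x\<bar> powr (p - 1)))\<^sup>2 = ennreal (\<bar>\<phi> x\<bar> powr q)"
        by (simp add: ennreal_power)
    qed
    also have "(\<integral>\<^sup>+x. (ennreal (p * \<bar>D' b x\<bar>))\<^sup>2 \<partial>lborel) = ennreal (p\<^sup>2) * (\<integral>\<^sup>+x. ennreal ((D' b x)\<^sup>2) \<partial>lborel)"
      using p2 by (simp add: nn_integral_cmult[symmetric] ennreal_power power_mult_distrib ennreal_mult)
    also have "\<dots> * X \<le> ennreal (p\<^sup>2) * Y * X"
      unfolding Y_def using b
      by (intro mult_right_mono mult_left_mono nn_integral_mono ennreal_leI)
         (auto simp: D'_def intro!: member_le_sum)
    finally show "(\<integral>\<^sup>+x. h b x \<partial>lborel)\<^sup>2 \<le> ennreal (p\<^sup>2) * Y * X" by simp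
  qed
  also have "\<dots> = (ennreal (p\<^sup>2) * Y) ^ d * X ^ d"
    by (simp add: d_def power_mult_distrib)
  finally have *: "X ^ (d + (d - 2)) \<le> (ennreal (p\<^sup>2) * Y) ^ d * X ^ d"
    unfolding sq .
  \<comment> \<open>Cancelling \<open>X ^ d\<close> is legitimate only for
    \<open>0 < X < top\<close>; finiteness comes from the bounded support.\<close>
  have "X ^ (d - 2) \<le> (ennreal (p\<^sup>2) * Y) ^ d"
  proof (cases "X = 0")
    case True
    then show ?thesis using d by (simp add: zero_power)
  next
    case False
    have "X ^ d * X ^ (d - 2) \<le> X ^ d * (ennreal (p\<^sup>2) * Y) ^ d"
      using * by (simp add: power_add mult_ac)
    then show ?thesis
      using False fin by (subst (asm) ennreal_mult_le_mult_iff) (auto simp: X_def power_eq_top_ennreal)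
  qed
  then show "(\<integral>\<^sup>+x. ennreal (\<bar>\<phi> x\<bar> powr q) \<partial>lborel) ^ (DIM('a) - 2)
      \<le> (ennreal (p\<^sup>2) * (\<integral>\<^sup>+x. ennreal (\<Sum>b\<in>Basis. (D b x)\<^sup>2) \<partial>lborel)) ^ DIM('a)"
    by (simp add: X_def Y_def d_def)
qed

section \<open>Square integrable functions\<close>

text \<open>One notion for scalar functions and vector fields alike. Functions are not identified
  almost everywhere, so \<open>L2n\<close> is only a seminorm.\<close>

definition sqint :: "'a measure \<Rightarrow> ('a \<Rightarrow> 'b::euclidean_space) \<Rightarrow> bool" where
  "sqint M F \<longleftrightarrow> F \<in> borel_measurable M \<and> integrable M (\<lambda>x. (norm (F x))\<^sup>2)"

definition L2n :: "'a measure \<Rightarrow> ('a \<Rightarrow> 'b::euclidean_space) \<Rightarrow> real" where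
  "L2n M F = sqrt (\<integral>x. (norm (F x))\<^sup>2 \<partial>M)"

abbreviation L2dist :: "'a measure \<Rightarrow> ('a \<Rightarrow> 'b::euclidean_space) \<Rightarrow> ('a \<Rightarrow> 'b) \<Rightarrow> real" where
  "L2dist M F G \<equiv> L2n M (\<lambda>x. F x - G x)"

lemma sqint_measurable: "sqint M F \<Longrightarrow> F \<in> borel_measurable M"
  by (simp add: sqint_def)

lemma sqint_integrable: "sqint M F \<Longrightarrow> integrable M (\<lambda>x. (norm (F x))\<^sup>2)"
  by (simp add: sqint_def)

lemma L2n_nonneg [simp]: "L2n M F \<ge> 0"
  by (simp add: L2n_def)

lemma L2n_square: "(L2n M F)\<^sup>2 = (\<integral>x. (norm (F x))\<^sup>2 \<partial>M)"
  by (simp add: L2n_def)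

lemma sqint_norm_mult:
  assumes F: "sqint M F" and G: "sqint M G"
  shows "integrable M (\<lambda>x. norm (F x) * norm (G x))"
proof (rule Bochner_Integration.integrable_bound)
  show "integrable M (\<lambda>x. (norm (F x))\<^sup>2 + (norm (G x))\<^sup>2)"
    using F G by (simp add: sqint_def)
  show "(\<lambda>x. norm (F x) * norm (G x)) \<in> borel_measurable M"
    using F G by (auto simp: sqint_def)
  have ab: "\<bar>a * b\<bar> \<le> a\<^sup>2 + b\<^sup>2" for a b :: real
  proof -
    have "2 * (\<bar>a\<bar> * \<bar>b\<bar>) \<le> a\<^sup>2 + b\<^sup>2"
      using sum_squares_bound[of "\<bar>a\<bar>" "\<bar>b\<bar>"] by simp
    moreover have "0 \<le> \<bar>a\<bar> * \<bar>b\<bar>" by simp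
    ultimately show ?thesis unfolding abs_mult by linarith
  qed
  show "AE x in M. norm (norm (F x) * norm (G x)) \<le> norm ((norm (F x))\<^sup>2 + (norm (G x))\<^sup>2)"
  proof (rule AE_I2)
    fix x
    show "norm (norm (F x) * norm (G x)) \<le> norm ((norm (F x))\<^sup>2 + (norm (G x))\<^sup>2)"
      using ab[of "norm (F x)" "norm (G x)"] by simp
  qed
qed

lemma sqint_inner:
  assumes F: "sqint M F" and G: "sqint M G"
  shows "integrable M (\<lambda>x. F x \<bullet> G x)"
proof (rule Bochner_Integration.integrable_bound[OF sqint_norm_mult[OF F G]])
  show "(\<lambda>x. F x \<bullet> G x) \<in> borel_measurable M"
    using F G by (auto simp: sqint_def)
  show "AE x in M. norm (F x \<bullet> G x) \<le> norm (norm (F x) * norm (G x))"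
    by (simp add: Cauchy_Schwarz_ineq2)
qed

lemma sqint_add:
  assumes F: "sqint M F" and G: "sqint M G"
  shows "sqint M (\<lambda>x. F x + G x)"
proof -
  have "(\<lambda>x. (norm (F x + G x))\<^sup>2) = (\<lambda>x. (norm (F x))\<^sup>2 + 2 * (F x \<bullet> G x) + (norm (G x))\<^sup>2)"
    by (simp add: power2_norm_eq_inner inner_simps inner_commute fun_eq_iff)
  then show ?thesis
    using F G sqint_inner[OF F G] by (auto simp: sqint_def)
qed

lemma sqint_scaleR: "sqint M F \<Longrightarrow> sqint M (\<lambda>x. c *\<^sub>R F x)"
  by (auto simp: sqint_def power_mult_distrib)

lemma sqint_diff:
  assumes F: "sqint M F" and G: "sqint M G"
  shows "sqint M (\<lambda>x. F x - G x)"
  using sqint_add[OF F sqint_scaleR[OF G, of "-1"]] by simp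

lemma L2n_Cauchy_Schwarz:
  assumes F: "sqint M F" and G: "sqint M G"
  shows "(\<integral>x. norm (F x) * norm (G x) \<partial>M) \<le> L2n M F * L2n M G"
proof -
  define a b c where "a = (\<integral>x. (norm (F x))\<^sup>2 \<partial>M)" and "b = (\<integral>x. (norm (G x))\<^sup>2 \<partial>M)"
    and "c = (\<integral>x. norm (F x) * norm (G x) \<partial>M)"
  \<comment> \<open>A nonnegative quadratic in \<open>t\<close> has nonpositive discriminant. In the
    degenerate case \<open>a = 0\<close> it is linear, and for \<open>c \<noteq> 0\<close> the
    choice \<open>t = (b + 1) / (2 * c)\<close> would give the value -1.\<close>
  have q: "0 \<le> t\<^sup>2 * a - 2 * t * c + b" for t
  proof -
    have "0 \<le> (\<integral>x. (t * norm (F x) - norm (G x))\<^sup>2 \<partial>M)"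
      by (rule Bochner_Integration.integral_nonneg) simp
    also have "\<dots> = (\<integral>x. t\<^sup>2 * (norm (F x))\<^sup>2 - 2 * t * (norm (F x) * norm (G x)) + (norm (G x))\<^sup>2 \<partial>M)"
      by (rule Bochner_Integration.integral_cong) (auto simp: power2_eq_square algebra_simps)
    also have "\<dots> = t\<^sup>2 * a - 2 * t * c + b"
      using F G sqint_norm_mult[OF F G] by (simp add: a_def b_def c_def sqint_def)
    finally show ?thesis .
  qed
  have ab: "a \<ge> 0" "b \<ge> 0" "c \<ge> 0" by (auto simp: a_def b_def c_def)
  have "c\<^sup>2 \<le> a * b"
  proof (cases "a = 0")
    case True
    have "c = 0"
    proof (rule ccontr)
      assume "c \<noteq> 0"
      then have "2 * ((b + 1) / (2 * c)) * c = b + 1" by simp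
      then show False using q[of "(b + 1) / (2 * c)"] True by simp
    qed
    then show ?thesis using True by simp
  next
    case False
    then have "(c / a)\<^sup>2 * a - 2 * (c / a) * c + b = b - c\<^sup>2 / a"
      by (simp add: field_simps power2_eq_square)
    then have "c\<^sup>2 / a \<le> b" using q[of "c / a"] by simp
    then show ?thesis using False ab by (simp add: field_simps)
  qed
  then have "c \<le> sqrt (a * b)"
    by (simp add: real_le_rsqrt)
  then show ?thesis
    by (simp add: L2n_def a_def b_def c_def real_sqrt_mult)
qed

lemma L2n_inner_le:
  assumes F: "sqint M F" and G: "sqint M G"
  shows "\<bar>\<integral>x. F x \<bullet> G x \<partial>M\<bar> \<le> L2n M F * L2n M G"
proof -
  have "\<bar>\<integral>x. F x \<bullet> G x \<partial>M\<bar> \<le> (\<integral>x. \<bar>F x \<bullet> G x\<bar> \<partial>M)"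
    by (rule integral_abs_bound)
  also have "\<dots> \<le> (\<integral>x. norm (F x) * norm (G x) \<partial>M)"
    using sqint_inner[OF F G] sqint_norm_mult[OF F G]
    by (intro integral_mono) (auto simp: Cauchy_Schwarz_ineq2)
  also have "\<dots> \<le> L2n M F * L2n M G"
    by (rule L2n_Cauchy_Schwarz[OF F G])
  finally show ?thesis .
qed

lemma L2n_inner_self: "(\<integral>x. F x \<bullet> F x \<partial>M) = (L2n M F)\<^sup>2"
  by (simp add: L2n_def power2_norm_eq_inner)

lemma L2n_triangle:
  assumes F: "sqint M F" and G: "sqint M G"
  shows "L2n M (\<lambda>x. F x + G x) \<le> L2n M F + L2n M G"
proof -
  have "(L2n M (\<lambda>x. F x + G x))\<^sup>2 = (\<integral>x. (norm (F x))\<^sup>2 + 2 * (F x \<bullet> G x) + (norm (G x))\<^sup>2 \<partial>M)"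
    unfolding L2n_square
    by (rule Bochner_Integration.integral_cong) (auto simp: power2_norm_eq_inner inner_simps inner_commute)
  also have "\<dots> = (L2n M F)\<^sup>2 + 2 * (\<integral>x. F x \<bullet> G x \<partial>M) + (L2n M G)\<^sup>2"
    using F G sqint_inner[OF F G] by (simp add: L2n_square sqint_def)
  also have "\<dots> \<le> (L2n M F + L2n M G)\<^sup>2"
    using L2n_inner_le[OF F G] by (simp add: power2_sum)
  finally show ?thesis
    by (rule power2_le_imp_le) simp
qed

lemma L2n_minus_commute: "L2dist M F G = L2dist M G F"
  by (simp add: L2n_def norm_minus_commute)

lemma L2n_triangle_diff:
  assumes "sqint M F" "sqint M G" "sqint M H"
  shows "L2dist M F H \<le> L2dist M F G + L2dist M G H"
  using L2n_triangle[OF sqint_diff[OF assms(1,2)] sqint_diff[OF assms(2,3)]] by simp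

lemma L2n_diff_bound:
  assumes "sqint M F" "sqint M G"
  shows "\<bar>L2n M F - L2n M G\<bar> \<le> L2dist M F G"
  using L2n_triangle[OF sqint_diff[OF assms] assms(2)]
    L2n_triangle[OF sqint_diff[OF assms(2,1)] assms(1)] L2n_minus_commute[of M F G] by simp

lemma L2n_tendsto_iff:
  "(\<lambda>n. L2n M (G n)) \<longlonglongrightarrow> 0 \<longleftrightarrow> (\<lambda>n. \<integral>x. (norm (G n x))\<^sup>2 \<partial>M) \<longlonglongrightarrow> 0"
proof
  assume "(\<lambda>n. L2n M (G n)) \<longlonglongrightarrow> 0"
  from tendsto_power[OF this, of 2] show "(\<lambda>n. \<integral>x. (norm (G n x))\<^sup>2 \<partial>M) \<longlonglongrightarrow> 0"
    by (simp add: L2n_square)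
next
  assume "(\<lambda>n. \<integral>x. (norm (G n x))\<^sup>2 \<partial>M) \<longlonglongrightarrow> 0"
  from tendsto_real_sqrt[OF this] show "(\<lambda>n. L2n M (G n)) \<longlonglongrightarrow> 0"
    by (simp add: L2n_def)
qed

lemma L2n_tendsto:
  assumes "\<And>n. sqint M (F n)" "sqint M G" "(\<lambda>n. L2dist M (F n) G) \<longlonglongrightarrow> 0"
  shows "(\<lambda>n. L2n M (F n)) \<longlonglongrightarrow> L2n M G"
proof -
  have "(\<lambda>n. L2n M (F n) - L2n M G) \<longlonglongrightarrow> 0"
    by (rule Lim_null_comparison[OF _ assms(3)]) (use assms(1,2) in \<open>simp add: L2n_diff_bound\<close>)
  then show ?thesis by (simp add: LIM_zero_iff)
qed

lemma L2_inner_tendsto: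
  assumes F: "\<And>n. sqint M (F n)" and G: "sqint M G" and H: "sqint M H"
    and lim: "(\<lambda>n. L2dist M (F n) G) \<longlonglongrightarrow> 0"
  shows "(\<lambda>n. \<integral>x. F n x \<bullet> H x \<partial>M) \<longlonglongrightarrow> (\<integral>x. G x \<bullet> H x \<partial>M)"
proof -
  have lim0: "(\<lambda>n. L2dist M (F n) G * L2n M H) \<longlonglongrightarrow> 0"
    using tendsto_mult_left_zero[OF lim] .
  have "norm ((\<integral>x. F n x \<bullet> H x \<partial>M) - (\<integral>x. G x \<bullet> H x \<partial>M)) \<le> L2dist M (F n) G * L2n M H" for n
  proof -
    have "(\<integral>x. F n x \<bullet> H x \<partial>M) - (\<integral>x. G x \<bullet> H x \<partial>M) = (\<integral>x. (F n x - G x) \<bullet> H x \<partial>M)"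
      using sqint_inner[OF F H] sqint_inner[OF G H] by (simp add: inner_diff_left)
    then show ?thesis
      using L2n_inner_le[OF sqint_diff[OF F G] H] by simp
  qed
  then have "(\<lambda>n. (\<integral>x. F n x \<bullet> H x \<partial>M) - (\<integral>x. G x \<bullet> H x \<partial>M)) \<longlonglongrightarrow> 0"
    by (intro Lim_null_comparison[OF always_eventually lim0] allI)
  then show ?thesis by (simp add: LIM_zero_iff)
qed

lemma L2_AE_subseq:
  assumes "\<And>n. sqint M (F n)" "sqint M G" "(\<lambda>n. L2dist M (F n) G) \<longlonglongrightarrow> 0"
  shows "\<exists>r. strict_mono r \<and> (AE x in M. (\<lambda>n. F (r n) x) \<longlonglongrightarrow> G x)"
proof -
  have "integrable M (\<lambda>x. (norm (F n x - G x))\<^sup>2)" for n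
    using sqint_diff[OF assms(1,2)] by (simp add: sqint_def)
  then obtain r :: "nat \<Rightarrow> nat" where r: "strict_mono r"
    and ae: "AE x in M. (\<lambda>n. (norm (F (r n) x - G x))\<^sup>2) \<longlonglongrightarrow> 0"
    using tendsto_L1_AE_subseq[of M "\<lambda>n x. (norm (F n x - G x))\<^sup>2"] assms(3)
    by (auto simp: L2n_tendsto_iff)
  have "AE x in M. (\<lambda>n. F (r n) x) \<longlonglongrightarrow> G x"
    using ae
  proof eventually_elim
    case (elim x)
    from tendsto_real_sqrt[OF elim] have "(\<lambda>n. norm (F (r n) x - G x)) \<longlonglongrightarrow> 0" by simp
    then show ?case by (simp add: tendsto_norm_zero_iff LIM_zero_iff)
  qed
  with r show ?thesis by blast
qed

lemma nn_integral_sq_eq: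
  "sqint M F \<Longrightarrow> (\<integral>\<^sup>+x. ennreal ((norm (F x))\<^sup>2) \<partial>M) = ennreal ((L2n M F)\<^sup>2)"
  unfolding L2n_square by (rule nn_integral_eq_integral) (auto simp: sqint_def)

text \<open>Fatou's lemma yields membership of the limit in \<open>L^2\<close> together with the
  bound. A bound that holds eventually is the form in which the Cauchy property delivers it.\<close>

lemma sqint_Fatou:
  fixes F :: "nat \<Rightarrow> 'a \<Rightarrow> 'b::euclidean_space"
  assumes F: "\<And>n. sqint M (F n)" and G: "G \<in> borel_measurable M"
    and ae: "AE x in M. (\<lambda>n. F n x) \<longlonglongrightarrow> G x"
    and bound: "eventually (\<lambda>n. L2n M (F n) \<le> e) sequentially"
  shows "sqint M G" "L2n M G \<le> e"
proof -
  have [measurable]: "\<And>n. F n \<in> borel_measurable M" "G \<in> borel_measurable M"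
    using F G by (auto simp: sqint_def)
  obtain n0 where "L2n M (F n0) \<le> e"
    using bound by (auto simp: eventually_sequentially)
  then have e: "e \<ge> 0" using L2n_nonneg order_trans by blast
  have "(\<integral>\<^sup>+x. ennreal ((norm (G x))\<^sup>2) \<partial>M) = (\<integral>\<^sup>+x. liminf (\<lambda>n. ennreal ((norm (F n x))\<^sup>2)) \<partial>M)"
  proof (rule nn_integral_cong_AE)
    show "AE x in M. ennreal ((norm (G x))\<^sup>2) = liminf (\<lambda>n. ennreal ((norm (F n x))\<^sup>2))"
      using ae
    proof eventually_elim
      case (elim x)
      have "(\<lambda>n. ennreal ((norm (F n x))\<^sup>2)) \<longlonglongrightarrow> ennreal ((norm (G x))\<^sup>2)"
        by (intro tendsto_intros elim)
      then show ?case by (rule lim_imp_Liminf[OF sequentially_bot, symmetric])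
    qed
  qed
  also have "\<dots> \<le> liminf (\<lambda>n. \<integral>\<^sup>+x. ennreal ((norm (F n x))\<^sup>2) \<partial>M)"
    by (rule nn_integral_liminf) simp
  also have "\<dots> = liminf (\<lambda>n. ennreal ((L2n M (F n))\<^sup>2))"
    using F by (simp add: nn_integral_sq_eq)
  also have "\<dots> \<le> ennreal (e\<^sup>2)"
  proof -
    have "liminf (\<lambda>n. ennreal ((L2n M (F n))\<^sup>2)) \<le> liminf (\<lambda>n. ennreal (e\<^sup>2))"
      using bound by (intro Liminf_mono) (auto elim!: eventually_mono intro!: ennreal_leI power_mono)
    then show ?thesis by (simp add: Liminf_const)
  qed
  finally have le: "(\<integral>\<^sup>+x. ennreal ((norm (G x))\<^sup>2) \<partial>M) \<le> ennreal (e\<^sup>2)" .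
  then show G: "sqint M G"
    unfolding sqint_def by (auto intro!: integrableI_bounded simp: le_less_trans)
  have "(L2n M G)\<^sup>2 \<le> e\<^sup>2"
    using le G by (simp add: nn_integral_sq_eq)
  then show "L2n M G \<le> e"
    using e by (rule power2_le_imp_le)
qed

text \<open>Riesz-Fischer for functions instead of classes: a rapidly converging subsequence
  converges almost everywhere, and Fatou's lemma upgrades this to convergence of the whole sequence
  in the seminorm.\<close>

theorem L2_complete:
  fixes F :: "nat \<Rightarrow> 'a \<Rightarrow> 'b::euclidean_space"
  assumes F: "\<And>n. sqint M (F n)"
    and Cauchy: "\<And>e. e > 0 \<Longrightarrow> \<exists>N. \<forall>m\<ge>N. \<forall>n\<ge>N. L2dist M (F m) (F n) < e"
  shows "\<exists>G. sqint M G \<and> (\<lambda>n. L2dist M (F n) G) \<longlonglongrightarrow> 0"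
proof -
  have [measurable]: "\<And>n. F n \<in> borel_measurable M"
    using F by (auto simp: sqint_def)
  have "\<exists>N. \<forall>m\<ge>N. \<forall>n\<ge>N. L2dist M (F m) (F n) < (1/4)^k" for k :: nat
    by (rule Cauchy) simp
  then obtain N where N: "\<And>k m n. m \<ge> N k \<Longrightarrow> n \<ge> N k \<Longrightarrow> L2dist M (F m) (F n) < (1/4)^k"
    by metis
  \<comment> \<open>Strictly increasing and at least \<open>N k\<close>, so that consecutive terms
    of the subsequence differ by less than \<open>(1/4)^k\<close>.\<close>
  define r where "r = rec_nat (N 0) (\<lambda>k s. max (Suc s) (N (Suc k)))"
  have rN: "r k \<ge> N k" for k by (cases k) (auto simp: r_def)
  have rS: "r (Suc k) > r k" for k by (simp add: r_def less_max_iff_disj)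
  then have r: "strict_mono r" by (simp add: strict_mono_Suc_iff)
  define a where "a k x = (norm (F (r (Suc k)) x - F (r k) x))\<^sup>2" for k x
  have [measurable]: "a k \<in> borel_measurable M" for k
    unfolding a_def[abs_def] by measurable
  have inta: "(\<integral>\<^sup>+x. ennreal (a k x) \<partial>M) \<le> ennreal ((1/16)^k)" for k
  proof -
    have "(L2n M (\<lambda>x. F (r (Suc k)) x - F (r k) x))\<^sup>2 \<le> ((1/4)^k)\<^sup>2"
      using N[of k "r (Suc k)" "r k"] rN[of k] rS[of k] by (intro power_mono) auto
    also have "((1/4::real)^k)\<^sup>2 = (1/16)^k"
      unfolding power2_eq_square power_mult_distrib[symmetric] by simp
    finally show ?thesis
      unfolding a_def nn_integral_sq_eq[OF sqint_diff[OF F F]] by (rule ennreal_leI)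
  qed
  \<comment> \<open>The squared steps have integral at most \<open>(1/16)^k\<close>, so with weights
    \<open>4^k\<close> the series still converges. Where its sum is finite, the squared steps are
    O(\<open>(1/4)^k\<close>) and the steps themselves O(\<open>(1/2)^k\<close>), hence
    summable.\<close>
  have "(\<integral>\<^sup>+x. (\<Sum>k. ennreal (4^k) * ennreal (a k x)) \<partial>M) = (\<Sum>k. \<integral>\<^sup>+x. ennreal (4^k) * ennreal (a k x) \<partial>M)"
    by (rule nn_integral_suminf) simp
  also have "\<dots> \<le> (\<Sum>k. ennreal ((1/4)^k))"
  proof (intro suminf_le)
    fix k
    have "(\<integral>\<^sup>+x. ennreal (4^k) * ennreal (a k x) \<partial>M) \<le> ennreal (4^k) * ennreal ((1/16)^k)"
      using inta[of k] by (subst nn_integral_cmult) (auto intro!: mult_left_mono)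
    also have "\<dots> = ennreal ((1/4)^k)"
      by (subst ennreal_mult[symmetric]) (simp, simp, unfold power_mult_distrib[symmetric], simp)
    finally show "(\<integral>\<^sup>+x. ennreal (4^k) * ennreal (a k x) \<partial>M) \<le> ennreal ((1/4)^k)" .
  qed auto
  also have "\<dots> < top"
    by (subst suminf_ennreal2[OF _ summable_geometric]) simp_all
  finally have "(\<integral>\<^sup>+x. (\<Sum>k. ennreal (4^k) * ennreal (a k x)) \<partial>M) \<noteq> \<infinity>" by simp
  then have "AE x in M. (\<Sum>k. ennreal (4^k) * ennreal (a k x)) \<noteq> \<infinity>"
    by (intro nn_integral_PInf_AE) auto
  then have conv: "AE x in M. convergent (\<lambda>k. F (r k) x)"
  proof eventually_elim
    case (elim x)
    then obtain K where K: "(\<Sum>k. ennreal (4^k) * ennreal (a k x)) = ennreal K" "K \<ge> 0"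
      by (metis ennreal_cases infinity_ennreal_def)
    have bnd: "norm (F (r (Suc k)) x - F (r k) x) \<le> sqrt K * (1/2)^k" for k
    proof -
      have "ennreal (4^k * a k x) \<le> (\<Sum>k. ennreal (4^k) * ennreal (a k x))"
        using sum_le_suminf[of "\<lambda>k. ennreal (4^k) * ennreal (a k x)" "{k}"]
        by (simp add: ennreal_mult a_def)
      then have "4^k * a k x \<le> K"
        using K by (simp add: a_def)
      then have "a k x \<le> K * (1/4)^k"
        by (simp add: power_one_over pos_le_divide_eq mult.commute)
      then have "sqrt (a k x) \<le> sqrt (K * (1/4)^k)" by simp
      also have "\<dots> = sqrt K * (1/2)^k"
      proof -
        have "(1/4::real)^k = ((1/2)^k)\<^sup>2"
          unfolding power2_eq_square power_mult_distrib[symmetric] by simp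
        then show ?thesis by (simp add: real_sqrt_mult)
      qed
      finally show ?thesis by (simp add: a_def)
    qed
    have "summable (\<lambda>k. F (r (Suc k)) x - F (r k) x)"
      by (rule summable_comparison_test'[OF summable_mult[OF summable_geometric] bnd]) simp
    then have "convergent (\<lambda>n. \<Sum>k<n. F (r (Suc k)) x - F (r k) x)"
      by (simp only: summable_iff_convergent)
    then have "convergent (\<lambda>n. F (r n) x - F (r 0) x)"
      by (simp only: sum_lessThan_telescope[of "\<lambda>k. F (r k) x"])
    then have "convergent (\<lambda>n. (F (r n) x - F (r 0) x) + F (r 0) x)"
      by (intro convergent_add convergent_const)
    then show ?case by simp
  qed
  define G where "G x = lim (\<lambda>k. F (r k) x)" for x
  have Gm [measurable]: "G \<in> borel_measurable M"
    unfolding G_def[abs_def] by (rule borel_measurable_lim_metric) simp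
  have aeG: "AE x in M. (\<lambda>k. F (r k) x) \<longlonglongrightarrow> G x"
    using conv by eventually_elim (simp add: G_def convergent_LIMSEQ_iff)
  have close: "sqint M (\<lambda>x. F n x - G x) \<and> L2dist M (F n) G \<le> e"
    if e: "e > 0" and n: "\<And>m. m \<ge> n \<Longrightarrow> L2dist M (F n) (F m) < e" for e n
  proof -
    have ev: "eventually (\<lambda>k. L2dist M (F n) (F (r k)) \<le> e) sequentially"
      unfolding eventually_sequentially
    proof (intro exI allI impI)
      fix k assume "n \<le> k"
      then have "n \<le> r k" using seq_suble[OF r, of k] by simp
      then show "L2dist M (F n) (F (r k)) \<le> e" using n less_imp_le by blast
    qed
    have ae: "AE x in M. (\<lambda>k. F n x - F (r k) x) \<longlonglongrightarrow> F n x - G x"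
      using aeG by eventually_elim (intro tendsto_intros)
    show ?thesis
      using sqint_Fatou[OF sqint_diff[OF F F] _ ae ev] by simp
  qed
  have cl: "\<exists>N. \<forall>n\<ge>N. sqint M (\<lambda>x. F n x - G x) \<and> L2dist M (F n) G \<le> e" if e: "e > 0" for e
  proof -
    obtain N where N: "\<And>m n. m \<ge> N \<Longrightarrow> n \<ge> N \<Longrightarrow> L2dist M (F m) (F n) < e"
      using Cauchy[OF e] by blast
    show ?thesis
    proof (intro exI allI impI)
      fix n assume n: "N \<le> n"
      show "sqint M (\<lambda>x. F n x - G x) \<and> L2dist M (F n) G \<le> e"
        by (rule close[OF e]) (use N n in auto)
    qed
  qed
  obtain n where "sqint M (\<lambda>x. F n x - G x)"
    using cl[OF zero_less_one] by blast
  from sqint_diff[OF F[of n] this] have G: "sqint M G" by simp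
  moreover have "(\<lambda>n. L2dist M (F n) G) \<longlonglongrightarrow> 0"
  proof (rule LIMSEQ_I)
    fix e :: real assume "e > 0"
    then have "e / 2 > 0" by simp
    from cl[OF this] obtain N where "\<forall>n\<ge>N. L2dist M (F n) G \<le> e / 2" by blast
    then show "\<exists>no. \<forall>n\<ge>no. norm (L2dist M (F n) G - 0) < e"
      using \<open>e > 0\<close> by (intro exI[of _ N] allI impI) (simp, smt (verit))
  qed
  ultimately show ?thesis by blast
qed

section \<open>Lions' projection theorem\<close>

text \<open>No vector space axioms are imposed: only the linearity of functionals and forms matters.\<close>

locale vector_ops =
  fixes V :: "'v set" and add :: "'v \<Rightarrow> 'v \<Rightarrow> 'v" and scale :: "real \<Rightarrow> 'v \<Rightarrow> 'v"
  assumes nonempty: "V \<noteq> {}"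
    and add_closed: "u \<in> V \<Longrightarrow> v \<in> V \<Longrightarrow> add u v \<in> V"
    and scale_closed: "u \<in> V \<Longrightarrow> scale c u \<in> V"
begin

definition functional :: "('v \<Rightarrow> real) \<Rightarrow> bool" where
  "functional F \<longleftrightarrow> (\<forall>u\<in>V. \<forall>v\<in>V. F (add u v) = F u + F v) \<and> (\<forall>u\<in>V. \<forall>c. F (scale c u) = c * F u)"

lemma functional_add: "functional F \<Longrightarrow> u \<in> V \<Longrightarrow> v \<in> V \<Longrightarrow> F (add u v) = F u + F v"
  and functional_scale: "functional F \<Longrightarrow> u \<in> V \<Longrightarrow> F (scale c u) = c * F u"
  by (auto simp: functional_def)

text \<open>Riesz' theorem without completeness: take a minimising sequence of
  \<open>B v v / 2 - F v\<close>. As \<open>V\<close> may be incomplete and \<open>B\<close>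
  degenerate, the representing element exists only as a Cauchy sequence, whose limit is formed where
  the lemma is applied.\<close>

lemma Riesz_sequence:
  assumes B1: "\<And>w. w \<in> V \<Longrightarrow> functional (\<lambda>v. B v w)"
    and sym: "\<And>v w. v \<in> V \<Longrightarrow> w \<in> V \<Longrightarrow> B v w = B w v"
    and pos: "\<And>v. v \<in> V \<Longrightarrow> B v v \<ge> 0"
    and F: "functional F"
    and bound: "\<And>v. v \<in> V \<Longrightarrow> \<bar>F v\<bar> \<le> C * sqrt (B v v)"
  obtains g where "\<And>n. g n \<in> V"
    "\<And>w. w \<in> V \<Longrightarrow> (\<lambda>n. B (g n) w) \<longlonglongrightarrow> F w"
    "\<And>e. e > 0 \<Longrightarrow> \<exists>N. \<forall>m\<ge>N. \<forall>n\<ge>N. B (g m) (g m) - 2 * B (g m) (g n) + B (g n) (g n) < e"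
proof -
  have B2: "functional (\<lambda>w. B v w)" if "v \<in> V" for v
    using B1[OF that] sym that by (auto simp: functional_def add_closed scale_closed)
  define J where "J v = B v v / 2 - F v" for v
  have Jlow: "J v \<ge> - (C\<^sup>2 / 2)" if "v \<in> V" for v
  proof -
    have "0 \<le> (sqrt (B v v) - C)\<^sup>2" by simp
    then have "C * sqrt (B v v) \<le> (B v v + C\<^sup>2) / 2"
      using pos[OF that] by (simp add: power2_diff mult.commute)
    then show ?thesis using bound[OF that] by (simp add: J_def field_simps)
  qed
  define I where "I = Inf (J ` V)"
  have bdd: "bdd_below (J ` V)"
    using Jlow by (auto intro!: bdd_belowI)
  have I: "I \<le> J v" if "v \<in> V" for v
    unfolding I_def using that bdd by (auto intro: cInf_lower)
  have "\<exists>v\<in>V. J v < I + 1 / real (Suc n)" for n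
  proof -
    have "Inf (J ` V) < I + 1 / real (Suc n)" by (simp add: I_def)
    then show ?thesis using nonempty bdd by (auto simp: cInf_less_iff)
  qed
  then obtain g where gV: "\<And>n. g n \<in> V" and gJ: "\<And>n. J (g n) < I + 1 / real (Suc n)"
    by metis
  have Jadd: "J (add u (scale t w)) = J u + t * (B u w - F w) + t\<^sup>2 * B w w / 2"
    if "u \<in> V" "w \<in> V" for u w t
    using that sym[of w u] scale_closed[OF that(2)]
    by (simp add: J_def functional_add[OF B1] functional_add[OF B2] functional_add[OF F]
        functional_scale[OF B1] functional_scale[OF B2] functional_scale[OF F] add_closed
        field_simps power2_eq_square)
  have conv: "(\<lambda>n. B (g n) w) \<longlonglongrightarrow> F w" if w: "w \<in> V" for w
  proof -
    \<comment> \<open>Adding 1 allows division by \<open>P\<close> even if \<open>w\<close> is a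
      null vector of \<open>B\<close>. Perturbing the near-minimiser by
      \<open>- \<delta> / P\<close> times \<open>w\<close> then forces \<delta> to 0.\<close>
    define P where "P = B w w + 1"
    have P: "P > 0" using pos[OF w] by (simp add: P_def)
    have sq: "(B (g n) w - F w)\<^sup>2 \<le> 2 * P * (1 / real (Suc n))" for n
    proof -
      define \<delta> where "\<delta> = B (g n) w - F w"
      have "I \<le> J (add (g n) (scale (- \<delta> / P) w))"
        by (intro I add_closed scale_closed gV w)
      also have "\<dots> = J (g n) - \<delta>\<^sup>2 / P + (\<delta> / P)\<^sup>2 * B w w / 2"
        using gV w by (simp add: Jadd \<delta>_def[symmetric] power2_eq_square)
      also have "(\<delta> / P)\<^sup>2 * B w w \<le> (\<delta> / P)\<^sup>2 * P"
        by (intro mult_left_mono) (auto simp: P_def)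
      also have "(\<delta> / P)\<^sup>2 * P = \<delta>\<^sup>2 / P"
        using P by (simp add: power2_eq_square)
      finally have "\<delta>\<^sup>2 / P / 2 \<le> 1 / real (Suc n)"
        using gJ[of n] by simp
      then show ?thesis using P by (simp add: \<delta>_def field_simps)
    qed
    have "(\<lambda>n. 2 * P * (1 / real (Suc n))) \<longlonglongrightarrow> 2 * P * 0"
      by (intro tendsto_intros LIMSEQ_Suc[OF lim_1_over_n])
    then have lim: "(\<lambda>n. 2 * P * (1 / real (Suc n))) \<longlonglongrightarrow> 0" by simp
    have "norm ((B (g n) w - F w)\<^sup>2) \<le> 2 * P * (1 / real (Suc n))" for n
      using sq[of n] by simp
    then have "(\<lambda>n. (B (g n) w - F w)\<^sup>2) \<longlonglongrightarrow> 0"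
      by (intro Lim_null_comparison[OF always_eventually lim] allI)
    then have "(\<lambda>n. B (g n) w - F w) \<longlonglongrightarrow> 0"
      by simp
    then show ?thesis by (simp add: LIM_zero_iff)
  qed
  \<comment> \<open>Parallelogram law: the midpoint of two near-minimisers cannot fall below
    \<open>I\<close>, so the two are close in the seminorm of \<open>B\<close>.\<close>
  have par: "B (g m) (g m) - 2 * B (g m) (g n) + B (g n) (g n) \<le> 4 * (1 / real (Suc m) + 1 / real (Suc n))" for m n
  proof -
    let ?h = "scale (1/2) (add (g m) (g n))"
    have "I \<le> J ?h" by (intro I add_closed scale_closed gV)
    moreover have "J ?h = (B (g m) (g m) + 2 * B (g m) (g n) + B (g n) (g n)) / 8 - (F (g m) + F (g n)) / 2"
      using gV sym[of "g n" "g m"]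
      by (simp add: J_def functional_add[OF B1] functional_add[OF B2] functional_add[OF F]
        functional_scale[OF B1] functional_scale[OF B2] functional_scale[OF F] add_closed scale_closed) argo
    ultimately show ?thesis
      using gJ[of m] gJ[of n] unfolding J_def by argo
  qed
  have "\<exists>N. \<forall>m\<ge>N. \<forall>n\<ge>N. B (g m) (g m) - 2 * B (g m) (g n) + B (g n) (g n) < e" if e: "e > 0" for e
  proof -
    have "0 < e / 8" using e by simp
    then obtain N where N: "1 / real (Suc N) < e / 8"
      by (rule nat_approx_posE)
    have mono: "1 / real (Suc m) \<le> 1 / real (Suc N)" if "m \<ge> N" for m
      using that by (simp add: frac_le)
    show ?thesis
    proof (intro exI allI impI)
      fix m n assume mn: "N \<le> m" "N \<le> n"
      show "B (g m) (g m) - 2 * B (g m) (g n) + B (g n) (g n) < e"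
        using par[of m n] mono[OF mn(1)] mono[OF mn(2)] N by argo
    qed
  qed
  with gV conv show ?thesis using that by blast
qed

text \<open>Riesz' theorem represents \<open>a w \<phi>\<close> as the inner product of
  \<open>T w\<close> with some \<open>K \<phi>\<close>, and a second application to the form \<open>\<lambda>\<phi> \<psi>. \<integral> K \<phi> \<bullet> K \<psi>\<close> gives the solution.\<close>

theorem Lions_projection:
  fixes T :: "'v \<Rightarrow> 'a \<Rightarrow> 'b::euclidean_space"
  assumes T: "\<And>v. v \<in> V \<Longrightarrow> sqint M (T v)"
    and T_add: "\<And>u v. u \<in> V \<Longrightarrow> v \<in> V \<Longrightarrow> T (add u v) = (\<lambda>x. T u x + T v x)"
    and T_scale: "\<And>u c. u \<in> V \<Longrightarrow> T (scale c u) = (\<lambda>x. c *\<^sub>R T u x)"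
    and a1: "\<And>\<phi>. \<phi> \<in> V \<Longrightarrow> functional (\<lambda>w. a w \<phi>)"
    and a2: "\<And>w. w \<in> V \<Longrightarrow> functional (\<lambda>\<phi>. a w \<phi>)"
    and a_bound: "\<And>\<phi>. \<phi> \<in> V \<Longrightarrow> \<exists>C. \<forall>w\<in>V. \<bar>a w \<phi>\<bar> \<le> C * L2n M (T w)"
    and lam: "lam > 0" and coercive: "\<And>\<phi>. \<phi> \<in> V \<Longrightarrow> lam * (L2n M (T \<phi>))\<^sup>2 \<le> a \<phi> \<phi>"
    and F: "functional F" and F_bound: "\<And>\<phi>. \<phi> \<in> V \<Longrightarrow> \<bar>F \<phi>\<bar> \<le> C * L2n M (T \<phi>)" and C: "C \<ge> 0"
  obtains w D where "\<And>n. w n \<in> V" "sqint M D" "(\<lambda>n. L2dist M (T (w n)) D) \<longlonglongrightarrow> 0"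
    "L2n M D \<le> C / lam" "\<And>\<phi>. \<phi> \<in> V \<Longrightarrow> (\<lambda>n. a (w n) \<phi>) \<longlonglongrightarrow> F \<phi>"
proof -
  have polar: "(\<integral>x. f x \<bullet> f x \<partial>M) - 2 * (\<integral>x. f x \<bullet> g x \<partial>M) + (\<integral>x. g x \<bullet> g x \<partial>M) = (L2dist M f g)\<^sup>2"
    if "sqint M f" "sqint M g" for f g :: "'a \<Rightarrow> 'b"
  proof -
    have "(L2dist M f g)\<^sup>2 = (\<integral>x. f x \<bullet> f x - 2 * (f x \<bullet> g x) + g x \<bullet> g x \<partial>M)"
      unfolding L2n_inner_self[symmetric]
      by (rule Bochner_Integration.integral_cong) (auto simp: inner_diff_left inner_diff_right inner_commute)
    then show ?thesis
      using sqint_inner[OF that(1) that(1)] sqint_inner[OF that] sqint_inner[OF that(2) that(2)] by simp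
  qed
  have limit: "\<exists>G. sqint M G \<and> (\<lambda>n. L2dist M (f n) G) \<longlonglongrightarrow> 0"
    if f: "\<And>n. sqint M (f n)"
      and c: "\<And>e. e > 0 \<Longrightarrow> \<exists>N. \<forall>m\<ge>N. \<forall>n\<ge>N. (\<integral>x. f m x \<bullet> f m x \<partial>M) - 2 * (\<integral>x. f m x \<bullet> f n x \<partial>M)
        + (\<integral>x. f n x \<bullet> f n x \<partial>M) < e" for f :: "nat \<Rightarrow> 'a \<Rightarrow> 'b"
  proof (rule L2_complete[OF f])
    fix e :: real assume e: "e > 0"
    then have "e\<^sup>2 > 0" by simp
    from c[OF this] obtain N where N: "\<And>m n. m \<ge> N \<Longrightarrow> n \<ge> N \<Longrightarrow> (L2dist M (f m) (f n))\<^sup>2 < e\<^sup>2"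
      unfolding polar[OF f f] by blast
    then show "\<exists>N. \<forall>m\<ge>N. \<forall>n\<ge>N. L2dist M (f m) (f n) < e"
      using e by (meson less_imp_le power_less_imp_less_base)
  qed
  \<comment> \<open>Besides representing \<open>a w \<phi>\<close>, \<open>k\<close> has to be an
    \<open>L^2\<close> limit of elements \<open>T (g n)\<close>. Lying in the closure of the range
    is what later expresses products \<open>K \<psi> \<bullet> K \<phi>\<close> through
    \<open>a\<close> and puts the solution into that closure.\<close>
  define R where "R \<phi> k \<longleftrightarrow> sqint M k \<and> (\<forall>w\<in>V. (\<integral>x. k x \<bullet> T w x \<partial>M) = a w \<phi>) \<and>
      (\<exists>g. (\<forall>n. g n \<in> V) \<and> (\<lambda>n. L2dist M (T (g n)) k) \<longlonglongrightarrow> 0)" for \<phi> k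
  have "\<exists>k. R \<phi> k" if \<phi>: "\<phi> \<in> V" for \<phi>
  proof -
    obtain C' where C': "\<And>w. w \<in> V \<Longrightarrow> \<bar>a w \<phi>\<bar> \<le> C' * L2n M (T w)"
      using a_bound[OF \<phi>] by blast
    obtain g where g: "\<And>n. g n \<in> V"
      and conv: "\<And>w. w \<in> V \<Longrightarrow> (\<lambda>n. \<integral>x. T (g n) x \<bullet> T w x \<partial>M) \<longlonglongrightarrow> a w \<phi>"
      and cauchy: "\<And>e. e > 0 \<Longrightarrow> \<exists>N. \<forall>m\<ge>N. \<forall>n\<ge>N. (\<integral>x. T (g m) x \<bullet> T (g m) x \<partial>M)
        - 2 * (\<integral>x. T (g m) x \<bullet> T (g n) x \<partial>M) + (\<integral>x. T (g n) x \<bullet> T (g n) x \<partial>M) < e"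
    proof (rule Riesz_sequence[of "\<lambda>v w. \<integral>x. T v x \<bullet> T w x \<partial>M" "\<lambda>w. a w \<phi>" C'])
      show "functional (\<lambda>v. \<integral>x. T v x \<bullet> T w x \<partial>M)" if "w \<in> V" for w
        unfolding functional_def
        using sqint_inner[OF T T[OF that]] by (simp add: T_add T_scale inner_add_left)
      show "(\<integral>x. T v x \<bullet> T w x \<partial>M) = (\<integral>x. T w x \<bullet> T v x \<partial>M)" for v w
        by (simp add: inner_commute)
      show "\<bar>a v \<phi>\<bar> \<le> C' * sqrt (\<integral>x. T v x \<bullet> T v x \<partial>M)" if "v \<in> V" for v
        using C'[OF that] by (simp add: L2n_inner_self)
    qed (use a1[OF \<phi>] in \<open>auto simp: L2n_inner_self\<close>)
    obtain k where k: "sqint M k" "(\<lambda>n. L2dist M (T (g n)) k) \<longlonglongrightarrow> 0"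
      using limit[of "\<lambda>n. T (g n)", OF T[OF g] cauchy] by blast
    have "(\<integral>x. k x \<bullet> T w x \<partial>M) = a w \<phi>" if "w \<in> V" for w
      using L2_inner_tendsto[OF T[OF g] k(1) T[OF that] k(2)] conv[OF that] LIMSEQ_unique by blast
    then show ?thesis unfolding R_def using k g by blast
  qed
  then obtain K where "\<forall>\<phi>\<in>V. R \<phi> (K \<phi>)"
    using bchoice[of V R] by blast
  then have K: "\<And>\<phi>. \<phi> \<in> V \<Longrightarrow> sqint M (K \<phi>)"
    and Ka: "\<And>\<phi> w. \<phi> \<in> V \<Longrightarrow> w \<in> V \<Longrightarrow> (\<integral>x. K \<phi> x \<bullet> T w x \<partial>M) = a w \<phi>"
    and Kg: "\<And>\<phi>. \<phi> \<in> V \<Longrightarrow> \<exists>g. (\<forall>n. g n \<in> V) \<and> (\<lambda>n. L2n M (\<lambda>x. T (g n) x - K \<phi> x)) \<longlonglongrightarrow> 0"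
    unfolding R_def by blast+
  have KK: "\<exists>g. (\<forall>n. g n \<in> V) \<and> (\<forall>\<psi>\<in>V. (\<lambda>n. a (g n) \<psi>) \<longlonglongrightarrow> (\<integral>x. K \<psi> x \<bullet> K \<phi> x \<partial>M))" if \<phi>: "\<phi> \<in> V" for \<phi>
  proof -
    obtain g where g: "\<And>n. g n \<in> V" "(\<lambda>n. L2n M (\<lambda>x. T (g n) x - K \<phi> x)) \<longlonglongrightarrow> 0"
      using Kg[OF \<phi>] by blast
    have "(\<lambda>n. a (g n) \<psi>) \<longlonglongrightarrow> (\<integral>x. K \<psi> x \<bullet> K \<phi> x \<partial>M)" if \<psi>: "\<psi> \<in> V" for \<psi>
      using L2_inner_tendsto[OF T[OF g(1)] K[OF \<phi>] K[OF \<psi>] g(2)] Ka[OF \<psi> g(1)]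
      by (simp add: inner_commute)
    with g(1) show ?thesis by blast
  qed
  \<comment> \<open>\<open>K\<close> comes from a choice and is not known to be linear. Its inner
    products with \<open>K \<phi>\<close> are limits of \<open>a (g n) \<psi>\<close>, which are
    linear in \<psi>; this is all the second use of Riesz' theorem requires.\<close>
  have linK: "functional (\<lambda>\<psi>. \<integral>x. K \<psi> x \<bullet> K \<phi> x \<partial>M)" if \<phi>: "\<phi> \<in> V" for \<phi>
  proof -
    obtain g where g: "\<And>n. g n \<in> V"
      and lim: "\<And>\<psi>. \<psi> \<in> V \<Longrightarrow> (\<lambda>n. a (g n) \<psi>) \<longlonglongrightarrow> (\<integral>x. K \<psi> x \<bullet> K \<phi> x \<partial>M)"
      using KK[OF \<phi>] by blast
    show ?thesis
      unfolding functional_def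
    proof (intro conjI ballI allI)
      fix u v assume uv: "u \<in> V" "v \<in> V"
      have "(\<lambda>n. a (g n) (add u v)) \<longlonglongrightarrow> (\<integral>x. K u x \<bullet> K \<phi> x \<partial>M) + (\<integral>x. K v x \<bullet> K \<phi> x \<partial>M)"
        using tendsto_add[OF lim[OF uv(1)] lim[OF uv(2)]] uv by (simp add: functional_add[OF a2[OF g]])
      then show "(\<integral>x. K (add u v) x \<bullet> K \<phi> x \<partial>M) = (\<integral>x. K u x \<bullet> K \<phi> x \<partial>M) + (\<integral>x. K v x \<bullet> K \<phi> x \<partial>M)"
        using lim[OF add_closed[OF uv]] LIMSEQ_unique by blast
    next
      fix u c assume u: "u \<in> V"
      have "(\<lambda>n. a (g n) (scale c u)) \<longlonglongrightarrow> c * (\<integral>x. K u x \<bullet> K \<phi> x \<partial>M)"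
        using tendsto_mult_left[OF lim[OF u], of c] u by (simp add: functional_scale[OF a2[OF g]])
      then show "(\<integral>x. K (scale c u) x \<bullet> K \<phi> x \<partial>M) = c * (\<integral>x. K u x \<bullet> K \<phi> x \<partial>M)"
        using lim[OF scale_closed[OF u]] LIMSEQ_unique by blast
    qed
  qed
  \<comment> \<open>On the diagonal the representation reads
    \<open>a \<phi> \<phi> = \<integral> K \<phi> \<bullet> T \<phi>\<close>, so coercivity and
    Cauchy-Schwarz bound \<open>K\<close> from below. Through this bound \<open>F\<close> becomes
    continuous in the norm of \<open>K \<phi>\<close>.\<close>
  have lamK: "L2n M (T \<phi>) \<le> L2n M (K \<phi>) / lam" if \<phi>: "\<phi> \<in> V" for \<phi>
  proof (cases "L2n M (T \<phi>) = 0")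
    case False
    have "lam * (L2n M (T \<phi>))\<^sup>2 \<le> L2n M (K \<phi>) * L2n M (T \<phi>)"
      using coercive[OF \<phi>] Ka[OF \<phi> \<phi>] L2n_inner_le[OF K[OF \<phi>] T[OF \<phi>]] by simp
    then have "lam * L2n M (T \<phi>) \<le> L2n M (K \<phi>)"
      using False L2n_nonneg[of M "T \<phi>"] by (simp add: power2_eq_square mult.assoc[symmetric])
    then show ?thesis using lam by (simp add: field_simps)
  qed (use lam in simp)
  have FK: "\<bar>F \<phi>\<bar> \<le> C / lam * L2n M (K \<phi>)" if \<phi>: "\<phi> \<in> V" for \<phi>
  proof -
    have "\<bar>F \<phi>\<bar> \<le> C * L2n M (T \<phi>)" by (rule F_bound[OF \<phi>])
    also have "\<dots> \<le> C * (L2n M (K \<phi>) / lam)" by (intro mult_left_mono lamK \<phi> C)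
    finally show ?thesis by simp
  qed
  obtain g where g: "\<And>n. g n \<in> V"
    and conv: "\<And>\<psi>. \<psi> \<in> V \<Longrightarrow> (\<lambda>n. \<integral>x. K (g n) x \<bullet> K \<psi> x \<partial>M) \<longlonglongrightarrow> F \<psi>"
    and cauchy: "\<And>e. e > 0 \<Longrightarrow> \<exists>N. \<forall>m\<ge>N. \<forall>n\<ge>N. (\<integral>x. K (g m) x \<bullet> K (g m) x \<partial>M)
      - 2 * (\<integral>x. K (g m) x \<bullet> K (g n) x \<partial>M) + (\<integral>x. K (g n) x \<bullet> K (g n) x \<partial>M) < e"
  proof (rule Riesz_sequence[of "\<lambda>v w. \<integral>x. K v x \<bullet> K w x \<partial>M" F "C / lam"])
    show "functional (\<lambda>v. \<integral>x. K v x \<bullet> K w x \<partial>M)" if "w \<in> V" for w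
      by (rule linK[OF that])
    show "(\<integral>x. K v x \<bullet> K w x \<partial>M) = (\<integral>x. K w x \<bullet> K v x \<partial>M)" for v w
      by (simp add: inner_commute)
    show "\<bar>F v\<bar> \<le> C / lam * sqrt (\<integral>x. K v x \<bullet> K v x \<partial>M)" if "v \<in> V" for v
      using FK[OF that] by (simp add: L2n_inner_self)
  qed (use F in \<open>auto simp: L2n_inner_self\<close>)
  obtain D where D: "sqint M D" and KD: "(\<lambda>n. L2dist M (K (g n)) D) \<longlonglongrightarrow> 0"
    using limit[of "\<lambda>n. K (g n)", OF K[OF g] cauchy] by blast
  have DK: "(\<integral>x. D x \<bullet> K \<psi> x \<partial>M) = F \<psi>" if \<psi>: "\<psi> \<in> V" for \<psi>
    using L2_inner_tendsto[OF K[OF g] D K[OF \<psi>] KD] conv[OF \<psi>] LIMSEQ_unique by blast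
  \<comment> \<open>\<open>D\<close> is a limit of the \<open>K (g n)\<close>, which need not have
    the form \<open>T v\<close>. Replacing each by some \<open>T (w n)\<close> at distance below
    \<open>1 / (n + 1)\<close> gives a sequence in the range with the same limit.\<close>
  have "\<exists>v\<in>V. L2dist M (T v) (K (g n)) < 1 / real (Suc n)" for n
  proof -
    obtain h where h: "\<And>m. h m \<in> V" "(\<lambda>m. L2dist M (T (h m)) (K (g n))) \<longlonglongrightarrow> 0"
      using Kg[OF g] by blast
    have "eventually (\<lambda>m. L2dist M (T (h m)) (K (g n)) < 1 / real (Suc n)) sequentially"
      by (rule order_tendstoD(2)[OF h(2)]) simp
    then show ?thesis using h(1) by (auto simp: eventually_sequentially)
  qed
  then obtain w where w: "\<And>n. w n \<in> V" and wK: "\<And>n. L2dist M (T (w n)) (K (g n)) < 1 / real (Suc n)"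
    by metis
  have wD: "(\<lambda>n. L2dist M (T (w n)) D) \<longlonglongrightarrow> 0"
  proof (rule tendsto_sandwich[OF _ _ tendsto_const])
    show "(\<lambda>n. 1 / real (Suc n) + L2dist M (K (g n)) D) \<longlonglongrightarrow> 0"
      using tendsto_add[OF LIMSEQ_Suc[OF lim_1_over_n] KD] by simp
    show "\<forall>\<^sub>F n in sequentially. L2dist M (T (w n)) D \<le> 1 / real (Suc n) + L2dist M (K (g n)) D"
    proof (rule always_eventually, rule allI)
      fix n
      show "L2dist M (T (w n)) D \<le> 1 / real (Suc n) + L2dist M (K (g n)) D"
        using L2n_triangle_diff[OF T[OF w] K[OF g] D, of n n] wK[of n] by linarith
    qed
  qed simp
  have "(\<lambda>n. a (w n) \<phi>) \<longlonglongrightarrow> F \<phi>" if \<phi>: "\<phi> \<in> V" for \<phi>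
    using L2_inner_tendsto[OF T[OF w] D K[OF \<phi>] wD] Ka[OF \<phi> w] DK[OF \<phi>]
    by (simp add: inner_commute)
  \<comment> \<open>Pairing the approximants \<open>K (g n)\<close> with \<open>D\<close> shows that
    the square of the norm of \<open>D\<close> is the limit of \<open>F (g n)\<close>, hence at most
    \<open>C / lam\<close> times that norm.\<close>
  moreover have "L2n M D \<le> C / lam"
  proof -
    have "(\<lambda>n. C / lam * L2n M (K (g n))) \<longlonglongrightarrow> C / lam * L2n M D"
      by (intro tendsto_intros L2n_tendsto K g D KD)
    moreover have "(\<lambda>n. F (g n)) \<longlonglongrightarrow> (L2n M D)\<^sup>2"
      using L2_inner_tendsto[OF K[OF g] D D KD] DK[OF g] by (simp add: inner_commute L2n_inner_self)
    moreover have "F (g n) \<le> C / lam * L2n M (K (g n))" for n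
      using FK[OF g, of n] by linarith
    ultimately have "(L2n M D)\<^sup>2 \<le> C / lam * L2n M D"
      using LIMSEQ_le by blast
    show ?thesis
    proof (cases "L2n M D = 0")
      case False
      then have "0 < L2n M D" using L2n_nonneg[of M D] by linarith
      then show ?thesis
        using \<open>(L2n M D)\<^sup>2 \<le> C / lam * L2n M D\<close> unfolding power2_eq_square
        by (rule mult_right_le_imp_le[rotated])
    qed (use C lam in simp)
  qed
  ultimately show ?thesis using w D wD that by blast
qed

end

section \<open>Test functions\<close>

lemma partial_deriv_eqI:
  "(f has_derivative f') (at x) \<Longrightarrow> partial_deriv i f x = f' (axis i 1)"
  using frechet_derivative_at[of f f' x] by (simp add: partial_deriv_def)

lemma differentiable_has_grad:
  fixes f :: "real^'n::finite \<Rightarrow> real"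
  assumes "f differentiable (at x)"
  shows "(f has_derivative (\<lambda>v. grad f x \<bullet> v)) (at x)"
proof -
  let ?f' = "frechet_derivative f (at x)"
  have f': "(f has_derivative ?f') (at x)"
    using assms by (simp add: frechet_derivative_works)
  then have lin: "linear ?f'"
    by (rule has_derivative_linear)
  have "?f' v = grad f x \<bullet> v" for v
  proof -
    have "?f' v = ?f' (\<Sum>i\<in>UNIV. v $ i *\<^sub>R axis i 1)"
      by (simp add: basis_expansion scalar_mult_eq_scaleR[symmetric])
    also have "\<dots> = (\<Sum>i\<in>UNIV. v $ i * ?f' (axis i 1))"
      by (simp add: linear_sum[OF lin] linear_scale[OF lin])
    also have "\<dots> = grad f x \<bullet> v"
      by (simp add: grad_def partial_deriv_def inner_vec_def mult.commute)
    finally show ?thesis .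
  qed
  then have "?f' = (\<lambda>v. grad f x \<bullet> v)" by (rule ext)
  with f' show ?thesis by simp
qed

lemma grad_eqI:
  "(f has_derivative (\<lambda>v. w \<bullet> v)) (at x) \<Longrightarrow> grad f x = w"
  using partial_deriv_eqI[of f "\<lambda>v. w \<bullet> v" x] by (simp add: grad_def inner_axis vec_eq_iff)

lemma Ck_continuous: "Ck k f \<Longrightarrow> continuous_on UNIV f"
  by (cases k) auto

lemma Ck_SucD: "Ck (Suc k) f \<Longrightarrow> Ck k f"
  by (induction k arbitrary: f) auto

lemma Ck_Suc_differentiable: "Ck (Suc k) f \<Longrightarrow> f differentiable (at x)"
  by (auto simp: differentiable_on_def)

lemma Ck_add: "Ck k f \<Longrightarrow> Ck k g \<Longrightarrow> Ck k (\<lambda>x. f x + g x)"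
proof (induction k arbitrary: f g)
  case (Suc k)
  have "partial_deriv i (\<lambda>x. f x + g x) = (\<lambda>x. partial_deriv i f x + partial_deriv i g x)" for i
  proof
    fix x
    show "partial_deriv i (\<lambda>x. f x + g x) x = partial_deriv i f x + partial_deriv i g x"
      unfolding partial_deriv_def[of i f] partial_deriv_def[of i g]
      by (rule partial_deriv_eqI)
         (intro has_derivative_add frechet_derivative_works[THEN iffD1] Ck_Suc_differentiable[OF Suc.prems(1)]
            Ck_Suc_differentiable[OF Suc.prems(2)])
  qed
  with Suc show ?case by (auto intro!: continuous_intros differentiable_on_add)
qed (auto intro!: continuous_intros)

lemma Ck_mult: "Ck k f \<Longrightarrow> Ck k g \<Longrightarrow> Ck k (\<lambda>x. f x * g x)"
proof (induction k arbitrary: f g)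
  case (Suc k)
  have "partial_deriv i (\<lambda>x. f x * g x) = (\<lambda>x. f x * partial_deriv i g x + partial_deriv i f x * g x)" for i
  proof
    fix x
    show "partial_deriv i (\<lambda>x. f x * g x) x = f x * partial_deriv i g x + partial_deriv i f x * g x"
      unfolding partial_deriv_def[of i f] partial_deriv_def[of i g]
      by (rule partial_deriv_eqI)
         (intro has_derivative_mult frechet_derivative_works[THEN iffD1] Ck_Suc_differentiable[OF Suc.prems(1)]
            Ck_Suc_differentiable[OF Suc.prems(2)])
  qed
  moreover have "Ck k (\<lambda>x. f x * partial_deriv i g x + partial_deriv i f x * g x)" for i
    using Suc.prems Ck_SucD[OF Suc.prems(1)] Ck_SucD[OF Suc.prems(2)] by (intro Ck_add Suc.IH) simp_all
  ultimately show ?case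
    using Suc.prems by (auto intro!: continuous_on_mult differentiable_on_mult)
qed (auto intro!: continuous_intros)

text \<open>The whole sequence of derivatives is the witness: passing to the derivative shifts it,
  passing to an antiderivative prepends one term.\<close>

definition smooth_real :: "(real \<Rightarrow> real) \<Rightarrow> bool" where
  "smooth_real g \<longleftrightarrow> (\<exists>D. D 0 = g \<and> (\<forall>k x. (D k has_real_derivative D (Suc k) x) (at x)))"

lemma smooth_realD: "smooth_real g \<Longrightarrow> \<exists>g'. smooth_real g' \<and> (\<forall>x. (g has_real_derivative g' x) (at x))"
proof -
  assume "smooth_real g"
  then obtain D where D: "D 0 = g" "\<And>k x. (D k has_real_derivative D (Suc k) x) (at x)"
    by (auto simp: smooth_real_def)
  have "smooth_real (D (Suc 0))"
    unfolding smooth_real_def by (rule exI[of _ "\<lambda>k. D (Suc k)"]) (use D in auto)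
  with D show ?thesis by metis
qed

lemma smooth_real_antiderivative:
  assumes "smooth_real g'" "\<And>x. (g has_real_derivative g' x) (at x)"
  shows "smooth_real g"
proof -
  obtain D where D: "D 0 = g'" "\<And>k x. (D k has_real_derivative D (Suc k) x) (at x)"
    using assms(1) by (auto simp: smooth_real_def)
  have "(rec_nat g (\<lambda>k _. D k) k has_real_derivative rec_nat g (\<lambda>k _. D k) (Suc k) x) (at x)" for k x
    using assms(2) D by (cases k) auto
  then show ?thesis
    unfolding smooth_real_def by (intro exI[of _ "rec_nat g (\<lambda>k _. D k)"]) auto
qed

text \<open>For families closed under differentiation, where a formula for the k-th derivative would
  be unwieldy: it suffices to differentiate once within \<open>S\<close>.\<close>

lemma smooth_real_coinduct:
  assumes "g \<in> S" and step: "\<And>f. f \<in> S \<Longrightarrow> \<exists>f'\<in>S. \<forall>x. (f has_real_derivative f' x) (at x)"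
  shows "smooth_real g"
proof -
  obtain d where d: "\<And>f. f \<in> S \<Longrightarrow> d f \<in> S" "\<And>f x. f \<in> S \<Longrightarrow> (f has_real_derivative d f x) (at x)"
    using step by metis
  have S: "(d ^^ k) g \<in> S" for k
    by (induction k) (use assms(1) d(1) in auto)
  show ?thesis
    unfolding smooth_real_def
    by (rule exI[of _ "\<lambda>k. (d ^^ k) g"]) (use d(2)[OF S] in auto)
qed

text \<open>The induction generalises over \<open>g\<close>, since the chain rule replaces
  \<open>g\<close> by its derivative.\<close>

lemma Ck_compose_smooth:
  assumes "Ck k \<phi>" "smooth_real g"
  shows "Ck k (\<lambda>x. g (\<phi> x))"
  using assms
proof (induction k arbitrary: g)
  case 0
  then obtain g' where "\<And>x. (g has_real_derivative g' x) (at x)"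
    using smooth_realD by blast
  then have "continuous_on UNIV g"
    by (meson DERIV_isCont continuous_at_imp_continuous_on)
  with 0 show ?case by (auto intro: continuous_on_compose2)
next
  case (Suc k)
  obtain g' where g': "smooth_real g'" "\<And>x. (g has_real_derivative g' x) (at x)"
    using smooth_realD[OF Suc.prems(2)] by blast
  have der: "((\<lambda>x. g (\<phi> x)) has_derivative (\<lambda>v. frechet_derivative \<phi> (at x) v * g' (\<phi> x))) (at x)" for x
    by (rule DERIV_compose_FDERIV[OF g'(2)])
       (rule frechet_derivative_works[THEN iffD1, OF Ck_Suc_differentiable[OF Suc.prems(1)]])
  then have pd: "partial_deriv i (\<lambda>x. g (\<phi> x)) = (\<lambda>x. partial_deriv i \<phi> x * g' (\<phi> x))" for i
    by (auto simp: fun_eq_iff partial_deriv_eqI[OF der] partial_deriv_def[of i \<phi>])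
  have diff: "(\<lambda>x. g (\<phi> x)) differentiable (at x)" for x
    using der[of x] by (auto simp: differentiable_def)
  have "continuous_on UNIV (\<lambda>x. g (\<phi> x))"
    using diff by (meson continuous_at_imp_continuous_on differentiable_imp_continuous_within)
  moreover have "Ck k (\<lambda>x. partial_deriv i \<phi> x * g' (\<phi> x))" for i
    using Suc.IH[OF Ck_SucD[OF Suc.prems(1)] g'(1)] Suc.prems(1) by (intro Ck_mult) auto
  ultimately show ?case
    using diff by (auto simp: pd differentiable_on_def differentiable_at_withinI)
qed

section \<open>Test functions: regularity, supports, compositions\<close>

lemma test_differentiable: "test_fun U \<phi> \<Longrightarrow> \<phi> differentiable (at x)"
  by (rule Ck_Suc_differentiable[of 0]) (simp only: test_fun_def)

lemma test_has_derivative: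
  "test_fun U \<phi> \<Longrightarrow> (\<phi> has_derivative (\<lambda>v. grad \<phi> x \<bullet> v)) (at x)"
  by (intro differentiable_has_grad test_differentiable)

lemma test_continuous: "test_fun U \<phi> \<Longrightarrow> continuous_on UNIV \<phi>"
  by (rule Ck_continuous[of 0]) (simp only: test_fun_def)

lemma grad_continuous:
  assumes "test_fun U \<phi>"
  shows "continuous_on UNIV (grad \<phi>)"
proof -
  have "Ck 1 \<phi>" using assms by (auto simp: test_fun_def)
  then have "continuous_on UNIV (partial_deriv i \<phi>)" for i by simp
  then have "continuous_on UNIV (\<lambda>x. \<chi> i. partial_deriv i \<phi> x)"
    by (intro continuous_on_vec_lambda) (simp add: eta_contract_eq)
  then show ?thesis by (simp add: grad_def[abs_def])
qed

lemma in_support: "\<phi> x \<noteq> 0 \<Longrightarrow> x \<in> closure {x. \<phi> x \<noteq> 0}"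
  by (rule subsetD[OF closure_subset]) simp

lemma test_outside: "test_fun U \<phi> \<Longrightarrow> x \<notin> U \<Longrightarrow> \<phi> x = 0"
  unfolding test_fun_def using in_support[of \<phi> x] by blast

lemma test_funI:
  assumes "\<And>k. Ck k \<psi>" "compact A" "A \<subseteq> U" "\<And>x. \<psi> x \<noteq> 0 \<Longrightarrow> x \<in> A"
  shows "test_fun U \<psi>"
proof -
  have sub: "closure {x. \<psi> x \<noteq> 0} \<subseteq> A"
    by (intro closure_minimal compact_imp_closed assms(2)) (use assms(4) in auto)
  then have "A \<inter> closure {x. \<psi> x \<noteq> 0} = closure {x. \<psi> x \<noteq> 0}" by auto
  then have "compact (closure {x. \<psi> x \<noteq> 0})"
    using compact_Int_closed[OF assms(2) closed_closure, of "{x. \<psi> x \<noteq> 0}"] by simp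
  with sub assms(1,3) show ?thesis by (auto simp: test_fun_def)
qed

lemma grad_outside:
  assumes "test_fun U \<phi>" "x \<notin> closure {x. \<phi> x \<noteq> 0}"
  shows "grad \<phi> x = 0"
proof (rule grad_eqI)
  have "((\<lambda>_. 0) has_derivative (\<lambda>v. 0 \<bullet> v)) (at x)" by simp
  then show "(\<phi> has_derivative (\<lambda>v. 0 \<bullet> v)) (at x)"
    by (rule has_derivative_transform_within_open[where s = "- closure {x. \<phi> x \<noteq> 0}"])
       (use assms in \<open>auto dest: in_support\<close>)
qed

lemma test_zero: "test_fun U (\<lambda>_. 0)"
proof (rule test_funI)
  have pd: "partial_deriv i (\<lambda>_. 0) = (\<lambda>_. 0 :: real)" for i :: "'a"
    by (auto simp: fun_eq_iff partial_deriv_eqI[OF has_derivative_const])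
  show "Ck k (\<lambda>_::real^'a. 0)" for k
    by (induction k) (auto simp: pd)
  show "compact {}" by simp
qed auto

lemma test_add:
  assumes "test_fun U \<phi>" "test_fun U \<psi>"
  shows "test_fun U (\<lambda>x. \<phi> x + \<psi> x)"
proof (rule test_funI)
  let ?A = "closure {x. \<phi> x \<noteq> 0} \<union> closure {x. \<psi> x \<noteq> 0}"
  show "compact ?A" "?A \<subseteq> U" using assms by (auto simp: test_fun_def)
  show "x \<in> ?A" if "\<phi> x + \<psi> x \<noteq> 0" for x
    using that in_support[of \<phi> x] in_support[of \<psi> x] by (cases "\<phi> x = 0") auto
  show "Ck k (\<lambda>x. \<phi> x + \<psi> x)" for k
    using assms by (intro Ck_add) (auto simp: test_fun_def)
qed

text \<open>\<open>g 0 = 0\<close> keeps the support inside that of \<phi>. This is how nonlinear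
  functions of test functions enter both the weak formulation and the sign condition on
  \<open>B\<close>.\<close>

lemma test_compose:
  assumes "test_fun U \<phi>" "smooth_real g" "g 0 = 0"
  shows "test_fun U (\<lambda>x. g (\<phi> x))"
proof (rule test_funI)
  show "Ck k (\<lambda>x. g (\<phi> x))" for k
    using assms by (intro Ck_compose_smooth[of k \<phi> g]) (auto simp: test_fun_def)
  show "x \<in> closure {x. \<phi> x \<noteq> 0}" if "g (\<phi> x) \<noteq> 0" for x
    using that assms(3) by (intro in_support[of \<phi>]) auto
qed (use assms in \<open>auto simp: test_fun_def\<close>)

lemma grad_compose:
  assumes "test_fun U \<phi>" "(g has_real_derivative g') (at (\<phi> x))"
  shows "grad (\<lambda>x. g (\<phi> x)) x = g' *\<^sub>R grad \<phi> x"
proof (rule grad_eqI)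
  show "((\<lambda>x. g (\<phi> x)) has_derivative (\<lambda>v. (g' *\<^sub>R grad \<phi> x) \<bullet> v)) (at x)"
    using DERIV_compose_FDERIV[OF assms(2) test_has_derivative[OF assms(1)]] by (simp add: mult.commute)
qed

lemma smooth_real_cmult: "smooth_real (\<lambda>x. c * x)"
proof (rule smooth_real_antiderivative)
  show "smooth_real (\<lambda>_. c)"
  proof (rule smooth_real_coinduct[where S = "range (\<lambda>c _. c)"])
    fix f :: "real \<Rightarrow> real" assume "f \<in> range (\<lambda>c _. c)"
    then show "\<exists>f'\<in>range (\<lambda>c _. c). \<forall>x. (f has_real_derivative f' x) (at x)"
      by (intro bexI[of _ "\<lambda>_. 0"]) auto
  qed auto
qed (auto intro!: derivative_eq_intros)

lemma smooth_real_square: "smooth_real (\<lambda>x. x\<^sup>2)"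
  by (rule smooth_real_antiderivative[OF smooth_real_cmult[of 2]]) (auto intro!: derivative_eq_intros)

lemma test_cmult: "test_fun U \<phi> \<Longrightarrow> test_fun U (\<lambda>x. c * \<phi> x)"
  using test_compose[of U \<phi> "\<lambda>x. c * x", OF _ smooth_real_cmult] by simp

lemma test_diff: "test_fun U \<phi> \<Longrightarrow> test_fun U \<psi> \<Longrightarrow> test_fun U (\<lambda>x. \<phi> x - \<psi> x)"
  using test_add[OF _ test_cmult[of U \<psi> "-1"], of \<phi>] by simp

lemma grad_add:
  assumes "test_fun U \<phi>" "test_fun U \<psi>"
  shows "grad (\<lambda>x. \<phi> x + \<psi> x) x = grad \<phi> x + grad \<psi> x"
  by (rule grad_eqI)
     (use has_derivative_add[OF assms[THEN test_has_derivative]] in \<open>simp add: inner_add_left\<close>)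

lemma grad_cmult:
  assumes "test_fun U \<phi>"
  shows "grad (\<lambda>x. c * \<phi> x) x = c *\<^sub>R grad \<phi> x"
  using grad_compose[OF assms, of "\<lambda>x. c * x" c x] DERIV_cmult_Id[of c] by simp

lemma grad_diff:
  assumes "test_fun U \<phi>" "test_fun U \<psi>"
  shows "grad (\<lambda>x. \<phi> x - \<psi> x) x = grad \<phi> x - grad \<psi> x"
  using grad_add[OF assms(1) test_cmult[OF assms(2), of "-1"], of x] grad_cmult[OF assms(2), of "-1" x] by simp

lemma test_bounded:
  assumes "test_fun U \<phi>"
  shows "\<exists>K. \<forall>x. \<bar>\<phi> x\<bar> \<le> K" "\<exists>K. \<forall>x. norm (grad \<phi> x) \<le> K"
proof -
  let ?S = "closure {x. \<phi> x \<noteq> 0}"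
  have S: "compact ?S" using assms by (simp add: test_fun_def)
  have "bounded (\<phi> ` ?S)" "bounded (grad \<phi> ` ?S)"
    using compact_imp_bounded[OF compact_continuous_image[OF continuous_on_subset[OF test_continuous[OF assms] subset_UNIV] S]]
      compact_imp_bounded[OF compact_continuous_image[OF continuous_on_subset[OF grad_continuous[OF assms] subset_UNIV] S]]
    by auto
  then obtain K1 K2 where K: "\<And>x. x \<in> ?S \<Longrightarrow> norm (\<phi> x) \<le> K1" "\<And>x. x \<in> ?S \<Longrightarrow> norm (grad \<phi> x) \<le> K2"
    unfolding bounded_iff by blast
  have "\<bar>\<phi> x\<bar> \<le> max K1 0" for x
    using K(1)[of x] in_support[of \<phi> x] by (cases "\<phi> x = 0") auto
  then show "\<exists>K. \<forall>x. \<bar>\<phi> x\<bar> \<le> K" by blast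
  have "norm (grad \<phi> x) \<le> max K2 0" for x
    using K(2)[of x] grad_outside[OF assms, of x] by (cases "x \<in> ?S") auto
  then show "\<exists>K. \<forall>x. norm (grad \<phi> x) \<le> K" by blast
qed

section \<open>Sobolev functions on a bounded domain\<close>

lemma Holder_inequality:
  fixes f g :: "'a \<Rightarrow> real"
  assumes pq: "p > 1" "q > 1" "1 / p + 1 / q = 1"
    and [measurable]: "f \<in> borel_measurable M" "g \<in> borel_measurable M"
    and f: "integrable M (\<lambda>x. \<bar>f x\<bar> powr p)" and g: "integrable M (\<lambda>x. \<bar>g x\<bar> powr q)"
  shows "integrable M (\<lambda>x. f x * g x)"
    and "(\<integral>x. \<bar>f x * g x\<bar> \<partial>M) \<le> (\<integral>x. \<bar>f x\<bar> powr p \<partial>M) powr (1 / p) * (\<integral>x. \<bar>g x\<bar> powr q \<partial>M) powr (1 / q)"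
proof -
  define A B where "A = (\<integral>x. \<bar>f x\<bar> powr p \<partial>M)" and "B = (\<integral>x. \<bar>g x\<bar> powr q \<partial>M)"
  have young: "\<bar>f x * g x\<bar> \<le> \<bar>f x\<bar> powr p / p + \<bar>g x\<bar> powr q / q" for x
    using Youngs_inequality[OF pq, of "\<bar>f x\<bar>" "\<bar>g x\<bar>"] by (simp add: abs_mult)
  have int_sum: "integrable M (\<lambda>x. \<bar>f x\<bar> powr p / p + \<bar>g x\<bar> powr q / q)"
    using f g by simp
  show int: "integrable M (\<lambda>x. f x * g x)"
  proof (rule Bochner_Integration.integrable_bound[OF int_sum])
    show "AE x in M. norm (f x * g x) \<le> norm (\<bar>f x\<bar> powr p / p + \<bar>g x\<bar> powr q / q)"
    proof (rule AE_I2)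
      fix x show "norm (f x * g x) \<le> norm (\<bar>f x\<bar> powr p / p + \<bar>g x\<bar> powr q / q)"
        using young[of x] by simp
    qed
  qed measurable
  have zero: "(\<integral>x. \<bar>f x * g x\<bar> \<partial>M) = 0" if "AE x in M. f x * g x = 0"
    using that by (intro integral_eq_zero_AE) auto
  show "(\<integral>x. \<bar>f x * g x\<bar> \<partial>M) \<le> (\<integral>x. \<bar>f x\<bar> powr p \<partial>M) powr (1 / p) * (\<integral>x. \<bar>g x\<bar> powr q \<partial>M) powr (1 / q)"
  proof (cases "A = 0 \<or> B = 0")
    case True
    have "AE x in M. \<bar>f x\<bar> powr p = 0 \<or> \<bar>g x\<bar> powr q = 0"
    proof (cases "A = 0")
      case True
      then have "AE x in M. \<bar>f x\<bar> powr p = 0"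
        using integral_nonneg_eq_0_iff_AE[OF f] by (simp add: A_def)
      then show ?thesis by eventually_elim simp
    next
      case False
      then have "AE x in M. \<bar>g x\<bar> powr q = 0"
        using integral_nonneg_eq_0_iff_AE[OF g] \<open>A = 0 \<or> B = 0\<close> by (simp add: B_def)
      then show ?thesis by eventually_elim simp
    qed
    then have "AE x in M. f x * g x = 0" by eventually_elim auto
    then show ?thesis using zero by simp
  next
    case False
    then have A: "A > 0" and B: "B > 0"
      unfolding A_def B_def by (auto simp: order_less_le)
    \<comment> \<open>Dividing by the norms first makes the right side of Young's inequality
      integrate to exactly \<open>1 / p + 1 / q\<close>.\<close>
    define a b where "a = A powr (1 / p)" and "b = B powr (1 / q)"
    have a: "a > 0" "a powr p = A" and b: "b > 0" "b powr q = B"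
      using A B pq by (auto simp: a_def b_def powr_powr)
    have "\<bar>f x * g x\<bar> / (a * b) \<le> \<bar>f x\<bar> powr p / (p * A) + \<bar>g x\<bar> powr q / (q * B)" for x
      using Youngs_inequality[OF pq, of "\<bar>f x\<bar> / a" "\<bar>g x\<bar> / b"] a b
      by (simp add: abs_mult powr_divide mult.commute)
    then have "(\<integral>x. \<bar>f x * g x\<bar> / (a * b) \<partial>M) \<le> (\<integral>x. \<bar>f x\<bar> powr p / (p * A) + \<bar>g x\<bar> powr q / (q * B) \<partial>M)"
      using int f g by (intro integral_mono) auto
    also have "\<dots> = 1 / p + 1 / q"
      using f g A B by (simp add: A_def[symmetric] B_def[symmetric])
    finally have "(\<integral>x. \<bar>f x * g x\<bar> \<partial>M) / (a * b) \<le> 1"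
      using pq by simp
    then show ?thesis
      using a b by (simp add: a_def b_def A_def B_def divide_le_eq split: if_splits)
  qed
qed

locale bounded_domain =
  fixes U :: "(real^'n::finite) set"
  assumes dim: "CARD('n) \<ge> 3" and bounded_U: "bounded U" and open_U: "open U"
begin

text \<open>\<open>sob\<close> is the Sobolev exponent \<open>2\<^sup>*\<close> and \<open>dual\<close> its conjugate exponent.\<close>

definition d :: real where "d = real CARD('n)"
definition sob :: real where "sob = 2 * d / (d - 2)"
definition dual :: real where "dual = 2 * d / (d + 2)"
text \<open>The exponent to which a test function is raised before Gagliardo's inequality is
  applied; differentiating the power turns it into the constant.\<close>

definition C_sob :: real where "C_sob = 2 * (d - 1) / (d - 2)"

abbreviation "M \<equiv> lebesgue_on U"
abbreviation "sob_int w \<equiv> integrable M (\<lambda>x. \<bar>w x\<bar> powr sob)"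
abbreviation "sob_norm w \<equiv> (\<integral>x. \<bar>w x\<bar> powr sob \<partial>M) powr (1 / sob)"

lemma d_ge: "d \<ge> 3" using dim by (simp add: d_def)
lemma sob_gt_2: "sob > 2" using d_ge by (simp add: sob_def field_simps)
lemma dual_gt_1: "dual > 1" using d_ge by (simp add: dual_def field_simps)
lemma dual_sob: "1 / dual + 1 / sob = 1" using d_ge by (simp add: dual_def sob_def field_simps)
lemma C_sob_pos: "C_sob > 0" using d_ge by (simp add: C_sob_def)

lemma U_lmeasurable: "U \<in> lmeasurable"
  using bounded_U open_U by (rule lmeasurable_open)

lemma U_sets: "U \<in> sets lebesgue"
  using U_lmeasurable by (rule fmeasurableD)

sublocale finite_measure M
  by (rule finite_measure_lebesgue_on[OF U_lmeasurable])

lemma continuous_measurable: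
  fixes f :: "real^'n \<Rightarrow> 'b::euclidean_space"
  assumes "continuous_on UNIV f"
  shows "f \<in> borel_measurable M"
  by (rule continuous_imp_measurable_on_sets_lebesgue[OF continuous_on_subset[OF assms subset_UNIV] U_sets])

lemma bounded_sqint:
  fixes f :: "real^'n \<Rightarrow> 'b::euclidean_space"
  assumes "f \<in> borel_measurable M" "\<And>x. norm (f x) \<le> K"
  shows "sqint M f"
  unfolding sqint_def
proof
  show "integrable M (\<lambda>x. (norm (f x))\<^sup>2)"
    by (rule integrable_const_bound[where B = "K\<^sup>2"])
       (use assms in \<open>auto intro!: power_mono\<close>)
qed (rule assms)

lemma test_measurable: "test_fun U \<phi> \<Longrightarrow> \<phi> \<in> borel_measurable M"
  by (rule continuous_measurable[OF test_continuous])

lemma grad_measurable: "test_fun U \<phi> \<Longrightarrow> grad \<phi> \<in> borel_measurable M"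
  by (rule continuous_measurable[OF grad_continuous])

lemma test_sqint: "test_fun U \<phi> \<Longrightarrow> sqint M \<phi>"
  using test_bounded(1)[of U \<phi>] bounded_sqint[OF test_measurable] by auto

lemma grad_sqint: "test_fun U \<phi> \<Longrightarrow> sqint M (grad \<phi>)"
  using test_bounded(2)[of U \<phi>] bounded_sqint[OF grad_measurable] by auto

text \<open>Connects the Sobolev inequality, proved on the whole space for Borel measure, with
  integrals over the domain.\<close>

lemma nn_integral_U:
  assumes "\<And>x. x \<notin> U \<Longrightarrow> f x = 0"
  shows "(\<integral>\<^sup>+x. f x \<partial>M) = (\<integral>\<^sup>+x. f x \<partial>lborel)"
proof -
  have "(\<integral>\<^sup>+x. f x \<partial>M) = (\<integral>\<^sup>+x. f x * indicator U x \<partial>lebesgue)"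
    using U_sets by (intro nn_integral_restrict_space) auto
  also have "\<dots> = (\<integral>\<^sup>+x. f x \<partial>lebesgue)"
    using assms by (intro nn_integral_cong) (auto simp: indicator_def)
  finally show ?thesis by (simp add: nn_integral_completion)
qed

text \<open>The 2d-th root of the power form: \<open>(d - 2) / (2 * d) = 1 / sob\<close> on the left
  and \<open>1 / 2\<close> on the right give the inequality between norms.\<close>

theorem sobolev_test:
  assumes \<phi>: "test_fun U \<phi>"
  shows "sob_int \<phi>"
    and "sob_norm \<phi> \<le> C_sob * L2n M (grad \<phi>)"
proof -
  define X where "X = (\<integral>x. \<bar>\<phi> x\<bar> powr sob \<partial>M)"
  define Y where "Y = (L2n M (grad \<phi>))\<^sup>2"
  have [measurable]: "\<phi> \<in> borel_measurable M" by (rule test_measurable[OF \<phi>])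
  obtain R where R: "\<And>x. x \<in> U \<Longrightarrow> norm x \<le> R"
    using bounded_U by (auto simp: bounded_iff)
  have supp: "\<phi> x = 0" if "norm x > R" for x
    using that R[of x] test_outside[OF \<phi>, of x] by force
  have D: "((\<lambda>t. \<phi> (x + t *\<^sub>R b)) has_real_derivative grad \<phi> (x + t *\<^sub>R b) \<bullet> b) (at t)" for x b t
  proof -
    have "((\<lambda>t. \<phi> (x + t *\<^sub>R b)) has_derivative (\<lambda>s. grad \<phi> (x + t *\<^sub>R b) \<bullet> (s *\<^sub>R b))) (at t)"
      by (rule has_derivative_compose[OF _ test_has_derivative[OF \<phi>]])
         (auto intro!: derivative_eq_intros)
    then show ?thesis
      by (simp add: has_field_derivative_def mult_commute_abs)
  qed
  have contD: "continuous_on UNIV (\<lambda>x. grad \<phi> x \<bullet> b)" for b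
    by (intro continuous_intros grad_continuous[OF \<phi>])
  have DIM: "DIM(real^'n) = CARD('n)" "DIM(real^'n) \<ge> 3" using dim by auto
  have sob': "sob = 2 * DIM(real^'n) / (DIM(real^'n) - 2)" "C_sob = 2 * (DIM(real^'n) - 1) / (DIM(real^'n) - 2)"
    using dim by (auto simp: sob_def C_sob_def d_def)
  note S = sobolev_inequality[OF DIM(2) test_continuous[OF \<phi>] contD D supp sob']
  have nnX: "(\<integral>\<^sup>+x. ennreal (\<bar>\<phi> x\<bar> powr sob) \<partial>M) = (\<integral>\<^sup>+x. ennreal (\<bar>\<phi> x\<bar> powr sob) \<partial>lborel)"
    by (rule nn_integral_U) (simp add: test_outside[OF \<phi>])
  show int: "sob_int \<phi>"
    using S(1) nnX by (intro integrableI_bounded) auto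
  have "(\<integral>\<^sup>+x. ennreal (\<bar>\<phi> x\<bar> powr sob) \<partial>M) = ennreal X"
    unfolding X_def by (rule nn_integral_eq_integral[OF int]) simp
  with nnX have X: "(\<integral>\<^sup>+x. ennreal (\<bar>\<phi> x\<bar> powr sob) \<partial>lborel) = ennreal X" by simp
  have out: "grad \<phi> x = 0" if "x \<notin> U" for x
    by (rule grad_outside[OF \<phi>]) (use \<phi> that in \<open>auto simp: test_fun_def\<close>)
  have "(\<Sum>b\<in>Basis. (v \<bullet> b)\<^sup>2) = (norm v)\<^sup>2" for v :: "real^'n"
    by (subst power2_norm_eq_inner, subst euclidean_inner) (simp add: power2_eq_square)
  then have "(\<integral>\<^sup>+x. ennreal (\<Sum>b\<in>Basis. (grad \<phi> x \<bullet> b)\<^sup>2) \<partial>lborel) = (\<integral>\<^sup>+x. ennreal ((norm (grad \<phi> x))\<^sup>2) \<partial>lborel)"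
    by simp
  also have "\<dots> = (\<integral>\<^sup>+x. ennreal ((norm (grad \<phi> x))\<^sup>2) \<partial>M)"
    by (rule nn_integral_U[symmetric]) (simp add: out)
  also have "\<dots> = ennreal Y"
    unfolding Y_def by (rule nn_integral_sq_eq[OF grad_sqint[OF \<phi>]])
  finally have Y: "(\<integral>\<^sup>+x. ennreal (\<Sum>b\<in>Basis. (grad \<phi> x \<bullet> b)\<^sup>2) \<partial>lborel) = ennreal Y" .
  have X0: "X \<ge> 0" by (simp add: X_def)
  have Y0: "Y \<ge> 0" by (simp add: Y_def)
  have "ennreal (X ^ (CARD('n) - 2)) \<le> ennreal ((C_sob\<^sup>2 * Y) ^ CARD('n))"
    using S(2) X0 Y0 unfolding X Y DIM(1) by (simp add: ennreal_power ennreal_mult[symmetric])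
  then have le: "X ^ (CARD('n) - 2) \<le> (C_sob\<^sup>2 * Y) ^ CARD('n)"
    using Y0 by (simp add: ennreal_le_iff)
  have "X powr (1 / sob) \<le> C_sob * L2n M (grad \<phi>)"
  proof (cases "X = 0")
    case True
    then show ?thesis using C_sob_pos by simp
  next
    case False
    then have Xp: "X > 0" using X0 by simp
    have Yp: "C_sob\<^sup>2 * Y > 0"
    proof (rule ccontr)
      assume "\<not> ?thesis"
      then have "C_sob\<^sup>2 * Y = 0" using Y0 by (meson mult_nonneg_nonneg not_less order_antisym zero_le_power2)
      then have "(C_sob\<^sup>2 * Y) ^ CARD('n) = 0" by simp
      then have "X ^ (CARD('n) - 2) \<le> 0" using le by (simp only:)
      then show False using zero_less_power[OF Xp, of "CARD('n) - 2"] by simp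
    qed
    have "(X ^ (CARD('n) - 2)) powr (1 / (2 * d)) \<le> ((C_sob\<^sup>2 * Y) ^ CARD('n)) powr (1 / (2 * d))"
      using le Xp d_ge by (intro powr_mono2) auto
    moreover have "(X ^ (CARD('n) - 2)) powr (1 / (2 * d)) = X powr (1 / sob)"
    proof -
      have "real (CARD('n) - 2) = d - 2" using dim by (simp add: d_def of_nat_diff)
      then show ?thesis
        using Xp d_ge by (simp add: powr_realpow[symmetric] powr_powr sob_def)
    qed
    moreover have "((C_sob\<^sup>2 * Y) ^ CARD('n)) powr (1 / (2 * d)) = C_sob * L2n M (grad \<phi>)"
    proof -
      have "((C_sob\<^sup>2 * Y) ^ CARD('n)) powr (1 / (2 * d)) = (C_sob\<^sup>2 * Y) powr (1 / 2)"
        using Yp d_ge by (simp add: powr_realpow[symmetric] powr_powr d_def)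
      also have "\<dots> = sqrt (C_sob\<^sup>2 * Y)" using Yp by (simp add: powr_half_sqrt)
      also have "\<dots> = C_sob * L2n M (grad \<phi>)" using C_sob_pos by (simp add: Y_def real_sqrt_mult)
      finally show ?thesis .
    qed
    ultimately show ?thesis by simp
  qed
  then show "sob_norm \<phi> \<le> C_sob * L2n M (grad \<phi>)"
    by (simp add: X_def)
qed

text \<open>Fatou's lemma needs only almost everywhere convergence on the left, and on the right
  only the gradient norms have to converge. This covers functions in \<open>H0\<close> as well as
  compositions \<open>P (u x)\<close>, for which only an approximating sequence is at hand.\<close>

lemma sobolev_limit:
  assumes \<phi>: "\<And>n. test_fun U (\<phi> n)" and w [measurable]: "w \<in> borel_measurable M"
    and ae: "AE x in M. (\<lambda>n. \<phi> n x) \<longlonglongrightarrow> w x"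
    and lim: "(\<lambda>n. L2n M (grad (\<phi> n))) \<longlonglongrightarrow> l"
  shows "sob_int w"
    and "sob_norm w \<le> C_sob * l"
proof -
  have [measurable]: "\<phi> n \<in> borel_measurable M" for n by (rule test_measurable[OF \<phi>])
  have l: "l \<ge> 0"
    by (rule LIMSEQ_le_const[OF lim]) auto
  have sob: "sob > 0" using sob_gt_2 by simp
  have "(\<integral>\<^sup>+x. ennreal (\<bar>w x\<bar> powr sob) \<partial>M) = (\<integral>\<^sup>+x. liminf (\<lambda>n. ennreal (\<bar>\<phi> n x\<bar> powr sob)) \<partial>M)"
  proof (rule nn_integral_cong_AE)
    show "AE x in M. ennreal (\<bar>w x\<bar> powr sob) = liminf (\<lambda>n. ennreal (\<bar>\<phi> n x\<bar> powr sob))"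
      using ae
    proof eventually_elim
      case (elim x)
      have "(\<lambda>n. \<bar>\<phi> n x\<bar> powr sob) \<longlonglongrightarrow> \<bar>w x\<bar> powr sob"
        using sob by (intro tendsto_powr' tendsto_rabs elim tendsto_const) (auto intro!: always_eventually)
      from lim_imp_Liminf[OF sequentially_bot tendsto_ennrealI[OF this]] show ?case by simp
    qed
  qed
  also have "\<dots> \<le> liminf (\<lambda>n. \<integral>\<^sup>+x. ennreal (\<bar>\<phi> n x\<bar> powr sob) \<partial>M)"
    by (rule nn_integral_liminf) simp
  also have "\<dots> \<le> liminf (\<lambda>n. ennreal ((C_sob * L2n M (grad (\<phi> n))) powr sob))"
  proof (rule Liminf_mono, rule always_eventually, rule allI)
    fix n
    let ?X = "\<integral>x. \<bar>\<phi> n x\<bar> powr sob \<partial>M"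
    have "(?X powr (1 / sob)) powr sob \<le> (C_sob * L2n M (grad (\<phi> n))) powr sob"
      using sobolev_test(2)[OF \<phi>[of n]] sob by (intro powr_mono2) auto
    moreover have "(?X powr (1 / sob)) powr sob = ?X"
      using sob by (simp add: powr_powr)
    ultimately show "(\<integral>\<^sup>+x. ennreal (\<bar>\<phi> n x\<bar> powr sob) \<partial>M) \<le> ennreal ((C_sob * L2n M (grad (\<phi> n))) powr sob)"
      by (subst nn_integral_eq_integral[OF sobolev_test(1)[OF \<phi>[of n]]]) (auto intro!: ennreal_leI)
  qed
  also have "\<dots> = ennreal ((C_sob * l) powr sob)"
  proof (rule lim_imp_Liminf[OF sequentially_bot tendsto_ennrealI])
    show "(\<lambda>n. (C_sob * L2n M (grad (\<phi> n))) powr sob) \<longlonglongrightarrow> (C_sob * l) powr sob"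
      using C_sob_pos sob by (intro tendsto_powr' tendsto_mult tendsto_const lim) (auto intro!: always_eventually)
  qed
  finally have le: "(\<integral>\<^sup>+x. ennreal (\<bar>w x\<bar> powr sob) \<partial>M) \<le> ennreal ((C_sob * l) powr sob)" .
  then show int: "sob_int w"
    by (intro integrableI_bounded) (auto simp: le_less_trans)
  have "(\<integral>x. \<bar>w x\<bar> powr sob \<partial>M) \<le> (C_sob * l) powr sob"
    using le by (simp add: nn_integral_eq_integral[OF int])
  then have "sob_norm w \<le> ((C_sob * l) powr sob) powr (1 / sob)"
    using sob by (intro powr_mono2) auto
  also have "\<dots> = C_sob * l"
    using sob l C_sob_pos by (simp add: powr_powr)
  finally show "sob_norm w \<le> C_sob * l" .
qed

lemma L2_vec_iff: "L2_vec U F \<longleftrightarrow> sqint M F"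
  by (simp add: L2_vec_def sqint_def)

lemma L2_vec_norm_eq: "L2_vec_norm U F = L2n M F"
  by (simp add: L2_vec_norm_def L2n_def)

lemma Lp_2_iff: "Lp U 2 u \<longleftrightarrow> sqint M u"
  by (simp add: Lp_def sqint_def powr_numeral)

lemma H0_iff:
  "H0 U u Du \<longleftrightarrow> sqint M u \<and> sqint M Du \<and> (\<exists>\<phi>. (\<forall>n. test_fun U (\<phi> n))
     \<and> (\<lambda>n. L2dist M (\<phi> n) u) \<longlonglongrightarrow> 0 \<and> (\<lambda>n. L2dist M (grad (\<phi> n)) Du) \<longlonglongrightarrow> 0)"
  by (simp add: H0_def L2_vec_iff Lp_2_iff L2n_tendsto_iff)

lemma H0_AE_sequence:
  assumes "H0 U u Du"
  obtains \<phi> where "\<And>n. test_fun U (\<phi> n)" "AE x in M. (\<lambda>n. \<phi> n x) \<longlonglongrightarrow> u x"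
    "(\<lambda>n. L2dist M (grad (\<phi> n)) Du) \<longlonglongrightarrow> 0"
proof -
  obtain \<phi> where u: "sqint M u" "sqint M Du" and \<phi>: "\<And>n. test_fun U (\<phi> n)"
    and lim: "(\<lambda>n. L2dist M (\<phi> n) u) \<longlonglongrightarrow> 0" "(\<lambda>n. L2dist M (grad (\<phi> n)) Du) \<longlonglongrightarrow> 0"
    using assms unfolding H0_iff by blast
  obtain r where r: "strict_mono r" "AE x in M. (\<lambda>n. \<phi> (r n) x) \<longlonglongrightarrow> u x"
    using L2_AE_subseq[OF test_sqint[OF \<phi>] u(1) lim(1)] by blast
  have "(\<lambda>n. L2n M (\<lambda>x. grad (\<phi> (r n)) x - Du x)) \<longlonglongrightarrow> 0"
    using LIMSEQ_subseq_LIMSEQ[OF lim(2) r(1)] by (simp add: o_def)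
  with that[of "\<lambda>n. \<phi> (r n)"] \<phi> r(2) show ?thesis by blast
qed

lemma sobolev_H0:
  assumes "H0 U u Du"
  shows "sob_int u"
    and "sob_norm u \<le> C_sob * L2n M Du"
proof -
  have u: "sqint M u" "sqint M Du" using assms by (auto simp: H0_iff)
  obtain \<phi> where \<phi>: "\<And>n. test_fun U (\<phi> n)" "AE x in M. (\<lambda>n. \<phi> n x) \<longlonglongrightarrow> u x"
    "(\<lambda>n. L2dist M (grad (\<phi> n)) Du) \<longlonglongrightarrow> 0"
    by (rule H0_AE_sequence[OF assms]) blast
  note lim = L2n_tendsto[OF grad_sqint[OF \<phi>(1)] u(2) \<phi>(3)]
  from sobolev_limit[OF \<phi>(1) sqint_measurable[OF u(1)] \<phi>(2) lim]
  show "sob_int u"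
    "sob_norm u \<le> C_sob * L2n M Du" by blast+
qed

lemma H0_test: "test_fun U \<phi> \<Longrightarrow> H0 U \<phi> (grad \<phi>)"
  unfolding H0_iff using test_sqint grad_sqint
  by (auto intro!: exI[of _ "\<lambda>_. \<phi>"] simp: L2n_def)

text \<open>Allows bounds on \<open>H0\<close> to be applied to the error of an approximation by
  test functions.\<close>

lemma H0_diff_test:
  assumes \<phi>: "test_fun U \<phi>" and u: "H0 U u Du"
  shows "H0 U (\<lambda>x. \<phi> x - u x) (\<lambda>x. grad \<phi> x - Du x)"
proof -
  obtain \<psi> where \<psi>: "\<And>n. test_fun U (\<psi> n)" "(\<lambda>n. L2dist M (\<psi> n) u) \<longlonglongrightarrow> 0"
    "(\<lambda>n. L2dist M (grad (\<psi> n)) Du) \<longlonglongrightarrow> 0" and s: "sqint M u" "sqint M Du"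
    using u unfolding H0_iff by blast
  have eq: "L2n M (\<lambda>x. (\<phi> x - \<psi> n x) - (\<phi> x - u x)) = L2dist M (\<psi> n) u"
    "L2n M (\<lambda>x. grad (\<lambda>x. \<phi> x - \<psi> n x) x - (grad \<phi> x - Du x)) = L2dist M (grad (\<psi> n)) Du" for n
    by (simp_all add: grad_diff[OF \<phi> \<psi>(1)] L2n_minus_commute[of M u] L2n_minus_commute[of M Du])
  show ?thesis
    unfolding H0_iff
    by (intro conjI exI[of _ "\<lambda>n x. \<phi> x - \<psi> n x"] allI sqint_diff s
        test_sqint[OF \<phi>] grad_sqint[OF \<phi>] test_diff \<phi> \<psi>(1)) (simp_all only: eq \<psi>)
qed

text \<open>The reason for the exponent \<open>2 * d / (d + 2)\<close>: it is conjugate to the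
  Sobolev exponent, so products of \<open>c\<close> or \<open>f\<close> with functions in
  \<open>H0\<close> are integrable.\<close>

lemma dual_pairing:
  assumes f: "Lp U dual f" and w: "w \<in> borel_measurable M" "sob_int w"
  shows "integrable M (\<lambda>x. f x * w x)"
    and "\<bar>\<integral>x. f x * w x \<partial>M\<bar> \<le> Lp_norm U dual f * sob_norm w"
proof -
  have sob1: "sob > 1" using sob_gt_2 by simp
  note H = Holder_inequality[OF dual_gt_1 sob1 dual_sob _ w(1) _ w(2)]
  show int: "integrable M (\<lambda>x. f x * w x)"
    using f by (intro H) (auto simp: Lp_def)
  have "\<bar>\<integral>x. f x * w x \<partial>M\<bar> \<le> (\<integral>x. \<bar>f x * w x\<bar> \<partial>M)"
    by (rule integral_abs_bound)
  also have "\<dots> \<le> Lp_norm U dual f * sob_norm w"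
    unfolding Lp_norm_def using f by (intro H) (auto simp: Lp_def)
  finally show "\<bar>\<integral>x. f x * w x \<partial>M\<bar> \<le> Lp_norm U dual f * sob_norm w" .
qed

end

section \<open>Smooth truncations\<close>

lemma smooth_real_lincomb:
  assumes "smooth_real f" "smooth_real g"
  shows "smooth_real (\<lambda>x. a * f x + b * g x)"
proof -
  obtain D E where D: "D 0 = f" "\<And>k x. (D k has_real_derivative D (Suc k) x) (at x)"
    and E: "E 0 = g" "\<And>k x. (E k has_real_derivative E (Suc k) x) (at x)"
    using assms by (auto simp: smooth_real_def)
  have "((\<lambda>x. a * D k x + b * E k x) has_real_derivative a * D (Suc k) x + b * E (Suc k) x) (at x)" for k x
    by (intro DERIV_add DERIV_cmult D E)
  then show ?thesis
    unfolding smooth_real_def using D(1) E(1) by (intro exI[of _ "\<lambda>k x. a * D k x + b * E k x"]) auto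
qed

text \<open>Polynomials times real powers of \<open>(s - a)^2 + e\<close> form a class closed under
  differentiation, the exponent dropping by one each time. Derivatives of smoothed absolute values
  belong to it.\<close>

lemma smooth_real_poly_powr:
  assumes e: "e > 0"
  shows "smooth_real (\<lambda>s. poly p s * ((s - a)\<^sup>2 + e) powr r)"
proof (rule smooth_real_coinduct[where S = "{\<lambda>s. poly p s * ((s - a)\<^sup>2 + e) powr r | p r. True}"])
  fix f assume "f \<in> {\<lambda>s. poly p s * ((s - a)\<^sup>2 + e) powr r | p r. True}"
  then obtain p r where f: "f = (\<lambda>s. poly p s * ((s - a)\<^sup>2 + e) powr r)" by blast
  \<comment> \<open>The polynomial left after pulling out the power \<open>r - 1\<close>;
    \<open>[:a\<^sup>2 + e, - 2 * a, 1:]\<close> is \<open>(s - a)\<^sup>2 + e\<close>, and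
    \<open>[:- 2 * a, 2:]\<close> is its derivative.\<close>
  let ?q = "pderiv p * [:a\<^sup>2 + e, - 2 * a, 1:] + smult r (p * [:- 2 * a, 2:])"
  have "(f has_real_derivative poly ?q s * ((s - a)\<^sup>2 + e) powr (r - 1)) (at s)" for s
  proof -
    have pos: "(s - a)\<^sup>2 + e > 0" using e by (simp add: add_nonneg_pos)
    have "(f has_real_derivative poly (pderiv p) s * ((s - a)\<^sup>2 + e) powr r
        + poly p s * (r * ((s - a)\<^sup>2 + e) powr (r - 1) * (2 * (s - a)))) (at s)"
      unfolding f using pos
      by (auto intro!: derivative_eq_intros)
    moreover have powr_eq: "((s - a)\<^sup>2 + e) powr r = ((s - a)\<^sup>2 + e) powr (r - 1) * ((s - a)\<^sup>2 + e)"
      using pos by (simp add: powr_diff)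
    moreover have pq: "poly ?q s = poly (pderiv p) s * ((s - a)\<^sup>2 + e) + r * (poly p s * (2 * (s - a)))"
      by (simp add: power2_eq_square algebra_simps)
    moreover have "poly (pderiv p) s * ((s - a)\<^sup>2 + e) powr r
        + poly p s * (r * ((s - a)\<^sup>2 + e) powr (r - 1) * (2 * (s - a))) = poly ?q s * ((s - a)\<^sup>2 + e) powr (r - 1)"
      unfolding powr_eq pq by (simp add: algebra_simps)
    ultimately show ?thesis by (simp only:)
  qed
  then show "\<exists>f'\<in>{\<lambda>s. poly p s * ((s - a)\<^sup>2 + e) powr r | p r. True}. \<forall>s. (f has_real_derivative f' s) (at s)"
    by (intro bexI[of _ "\<lambda>s. poly ?q s * ((s - a)\<^sup>2 + e) powr (r - 1)"]) blast+
qed blast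

text \<open>\<open>s^+ = (s + \<bar>s\<bar>) / 2\<close> with the absolute value smoothed to
  \<open>sqrt (s\<^sup>2 + e)\<close>.\<close>

definition soft_pos :: "real \<Rightarrow> real \<Rightarrow> real" where
  "soft_pos e s = (s + sqrt (s\<^sup>2 + e)) / 2"

text \<open>Derivative of \<open>sqrt (s\<^sup>2 + e)\<close>, that is, a smoothed sign.\<close>

definition soft_step :: "real \<Rightarrow> real \<Rightarrow> real" where
  "soft_step e s = s / sqrt (s\<^sup>2 + e)"

lemma soft_pos_DERIV:
  assumes "e > 0"
  shows "(soft_pos e has_real_derivative (1 + soft_step e s) / 2) (at s)"
proof -
  have "s\<^sup>2 + e > 0" using assms by (simp add: add_nonneg_pos)
  then show ?thesis
    unfolding soft_pos_def[abs_def] soft_step_def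
    by (auto intro!: derivative_eq_intros simp: field_simps)
qed

lemma soft_step_smooth:
  assumes "e > 0"
  shows "smooth_real (\<lambda>s. soft_step e (s - a))"
proof -
  have "soft_step e (s - a) = poly [:- a, 1:] s * ((s - a)\<^sup>2 + e) powr (- (1 / 2))" for s
  proof -
    have "(s - a)\<^sup>2 + e \<ge> 0" using assms by simp
    then have "((s - a)\<^sup>2 + e) powr (- (1 / 2)) = inverse (sqrt ((s - a)\<^sup>2 + e))"
      by (simp only: powr_minus powr_half_sqrt)
    then show ?thesis by (simp only: soft_step_def divide_inverse[of "s - a"]) simp
  qed
  then show ?thesis using smooth_real_poly_powr[OF assms, of "[:- a, 1:]" a "- (1 / 2)"] by presburger
qed

lemma soft_step_bounds: "e > 0 \<Longrightarrow> \<bar>soft_step e s\<bar> \<le> 1"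
proof -
  assume e: "e > 0"
  have "\<bar>s\<bar> \<le> sqrt (s\<^sup>2 + e)"
    using e by (intro real_le_rsqrt) simp
  moreover have "sqrt (s\<^sup>2 + e) > 0" using e by (simp add: add_nonneg_pos)
  ultimately show ?thesis by (simp add: soft_step_def)
qed

lemma soft_step_mono:
  assumes e: "e > 0" and "s \<le> t"
  shows "soft_step e s \<le> soft_step e t"
proof (rule DERIV_nonneg_imp_nondecreasing[OF \<open>s \<le> t\<close>])
  fix x
  have pos: "x\<^sup>2 + e > 0" using e by (simp add: add_nonneg_pos)
  have "(soft_step e has_real_derivative e / ((x\<^sup>2 + e) * sqrt (x\<^sup>2 + e))) (at x)"
    unfolding soft_step_def[abs_def] using pos
    by (auto intro!: derivative_eq_intros simp: field_simps power2_eq_square)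
  then show "\<exists>y. (soft_step e has_real_derivative y) (at x) \<and> 0 \<le> y"
    using e pos by (intro exI[of _ "e / ((x\<^sup>2 + e) * sqrt (x\<^sup>2 + e))"] conjI) (auto intro!: divide_nonneg_pos)
qed

lemma soft_pos_approx:
  assumes "e > 0"
  shows "\<bar>soft_pos (e\<^sup>2) s - max 0 s\<bar> \<le> e"
proof -
  have "sqrt (s\<^sup>2 + e\<^sup>2) \<le> \<bar>s\<bar> + e"
    using sqrt_sum_squares_le_sum_abs[of s e] assms by simp
  moreover have "\<bar>s\<bar> \<le> sqrt (s\<^sup>2 + e\<^sup>2)"
    by (intro real_le_rsqrt) simp
  ultimately show ?thesis
    using assms unfolding soft_pos_def by (cases "0 \<le> s") (simp_all add: abs_le_iff field_simps)
qed

lemma DERIV_01_lipschitz: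
  fixes P :: "real \<Rightarrow> real"
  assumes "\<And>x. (P has_real_derivative P' x) (at x)" "\<And>x. 0 \<le> P' x" "\<And>x. P' x \<le> 1" "s \<le> t"
  shows "0 \<le> P t - P s" "P t - P s \<le> t - s"
proof -
  show "0 \<le> P t - P s"
  proof -
    have "P s \<le> P t"
      by (rule DERIV_nonneg_imp_nondecreasing[OF \<open>s \<le> t\<close>]) (use assms(1,2) in blast)
    then show ?thesis by simp
  qed
  have "((\<lambda>x. x - P x) has_real_derivative 1 - P' x) (at x)" for x
    by (intro DERIV_diff DERIV_ident assms(1))
  moreover have "0 \<le> 1 - P' x" for x using assms(3)[of x] by simp
  ultimately have "s - P s \<le> t - P t"
    by (intro DERIV_nonneg_imp_nondecreasing[OF \<open>s \<le> t\<close>, of "\<lambda>x. x - P x"]) blast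
  then show "P t - P s \<le> t - s" by simp
qed

text \<open>Bounded smooth approximations of \<open>s \<mapsto> (s - k)\<^sup>+\<close> that vanish at \<open>0\<close>.\<close>

definition soft_trunc :: "real \<Rightarrow> nat \<Rightarrow> real \<Rightarrow> real" where
  "soft_trunc k n s = (let e = (1 / real (Suc n))\<^sup>2; N = real (Suc n) in
     (soft_pos e (s - k) - soft_pos e (s - (k + N))) - (soft_pos e (0 - k) - soft_pos e (0 - (k + N))))"

text \<open>Up to a constant this is a smoothed ramp between \<open>k\<close> and
  \<open>k + N\<close>. It takes values in \<open>[0, N]\<close> because \<open>soft_pos\<close> is
  nondecreasing with Lipschitz constant 1, so subtracting its value at 0 leaves a function bounded
  by \<open>N\<close>. The derivative is half the difference of two shifted soft steps, hence
  between 0 and 1.\<close>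

lemma soft_trunc_props:
  fixes k :: real and n :: nat
  obtains P' where "smooth_real P'" "\<And>s. (soft_trunc k n has_real_derivative P' s) (at s)"
    "\<And>s. 0 \<le> P' s" "\<And>s. P' s \<le> 1"
    "soft_trunc k n 0 = 0" "\<And>s. \<bar>soft_trunc k n s\<bar> \<le> real (Suc n)"
proof -
  define e N where "e = (1 / real (Suc n))\<^sup>2" and "N = real (Suc n)"
  have e: "e > 0" and N: "N \<ge> 0" by (auto simp: e_def N_def)
  define P' where "P' s = 1/2 * soft_step e (s - k) + (- 1/2) * soft_step e (s - (k + N))" for s
  have P: "soft_trunc k n = (\<lambda>s. (soft_pos e (s - k) - soft_pos e (s - (k + N))) - (soft_pos e (0 - k) - soft_pos e (0 - (k + N))))"
    by (rule ext) (simp only: soft_trunc_def Let_def e_def N_def)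
  have sm: "smooth_real P'"
    unfolding P'_def[abs_def] by (intro smooth_real_lincomb soft_step_smooth e)
  have der: "(soft_trunc k n has_real_derivative P' s) (at s)" for s
  proof -
    have sh: "((\<lambda>s. soft_pos e (s - a)) has_real_derivative (1 + soft_step e (s - a)) / 2) (at s)" for a
      using DERIV_chain2[OF soft_pos_DERIV[OF e] DERIV_diff[OF DERIV_ident DERIV_const]] by simp
    have "((\<lambda>s. (soft_pos e (s - k) - soft_pos e (s - (k + N))) - (soft_pos e (0 - k) - soft_pos e (0 - (k + N)))) has_real_derivative
       ((1 + soft_step e (s - k)) / 2 - (1 + soft_step e (s - (k + N))) / 2) - 0) (at s)"
      by (intro DERIV_diff sh DERIV_const)
    moreover have "((1 + soft_step e (s - k)) / 2 - (1 + soft_step e (s - (k + N))) / 2) - 0 = P' s"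
      unfolding P'_def by argo
    ultimately show ?thesis unfolding P by (simp only:)
  qed
  have nonneg: "0 \<le> P' s" for s
    using soft_step_mono[OF e, of "s - (k + N)" "s - k"] N by (simp add: P'_def)
  have le1: "P' s \<le> 1" for s
    using soft_step_bounds[OF e, of "s - k"] soft_step_bounds[OF e, of "s - (k + N)"] by (simp add: P'_def)
  have hd: "(soft_pos e has_real_derivative (1 + soft_step e s) / 2) (at s)"
    "0 \<le> (1 + soft_step e s) / 2" "(1 + soft_step e s) / 2 \<le> 1" for s
    using soft_pos_DERIV[OF e, of s] soft_step_bounds[OF e, of s] by auto
  have b: "0 \<le> soft_pos e (s - k) - soft_pos e (s - (k + N))" "soft_pos e (s - k) - soft_pos e (s - (k + N)) \<le> N" for s
    using DERIV_01_lipschitz[OF hd, of "s - (k + N)" "s - k"] N by auto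
  have "\<bar>soft_trunc k n s\<bar> \<le> real (Suc n)" for s
    using b[of s] b[of 0] unfolding P N_def[symmetric] abs_le_iff by linarith
  moreover have "soft_trunc k n 0 = 0" by (simp add: P)
  ultimately show ?thesis using that sm der nonneg le1 by blast
qed

lemma soft_trunc_lim:
  assumes k: "k \<ge> 0"
  shows "(\<lambda>n. soft_trunc k n s) \<longlonglongrightarrow> max 0 (s - k)"
proof -
  \<comment> \<open>Once \<open>n + 1\<close> is at least \<open>s - k\<close>, the upper kink is
    out of reach, and each of the four \<open>soft_pos\<close> terms is within \<open>e\<close> of
    the positive part it approximates. By \<open>k \<ge> 0\<close> these positive parts are 0 for
    both terms of the subtracted constant.\<close>
  have bound: "norm (soft_trunc k n s - max 0 (s - k)) \<le> 4 * (1 / real (Suc n))" if n: "s - k \<le> real (Suc n)" for n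
  proof -
    define e where "e = 1 / real (Suc n)"
    have e: "e > 0" by (simp add: e_def)
    note S = soft_pos_approx[OF e]
    have "\<bar>soft_pos (e\<^sup>2) (s - (k + real (Suc n)))\<bar> \<le> e"
      using S[of "s - (k + real (Suc n))"] n by (simp add: max_def split: if_splits)
    moreover have "\<bar>soft_pos (e\<^sup>2) (0 - k)\<bar> \<le> e" "\<bar>soft_pos (e\<^sup>2) (0 - (k + real (Suc n)))\<bar> \<le> e"
      using S[of "0 - k"] S[of "0 - (k + real (Suc n))"] k by (auto simp: max_def split: if_splits)
    moreover have "soft_trunc k n s = (soft_pos (e\<^sup>2) (s - k) - soft_pos (e\<^sup>2) (s - (k + real (Suc n))))
        - (soft_pos (e\<^sup>2) (0 - k) - soft_pos (e\<^sup>2) (0 - (k + real (Suc n))))"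
      by (simp only: soft_trunc_def Let_def e_def)
    ultimately show ?thesis
      using S[of "s - k"] unfolding e_def[symmetric] real_norm_def by linarith
  qed
  obtain n0 :: nat where n0: "s - k \<le> real n0" using real_arch_simple by blast
  have "eventually (\<lambda>n. norm (soft_trunc k n s - max 0 (s - k)) \<le> 4 * (1 / real (Suc n))) sequentially"
    unfolding eventually_sequentially
  proof (intro exI allI impI)
    fix n assume "n0 \<le> n"
    then have "real n0 \<le> real (Suc n)" by simp
    with n0 have "s - k \<le> real (Suc n)" by linarith
    then show "norm (soft_trunc k n s - max 0 (s - k)) \<le> 4 * (1 / real (Suc n))" by (rule bound)
  qed
  moreover have "(\<lambda>n. 4 * (1 / real (Suc n))) \<longlonglongrightarrow> 0"
    using tendsto_mult_right_zero[OF LIMSEQ_Suc[OF lim_1_over_n], of 4] by simp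
  ultimately have "(\<lambda>n. soft_trunc k n s - max 0 (s - k)) \<longlonglongrightarrow> 0"
    by (rule Lim_null_comparison)
  then show ?thesis by (simp add: LIM_zero_iff)
qed

text \<open>A nondecreasing \<open>P\<close> with \<open>P 0 = 0\<close> has the sign of its
  argument, so its primitive from 0 is smallest there. Composed with test functions,
  \<open>S\<close> supplies the nonnegative test functions for the condition on
  \<open>B\<close>.\<close>

lemma nonneg_antiderivative:
  fixes P :: "real \<Rightarrow> real"
  assumes der: "\<And>x. (P has_real_derivative P' x) (at x)" and nonneg: "\<And>x. 0 \<le> P' x" and P0: "P 0 = 0"
  obtains S where "\<And>x. (S has_real_derivative P x) (at x)" "S 0 = 0" "\<And>x. S x \<ge> 0"
proof -
  have "\<exists>F. \<forall>x :: real. -\<infinity> < ereal x \<longrightarrow> ereal x < \<infinity> \<longrightarrow> (F has_vector_derivative P x) (at x)"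
    by (rule einterval_antiderivative) (use DERIV_isCont[OF der] in auto)
  then obtain F where F: "\<And>x. (F has_real_derivative P x) (at x)"
    by (auto simp: has_real_derivative_iff_has_vector_derivative)
  define S where "S x = F x - F 0" for x
  have S: "(S has_real_derivative P x) (at x)" for x
    unfolding S_def[abs_def] using DERIV_diff[OF F DERIV_const] by simp
  have mono: "P s \<le> P t" if "s \<le> t" for s t
    by (rule DERIV_nonneg_imp_nondecreasing[OF that]) (use der nonneg in blast)
  have "S x \<ge> 0" for x
  proof (cases "x \<ge> 0")
    case True
    have "S 0 \<le> S x"
    proof (rule DERIV_nonneg_imp_nondecreasing[OF True])
      fix y :: real assume "0 \<le> y"
      then show "\<exists>z. (S has_real_derivative z) (at y) \<and> 0 \<le> z" using S mono[of 0 y] P0 by auto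
    qed
    then show ?thesis by (simp add: S_def)
  next
    case False
    then have "x \<le> 0" by simp
    have "S x \<ge> S 0"
    proof (rule DERIV_nonpos_imp_nonincreasing[OF \<open>x \<le> 0\<close>])
      fix y :: real assume "y \<le> 0"
      then show "\<exists>z. (S has_real_derivative z) (at y) \<and> z \<le> 0" using S mono[of y 0] P0 by auto
    qed
    then show ?thesis by (simp add: S_def)
  qed
  with that[of S] S show ?thesis by (simp add: S_def)
qed

section \<open>The energy estimate\<close>

lemma tendsto_zero_bound:
  fixes f :: "nat \<Rightarrow> real"
  assumes "\<And>n. norm (f n) \<le> g n" "g \<longlonglongrightarrow> 0"
  shows "f \<longlonglongrightarrow> 0"
  by (rule Lim_null_comparison[OF always_eventually assms(2)]) (use assms(1) in blast)

lemma L2n_mono_AE: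
  assumes "sqint M G" "F \<in> borel_measurable M" "AE x in M. norm (F x) \<le> K * norm (G x)" "K \<ge> 0"
  shows "sqint M F" "L2n M F \<le> K * L2n M G"
proof -
  have sq: "AE x in M. (norm (F x))\<^sup>2 \<le> K\<^sup>2 * (norm (G x))\<^sup>2"
    using assms(3)
  proof eventually_elim
    case (elim x)
    then show ?case using power_mono[OF elim, of 2] by (simp add: power_mult_distrib)
  qed
  have int: "integrable M (\<lambda>x. K\<^sup>2 * (norm (G x))\<^sup>2)"
    using assms(1) by (simp add: sqint_def)
  have "integrable M (\<lambda>x. (norm (F x))\<^sup>2)"
    by (rule Bochner_Integration.integrable_bound[OF int]) (use assms(2) sq in auto)
  then show F: "sqint M F"
    using assms(2) by (simp add: sqint_def)
  have "(L2n M F)\<^sup>2 \<le> (\<integral>x. K\<^sup>2 * (norm (G x))\<^sup>2 \<partial>M)"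
    unfolding L2n_square using sqint_integrable[OF F] int sq by (intro integral_mono_AE) auto
  also have "\<dots> = (K * L2n M G)\<^sup>2"
    by (simp add: L2n_square power_mult_distrib)
  finally show "L2n M F \<le> K * L2n M G"
    by (rule power2_le_imp_le) (use assms(4) in simp)
qed

locale elliptic = bounded_domain U for U :: "(real^'n::finite) set" +
  fixes lam MA :: real and A :: "real^'n \<Rightarrow> real^'n^'n" and B :: "real^'n \<Rightarrow> real^'n" and c :: "real^'n \<Rightarrow> real"
  assumes adm: "admissible U lam MA A B c"
begin

lemma lam_pos: "lam > 0" using adm by (simp add: admissible_def)

lemma B_sqint: "sqint M B" using adm by (simp add: admissible_def L2_vec_iff)

lemma B_nonneg: "test_fun U \<phi> \<Longrightarrow> (\<And>x. \<phi> x \<ge> 0) \<Longrightarrow> 0 \<le> (\<integral>x. B x \<bullet> grad \<phi> x \<partial>M)"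
  using adm by (simp add: admissible_def)

lemma c_Lp: "Lp U dual c" using adm by (simp add: admissible_def dual_def d_def)

lemma c_nonneg: "AE x in M. c x \<ge> 0" using adm by (simp add: admissible_def)

lemma A_elliptic: "AE x in M. \<forall>\<xi>. lam * (norm \<xi>)\<^sup>2 \<le> (A x *v \<xi>) \<bullet> \<xi>"
  using adm by (simp add: admissible_def)

text \<open>A crude bound through the entries suffices: it is used for integrability and for the
  continuity of the form, while all quantitative estimates rest on ellipticity.\<close>

lemma A_sqint:
  assumes F: "sqint M F"
  shows "sqint M (\<lambda>x. A x *v F x)" "L2n M (\<lambda>x. A x *v F x) \<le> real CARD('n) * (real CARD('n) * MA) * L2n M F"
proof -
  have Am [measurable]: "(\<lambda>x. A x $ i $ j) \<in> borel_measurable M" for i j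
    using adm by (simp add: admissible_def)
  have Fm [measurable]: "F \<in> borel_measurable M" by (rule sqint_measurable[OF F])
  have Fc [measurable]: "(\<lambda>x. F x $ j) \<in> borel_measurable M" for j
  proof -
    have "(\<lambda>x. F x \<bullet> axis j 1) \<in> borel_measurable M" by measurable
    then show ?thesis by (simp add: inner_axis)
  qed
  have comp: "(\<lambda>x. (A x *v F x) \<bullet> b) \<in> borel_measurable M" if bas: "b \<in> Basis" for b
  proof -
    obtain i and r :: real where "b = axis i r" "r \<in> Basis"
      using bas unfolding Basis_vec_def by blast
    then have b: "b = axis i 1" by simp
    have "(\<lambda>x. \<Sum>j\<in>UNIV. A x $ i $ j * F x $ j) \<in> borel_measurable M" by measurable
    then show ?thesis by (simp add: b inner_axis matrix_vector_mult_def)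
  qed
  have meas: "(\<lambda>x. A x *v F x) \<in> borel_measurable M"
    by (subst borel_measurable_euclidean_space) (use comp in auto)
  have MA: "MA > 0" using adm by (simp add: admissible_def)
  have "AE x in M. \<forall>i j. \<bar>A x $ i $ j\<bar> \<le> MA" using adm by (simp add: admissible_def)
  then have bound: "AE x in M. norm (A x *v F x) \<le> real CARD('n) * (real CARD('n) * MA) * norm (F x)"
  proof eventually_elim
    case (elim x)
    have "\<bar>(A x *v F x) $ i\<bar> \<le> real CARD('n) * MA * norm (F x)" for i
    proof -
      have "\<bar>(A x *v F x) $ i\<bar> \<le> (\<Sum>j\<in>UNIV. \<bar>A x $ i $ j * F x $ j\<bar>)"
        unfolding matrix_vector_mult_def by simp
      also have "\<dots> \<le> (\<Sum>j\<in>(UNIV::'n set). MA * norm (F x))"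
        using elim component_le_norm_cart[of "F x"] MA
        by (intro sum_mono) (auto simp: abs_mult intro!: mult_mono)
      finally show ?thesis by simp
    qed
    then have "(\<Sum>i\<in>UNIV. \<bar>(A x *v F x) $ i\<bar>) \<le> (\<Sum>i\<in>(UNIV::'n set). real CARD('n) * MA * norm (F x))"
      by (intro sum_mono) auto
    then show ?case using norm_le_l1_cart[of "A x *v F x"] by simp
  qed
  have K: "real CARD('n) * (real CARD('n) * MA) \<ge> 0" using MA by simp
  show "sqint M (\<lambda>x. A x *v F x)" "L2n M (\<lambda>x. A x *v F x) \<le> real CARD('n) * (real CARD('n) * MA) * L2n M F"
    using L2n_mono_AE[OF F meas bound K] by auto
qed

lemma Lp_dual_integrable: "Lp U dual f \<Longrightarrow> integrable M f"
  using dual_pairing(1)[of f "\<lambda>_. 1"] by simp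

lemma c_u_integrable:
  assumes "H0 U u Du"
  shows "integrable M (\<lambda>x. c x * u x)"
  using dual_pairing(1)[OF c_Lp _ sobolev_H0(1)[OF assms]] assms sqint_measurable by (auto simp: H0_iff)

text \<open>\<open>P (u x)\<close> is not a test function, so \<open>P\<close> of approximating test
  functions is inserted and the limit taken. Boundedness of \<open>P\<close> serves this passage to
  the limit; as \<open>K\<close> is absent from the conclusion, the result applies to families with
  growing bounds.\<close>

lemma energy_estimate:
  assumes u: "H0 U u Du" and weak: "weak_sol U A B c u Du f" and f: "Lp U dual f"
    and P': "smooth_real P'" and der: "\<And>s. (P has_real_derivative P' s) (at s)"
    and P'0: "\<And>s. 0 \<le> P' s" and P'1: "\<And>s. P' s \<le> 1" and P0: "P 0 = 0" and bound: "\<And>s. \<bar>P s\<bar> \<le> K"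
  shows "(sob_norm (\<lambda>x. P (u x)))\<^sup>2 \<le> C_sob\<^sup>2 / lam * (\<integral>x. f x * P (u x) \<partial>M)"
proof -
  have su: "sqint M u" and sDu: "sqint M Du" using u by (auto simp: H0_iff)
  note [measurable] = sqint_measurable[OF su] sqint_measurable[OF sDu] sqint_measurable[OF B_sqint]
  have contP: "continuous_on UNIV P" by (meson DERIV_isCont continuous_at_imp_continuous_on der)
  obtain P'' where "\<And>s. (P' has_real_derivative P'' s) (at s)" using smooth_realD[OF P'] by blast
  then have isContP': "isCont P' s" for s using DERIV_isCont by blast
  then have contP': "continuous_on UNIV P'" by (simp add: continuous_at_imp_continuous_on)
  have isContP: "isCont P s" for s using DERIV_isCont der by blast
  have [measurable]: "P \<in> borel_measurable borel" "P' \<in> borel_measurable borel"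
    using contP contP' by (auto intro: borel_measurable_continuous_onI)
  have smP: "smooth_real P" by (rule smooth_real_antiderivative[OF P' der])
  have K: "K \<ge> 0" using bound[of 0] by simp
  obtain S where S: "\<And>s. (S has_real_derivative P s) (at s)" "S 0 = 0" "\<And>s. S s \<ge> 0"
    using nonneg_antiderivative[OF der P'0 P0] by blast
  obtain \<phi> where \<phi>: "\<And>n. test_fun U (\<phi> n)" and ae: "AE x in M. (\<lambda>n. \<phi> n x) \<longlonglongrightarrow> u x"
    and grad_lim: "(\<lambda>n. L2dist M (grad (\<phi> n)) Du) \<longlonglongrightarrow> 0"
    by (rule H0_AE_sequence[OF u]) blast
  note [measurable] = test_measurable[OF \<phi>] grad_measurable[OF \<phi>]
  define \<psi> where "\<psi> n x = P (\<phi> n x)" for n x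
  have \<psi>: "test_fun U (\<psi> n)" for n
    unfolding \<psi>_def[abs_def] by (rule test_compose[OF \<phi> smP P0])
  have grad\<psi>: "grad (\<psi> n) x = P' (\<phi> n x) *\<^sub>R grad (\<phi> n) x" for n x
    unfolding \<psi>_def[abs_def] by (rule grad_compose[OF \<phi> der])
  have \<psi>_lim: "AE x in M. (\<lambda>n. \<psi> n x) \<longlonglongrightarrow> P (u x)"
    using ae unfolding \<psi>_def by eventually_elim (rule isCont_tendsto_compose[OF isContP])
  have [measurable]: "\<psi> n \<in> borel_measurable M" for n by (rule test_measurable[OF \<psi>])
  define G where "G x = P' (u x) *\<^sub>R Du x" for x
  have Gm: "G \<in> borel_measurable M" unfolding G_def[abs_def] by measurable
  have sG: "sqint M G"
    by (rule L2n_mono_AE(1)[OF sDu Gm, of 1]) (auto simp: G_def P'0 P'1 mult_left_le_one_le)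
  \<comment> \<open>The error splits in two: in \<open>E\<close> the gradients converge and carry
    the bounded factor \<open>P' (\<phi> n x)\<close>; in \<open>H\<close> the fixed field
    \<open>Du\<close> carries a factor tending to 0, so that dominated convergence applies.\<close>
  have G_lim: "(\<lambda>n. L2dist M (grad (\<psi> n)) G) \<longlonglongrightarrow> 0"
  proof -
    define E where "E n x = P' (\<phi> n x) *\<^sub>R (grad (\<phi> n) x - Du x)" for n x
    define H where "H n x = (P' (\<phi> n x) - P' (u x)) *\<^sub>R Du x" for n x
    have Em: "E n \<in> borel_measurable M" for n unfolding E_def[abs_def] by measurable
    have Hm: "H n \<in> borel_measurable M" for n unfolding H_def[abs_def] by measurable
    have sE: "sqint M (E n)" "L2n M (E n) \<le> 1 * L2dist M (grad (\<phi> n)) Du" for n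
    proof -
      have "AE x in M. norm (E n x) \<le> 1 * norm (grad (\<phi> n) x - Du x)"
        by (rule AE_I2) (simp add: E_def P'0 P'1 mult_left_le_one_le)
      from L2n_mono_AE[OF sqint_diff[OF grad_sqint[OF \<phi>] sDu] Em this zero_le_one]
      show "sqint M (E n)" "L2n M (E n) \<le> 1 * L2dist M (grad (\<phi> n)) Du" by blast+
    qed
    have dP: "\<bar>P' s - P' t\<bar> \<le> 1" for s t
      using P'0[of s] P'1[of s] P'0[of t] P'1[of t] by linarith
    have sH: "sqint M (H n)" for n
      by (rule L2n_mono_AE(1)[OF sDu Hm, of n 1]) (auto simp: H_def dP mult_left_le_one_le)
    have "(\<lambda>n. \<integral>x. (norm (H n x))\<^sup>2 \<partial>M) \<longlonglongrightarrow> (\<integral>x. 0 \<partial>M)"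
    proof (rule integral_dominated_convergence[where w = "\<lambda>x. (norm (Du x))\<^sup>2"])
      show "integrable M (\<lambda>x. (norm (Du x))\<^sup>2)" by (rule sqint_integrable[OF sDu])
      show "(\<lambda>x. (norm (H n x))\<^sup>2) \<in> borel_measurable M" for n using Hm[of n] by measurable
      show "AE x in M. (\<lambda>n. (norm (H n x))\<^sup>2) \<longlonglongrightarrow> 0"
        using ae
      proof eventually_elim
        case (elim x)
        have "(\<lambda>n. (norm ((P' (\<phi> n x) - P' (u x)) *\<^sub>R Du x))\<^sup>2) \<longlonglongrightarrow> (norm ((P' (u x) - P' (u x)) *\<^sub>R Du x))\<^sup>2"
          by (intro tendsto_intros isCont_tendsto_compose[OF isContP' elim])
        then show ?case by (simp add: H_def)
      qed
      show "AE x in M. norm ((norm (H n x))\<^sup>2) \<le> (norm (Du x))\<^sup>2" for n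
      proof (rule AE_I2)
        fix x
        have "norm (H n x) \<le> norm (Du x)"
          using dP by (simp add: H_def mult_left_le_one_le)
        then show "norm ((norm (H n x))\<^sup>2) \<le> (norm (Du x))\<^sup>2" by (simp add: power_mono)
      qed
    qed simp
    then have H0lim: "(\<lambda>n. L2n M (H n)) \<longlonglongrightarrow> 0"
      by (simp add: L2n_tendsto_iff)
    have "L2dist M (grad (\<psi> n)) G \<le> L2dist M (grad (\<phi> n)) Du + L2n M (H n)" for n
    proof -
      have "(\<lambda>x. grad (\<psi> n) x - G x) = (\<lambda>x. E n x + H n x)"
        by (simp add: fun_eq_iff grad\<psi> G_def E_def H_def algebra_simps)
      then show ?thesis using L2n_triangle[OF sE(1) sH, of n n] sE(2)[of n] by simp
    qed
    then have "norm (L2dist M (grad (\<psi> n)) G) \<le> L2dist M (grad (\<phi> n)) Du + L2n M (H n)" for n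
      by simp
    moreover have "(\<lambda>n. L2dist M (grad (\<phi> n)) Du + L2n M (H n)) \<longlonglongrightarrow> 0"
      using tendsto_add[OF grad_lim H0lim] by simp
    ultimately show ?thesis by (rule tendsto_zero_bound)
  qed
  \<comment> \<open>One limit statement for the drift, the zero order term and the right side:
    \<open>g\<close> is merely integrable, and the bound \<open>K\<close> on \<open>P\<close>
    provides the majorant.\<close>
  have dct: "(\<lambda>n. \<integral>x. g x * \<psi> n x \<partial>M) \<longlonglongrightarrow> (\<integral>x. g x * P (u x) \<partial>M)"
    if g: "integrable M g" for g
  proof -
    have [measurable]: "g \<in> borel_measurable M" using g by simp
    have w: "integrable M (\<lambda>x. K * \<bar>g x\<bar>)" using g by simp
    have le: "norm (a * P s) \<le> K * \<bar>a\<bar>" for a s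
      using mult_right_mono[OF bound[of s], of "\<bar>a\<bar>"] by (simp add: abs_mult mult.commute)
    show "(\<lambda>n. \<integral>x. g x * \<psi> n x \<partial>M) \<longlonglongrightarrow> (\<integral>x. g x * P (u x) \<partial>M)"
    proof (rule integral_dominated_convergence[OF _ _ w])
      show "AE x in M. (\<lambda>n. g x * \<psi> n x) \<longlonglongrightarrow> g x * P (u x)"
        using \<psi>_lim by eventually_elim (intro tendsto_intros)
      show "AE x in M. norm (g x * \<psi> n x) \<le> K * \<bar>g x\<bar>" for n
        by (rule AE_I2) (simp only: \<psi>_def le)
    qed measurable
  qed
  have intBD: "integrable M (\<lambda>x. B x \<bullet> Du x)" by (rule sqint_inner[OF B_sqint sDu])
  have sADu: "sqint M (\<lambda>x. A x *v Du x)" by (rule A_sqint[OF sDu])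
  have t1: "(\<lambda>n. \<integral>x. (A x *v Du x) \<bullet> grad (\<psi> n) x \<partial>M) \<longlonglongrightarrow> (\<integral>x. (A x *v Du x) \<bullet> G x \<partial>M)"
    using L2_inner_tendsto[OF grad_sqint[OF \<psi>] sG sADu G_lim] by (simp add: inner_commute)
  note t2 = dct[OF intBD] and t3 = dct[OF c_u_integrable[OF u]] and t4 = dct[OF Lp_dual_integrable[OF f]]
  have "(\<lambda>n. \<integral>x. f x * \<psi> n x \<partial>M) \<longlonglongrightarrow>
      (\<integral>x. (A x *v Du x) \<bullet> G x \<partial>M) + (\<integral>x. (B x \<bullet> Du x) * P (u x) \<partial>M) + (\<integral>x. (c x * u x) * P (u x) \<partial>M)"
  proof -
    have "(\<integral>x. f x * \<psi> n x \<partial>M) = (\<integral>x. (A x *v Du x) \<bullet> grad (\<psi> n) x \<partial>M)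
        + (\<integral>x. (B x \<bullet> Du x) * \<psi> n x \<partial>M) + (\<integral>x. (c x * u x) * \<psi> n x \<partial>M)" for n
      using weak \<psi>[of n] unfolding weak_sol_def by simp
    then show ?thesis using tendsto_add[OF tendsto_add[OF t1 t2] t3] by simp
  qed
  from LIMSEQ_unique[OF this t4] have eq: "(\<integral>x. (A x *v Du x) \<bullet> G x \<partial>M) + (\<integral>x. (B x \<bullet> Du x) * P (u x) \<partial>M)
      + (\<integral>x. (c x * u x) * P (u x) \<partial>M) = (\<integral>x. f x * P (u x) \<partial>M)" .
  have mono: "P s \<le> P t" if "s \<le> t" for s t
    by (rule DERIV_nonneg_imp_nondecreasing[OF that]) (use der P'0 in blast)
  have sP: "0 \<le> s * P s" for s
    using mono[of 0 s] mono[of s 0] P0 by (cases "s \<ge> 0") (auto intro: mult_nonpos_nonpos)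
  have c0: "0 \<le> (\<integral>x. (c x * u x) * P (u x) \<partial>M)"
  proof (rule integral_nonneg_AE)
    show "AE x in M. 0 \<le> (c x * u x) * P (u x)"
      using c_nonneg
    proof eventually_elim
      case (elim x)
      then show ?case using mult_nonneg_nonneg[OF elim sP[of "u x"]] by (simp add: mult.assoc)
    qed
  qed
  \<comment> \<open>The sign condition concerns classical gradients of test functions only, and
    there \<open>P (\<phi> n x)\<close> times \<open>grad (\<phi> n) x\<close> is the gradient of
    \<open>S (\<phi> n x)\<close>. The difference between \<open>grad (\<phi> n)\<close> and
    \<open>Du\<close> is paired with \<open>BP n\<close>, whose \<open>L^2\<close> norm is bounded
    uniformly in \<open>n\<close>.\<close>
  have B0: "0 \<le> (\<integral>x. (B x \<bullet> Du x) * P (u x) \<partial>M)"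
  proof -
    define BP where "BP n x = \<psi> n x *\<^sub>R B x" for n x
    have BPm: "BP n \<in> borel_measurable M" for n unfolding BP_def[abs_def] by measurable
    have sBP: "sqint M (BP n)" "L2n M (BP n) \<le> K * L2n M B" for n
    proof -
      have "AE x in M. norm (BP n x) \<le> K * norm (B x)"
        by (rule AE_I2) (simp add: BP_def \<psi>_def bound mult_right_mono)
      from L2n_mono_AE[OF B_sqint BPm this K]
      show "sqint M (BP n)" "L2n M (BP n) \<le> K * L2n M B" by blast+
    qed
    have test_S: "test_fun U (\<lambda>x. S (\<phi> n x))" for n
      by (rule test_compose[OF \<phi> smooth_real_antiderivative[OF smP S(1)] S(2)])
    have nonneg: "0 \<le> (\<integral>x. BP n x \<bullet> grad (\<phi> n) x \<partial>M)" for n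
    proof -
      have "0 \<le> (\<integral>x. B x \<bullet> grad (\<lambda>x. S (\<phi> n x)) x \<partial>M)"
        by (rule B_nonneg[OF test_S]) (rule S(3))
      also have "\<dots> = (\<integral>x. BP n x \<bullet> grad (\<phi> n) x \<partial>M)"
        by (simp add: grad_compose[OF \<phi> S(1)] BP_def \<psi>_def)
      finally show ?thesis .
    qed
    have diff: "norm (\<integral>x. BP n x \<bullet> (grad (\<phi> n) x - Du x) \<partial>M) \<le> (K * L2n M B) * L2dist M (grad (\<phi> n)) Du" for n
    proof -
      have "norm (\<integral>x. BP n x \<bullet> (grad (\<phi> n) x - Du x) \<partial>M) \<le> L2n M (BP n) * L2dist M (grad (\<phi> n)) Du"
        using L2n_inner_le[OF sBP(1) sqint_diff[OF grad_sqint[OF \<phi>] sDu], of n n] by simp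
      also have "\<dots> \<le> (K * L2n M B) * L2dist M (grad (\<phi> n)) Du"
        by (intro mult_right_mono sBP) simp
      finally show ?thesis .
    qed
    have z: "(\<lambda>n. \<integral>x. BP n x \<bullet> (grad (\<phi> n) x - Du x) \<partial>M) \<longlonglongrightarrow> 0"
      by (rule tendsto_zero_bound[OF diff tendsto_mult_right_zero[OF grad_lim]])
    have "(\<integral>x. BP n x \<bullet> grad (\<phi> n) x \<partial>M) = (\<integral>x. BP n x \<bullet> (grad (\<phi> n) x - Du x) \<partial>M) + (\<integral>x. (B x \<bullet> Du x) * \<psi> n x \<partial>M)" for n
    proof -
      have "(\<integral>x. (B x \<bullet> Du x) * \<psi> n x \<partial>M) = (\<integral>x. BP n x \<bullet> Du x \<partial>M)"
        by (simp add: BP_def mult.commute)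
      then show ?thesis
        using sqint_inner[OF sBP(1) grad_sqint[OF \<phi>], of n n] sqint_inner[OF sBP(1) sDu, of n]
        by (simp add: inner_diff_right)
    qed
    then have "(\<lambda>n. \<integral>x. BP n x \<bullet> grad (\<phi> n) x \<partial>M) \<longlonglongrightarrow> (\<integral>x. (B x \<bullet> Du x) * P (u x) \<partial>M)"
      using tendsto_add[OF z t2] by simp
    then show ?thesis by (rule LIMSEQ_le_const) (use nonneg in blast)
  qed
  have energy: "lam * (L2n M G)\<^sup>2 \<le> (\<integral>x. f x * P (u x) \<partial>M)"
  proof -
    have "lam * (L2n M G)\<^sup>2 = (\<integral>x. lam * (norm (G x))\<^sup>2 \<partial>M)" by (simp add: L2n_square)
    also have "\<dots> \<le> (\<integral>x. (A x *v Du x) \<bullet> G x \<partial>M)"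
    proof (rule integral_mono_AE)
      show "integrable M (\<lambda>x. lam * (norm (G x))\<^sup>2)" using sqint_integrable[OF sG] by simp
      show "integrable M (\<lambda>x. (A x *v Du x) \<bullet> G x)" by (rule sqint_inner[OF sADu sG])
      show "AE x in M. lam * (norm (G x))\<^sup>2 \<le> (A x *v Du x) \<bullet> G x"
        using A_elliptic
      proof eventually_elim
        case (elim x)
        \<comment> \<open>Here \<open>0 \<le> P' \<le> 1\<close> enters: the quadratic form of
          \<open>A\<close> at \<open>Du\<close>, weighted by \<open>P'\<close>, dominates its lower
          bound for the full gradient \<open>G\<close> of \<open>P u\<close>.\<close>
        have "(P' (u x))\<^sup>2 \<le> P' (u x)"
          using P'0[of "u x"] P'1[of "u x"] by (simp add: power2_eq_square mult_left_le_one_le)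
        then have "lam * (norm (G x))\<^sup>2 \<le> P' (u x) * (lam * (norm (Du x))\<^sup>2)"
          using lam_pos by (simp add: G_def power_mult_distrib mult.left_commute mult_right_mono)
        also have "\<dots> \<le> P' (u x) * ((A x *v Du x) \<bullet> Du x)"
          using elim P'0 by (intro mult_left_mono) auto
        finally show ?case by (simp add: G_def)
      qed
    qed
    also have "\<dots> \<le> (\<integral>x. f x * P (u x) \<partial>M)" using eq B0 c0 by linarith
    finally show ?thesis .
  qed
  have "(\<lambda>x. P (u x)) \<in> borel_measurable M" by measurable
  then have "sob_norm (\<lambda>x. P (u x)) \<le> C_sob * L2n M G"
    by (rule sobolev_limit(2)[OF \<psi> _ \<psi>_lim L2n_tendsto[OF grad_sqint[OF \<psi>] sG G_lim]])
  then have "(sob_norm (\<lambda>x. P (u x)))\<^sup>2 \<le> (C_sob * L2n M G)\<^sup>2"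
    by (intro power_mono) auto
  also have "\<dots> = C_sob\<^sup>2 / lam * (lam * (L2n M G)\<^sup>2)"
    using lam_pos by (simp add: power_mult_distrib)
  also have "\<dots> \<le> C_sob\<^sup>2 / lam * (\<integral>x. f x * P (u x) \<partial>M)"
    using lam_pos by (intro mult_left_mono energy) simp
  finally show ?thesis .
qed

end

section \<open>Uniqueness and boundedness\<close>

text \<open>Along the levels \<open>k n = D * (1 - (1/2) ^ n)\<close> the hypothesis gives
  \<open>a (k n) \<le> m * r ^ n\<close>. The ratio satisfies
  \<open>r powr (\<alpha> - \<sigma>) = 1/2\<close>, which absorbs the halving of the gaps, and
  \<open>D\<close> is chosen such that the recursion is an equality for \<open>m * r ^ n\<close>;
  this is \<open>key\<close>. Convergence rests on \<alpha> > \<sigma>, which makes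
  \<open>r < 1\<close>.\<close>

lemma stampacchia_iteration:
  fixes a :: "real \<Rightarrow> real"
  assumes nonneg: "\<And>k. 0 \<le> a k" and anti: "\<And>k h. k \<le> h \<Longrightarrow> a h \<le> a k"
    and \<sigma>: "0 < \<sigma>" "\<sigma> < \<alpha>" and K: "K > 0" and m: "m > 0" "a 0 \<le> m"
    and level: "\<And>k h. 0 \<le> k \<Longrightarrow> k < h \<Longrightarrow> (h - k) * a h powr \<sigma> \<le> K * a k powr \<alpha>"
  shows "a (K * (m powr (\<alpha> - \<sigma>) * 2 powr (\<alpha> / (\<alpha> - \<sigma>)))) = 0"
proof -
  define \<delta> where "\<delta> = \<alpha> - \<sigma>"
  define r where "r = 2 powr (- 1 / \<delta>)"
  define D where "D = K * (m powr \<delta> * 2 powr (\<alpha> / \<delta>))"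
  have \<delta>: "\<delta> > 0" using \<sigma> by (simp add: \<delta>_def)
  have D: "D > 0" using K m by (simp add: D_def)
  have r0: "r > 0" by (simp add: r_def)
  have r1: "r < 1" unfolding r_def using \<delta> powr_less_mono[of "- 1 / \<delta>" 0 2] by simp
  define k where "k n = D * (1 - (1/2) ^ n)" for n :: nat
  have k0: "0 \<le> k n" for n
    using D by (simp add: k_def power_le_one)
  have kD: "k n \<le> D" for n using D by (simp add: k_def)
  have kS: "k (Suc n) - k n = D * (1/2) ^ Suc n" for n
    by (simp add: k_def algebra_simps)
  have key: "D * (1/2) ^ Suc n * (m * r ^ Suc n) powr \<sigma> = K * (m * r ^ n) powr \<alpha>" for n
  proof -
    have rp: "r ^ j = 2 powr (- real j / \<delta>)" for j
      by (simp add: r_def powr_realpow[symmetric] powr_powr)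
    have hp: "(1/2::real) ^ j = 2 powr (- real j)" for j
      by (simp add: powr_minus powr_realpow power_one_over inverse_eq_divide)
    have "D * (1/2) ^ Suc n * (m * r ^ Suc n) powr \<sigma>
        = K * (m powr \<delta> * m powr \<sigma>) * (2 powr (\<alpha> / \<delta>) * 2 powr (- real (Suc n)) * 2 powr (- real (Suc n) / \<delta> * \<sigma>))"
      unfolding rp hp D_def using m by (simp add: powr_mult powr_powr mult_ac)
    also have "m powr \<delta> * m powr \<sigma> = m powr \<alpha>"
      by (simp add: powr_add[symmetric] \<delta>_def)
    also have "2 powr (\<alpha> / \<delta>) * 2 powr (- real (Suc n)) * 2 powr (- real (Suc n) / \<delta> * \<sigma>)
        = (2::real) powr (\<alpha> / \<delta> + (- real (Suc n)) + (- real (Suc n) / \<delta> * \<sigma>))"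
      by (simp only: powr_add)
    also have "\<alpha> / \<delta> + (- real (Suc n)) + (- real (Suc n) / \<delta> * \<sigma>) = - real n / \<delta> * \<alpha>"
    proof -
      have \<alpha>: "\<alpha> = \<delta> + \<sigma>" by (simp add: \<delta>_def)
      show ?thesis unfolding \<alpha> using \<delta> by (simp add: field_simps)
    qed
    also have "K * m powr \<alpha> * 2 powr (- real n / \<delta> * \<alpha>) = K * (m * r ^ n) powr \<alpha>"
      unfolding rp using m by (simp add: powr_mult powr_powr)
    finally show ?thesis .
  qed
  have bound: "a (k n) \<le> m * r ^ n" for n
  proof (induction n)
    case 0
    then show ?case using m by (simp add: k_def)
  next
    case (Suc n)
    have lt: "k n < k (Suc n)"
    proof -
      have "0 < D * (1/2) ^ Suc n" using D by simp
      then show ?thesis using kS[of n] by linarith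
    qed
    have "D * (1/2) ^ Suc n * a (k (Suc n)) powr \<sigma> \<le> K * a (k n) powr \<alpha>"
      using level[OF k0 lt] by (simp only: kS)
    also have "\<dots> \<le> K * (m * r ^ n) powr \<alpha>"
      using Suc nonneg K \<sigma> by (intro mult_left_mono powr_mono2) auto
    also have "\<dots> = D * (1/2) ^ Suc n * (m * r ^ Suc n) powr \<sigma>"
      by (simp only: key)
    finally have le: "a (k (Suc n)) powr \<sigma> \<le> (m * r ^ Suc n) powr \<sigma>"
      by (rule mult_left_le_imp_le) (use D in simp)
    show ?case
    proof (rule ccontr)
      assume "\<not> ?case"
      then have "(m * r ^ Suc n) powr \<sigma> < a (k (Suc n)) powr \<sigma>"
        using \<sigma>(1) m r0 by (intro powr_less_mono2) auto
      with le show False by simp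
    qed
  qed
  have "(\<lambda>n. m * r ^ n) \<longlonglongrightarrow> m * 0"
    using r0 r1 by (intro tendsto_intros LIMSEQ_realpow_zero) auto
  moreover have "a D \<le> m * r ^ n" for n
    using anti[OF kD[of n]] bound[of n] by linarith
  ultimately have "a D \<le> m * 0" using LIMSEQ_le_const by blast
  then show ?thesis using nonneg[of D] by (simp add: D_def \<delta>_def)
qed

section \<open>Localised norms, superlevel sets and change of sign\<close>

context bounded_domain
begin

text \<open>Hoelder against the indicator, for \<open>\<bar>f\<bar> powr dual\<close> with exponent
  \<open>q / dual\<close>: the surplus integrability of \<open>f\<close> is converted into a power
  of the measure of \<open>S\<close>.\<close>

lemma Lp_localized:
  assumes q: "q > dual" and f: "Lp U q f" and S: "S \<in> sets M"
  shows "Lp U dual (\<lambda>x. f x * indicator S x)"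
    and "Lp_norm U dual (\<lambda>x. f x * indicator S x) \<le> Lp_norm U q f * measure M S powr (1 / dual - 1 / q)"
proof -
  note [measurable] = S
  have [measurable]: "f \<in> borel_measurable M" using f by (simp add: Lp_def)
  define \<rho> where "\<rho> = q / dual"
  define \<rho>' where "\<rho>' = q / (q - dual)"
  have q0: "q > 0" using q dual_gt_1 by simp
  have \<rho>: "\<rho> > 1" "\<rho>' > 1" "1 / \<rho> + 1 / \<rho>' = 1"
    using q dual_gt_1 by (auto simp: \<rho>_def \<rho>'_def field_simps)
  have pw: "\<bar>\<bar>f x\<bar> powr dual\<bar> powr \<rho> = \<bar>f x\<bar> powr q" for x
    using dual_gt_1 by (simp add: powr_powr \<rho>_def)
  have ind: "\<bar>indicator S x :: real\<bar> powr \<rho>' = indicator S x" for x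
    by (simp add: indicator_def)
  have intf: "integrable M (\<lambda>x. \<bar>\<bar>f x\<bar> powr dual\<bar> powr \<rho>)"
    unfolding pw using f by (simp add: Lp_def)
  have intS: "integrable M (\<lambda>x. \<bar>indicator S x :: real\<bar> powr \<rho>')"
    unfolding ind using S by (simp add: emeasure_finite less_top[symmetric])
  have eq: "\<bar>f x * indicator S x\<bar> powr dual = \<bar>f x\<bar> powr dual * indicator S x" for x
    by (simp add: indicator_def)
  note H = Holder_inequality[OF \<rho> _ _ intf intS]
  have int: "integrable M (\<lambda>x. \<bar>f x\<bar> powr dual * indicator S x)"
    by (rule H) measurable
  then show "Lp U dual (\<lambda>x. f x * indicator S x)"
    by (simp add: Lp_def eq)
  have "(\<integral>x. \<bar>f x\<bar> powr dual * indicator S x \<partial>M) = (\<integral>x. \<bar>\<bar>f x\<bar> powr dual * indicator S x\<bar> \<partial>M)"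
    by simp
  also have "\<dots> \<le> (\<integral>x. \<bar>f x\<bar> powr q \<partial>M) powr (1 / \<rho>) * (\<integral>x. indicator S x \<partial>M) powr (1 / \<rho>')"
    using H(2) unfolding pw ind by simp
  also have "(\<integral>x. indicator S x \<partial>M) = measure M S"
    using S sets.sets_into_space[OF S] by (simp add: Int_absorb2)
  finally have le: "(\<integral>x. \<bar>f x\<bar> powr dual * indicator S x \<partial>M) \<le> (\<integral>x. \<bar>f x\<bar> powr q \<partial>M) powr (1 / \<rho>) * measure M S powr (1 / \<rho>')" .
  have "Lp_norm U dual (\<lambda>x. f x * indicator S x) = (\<integral>x. \<bar>f x\<bar> powr dual * indicator S x \<partial>M) powr (1 / dual)"
    by (simp add: Lp_norm_def eq)
  also have "\<dots> \<le> ((\<integral>x. \<bar>f x\<bar> powr q \<partial>M) powr (1 / \<rho>) * measure M S powr (1 / \<rho>')) powr (1 / dual)"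
    using dual_gt_1 by (intro powr_mono2 le) auto
  also have "\<dots> = (\<integral>x. \<bar>f x\<bar> powr q \<partial>M) powr (1 / \<rho> * (1 / dual)) * measure M S powr (1 / \<rho>' * (1 / dual))"
    by (simp add: powr_mult powr_powr)
  also have "1 / \<rho> * (1 / dual) = 1 / q"
    using dual_gt_1 by (simp add: \<rho>_def)
  also have "1 / \<rho>' * (1 / dual) = 1 / dual - 1 / q"
    using dual_gt_1 q q0 by (simp add: \<rho>'_def field_simps)
  finally show "Lp_norm U dual (\<lambda>x. f x * indicator S x) \<le> Lp_norm U q f * measure M S powr (1 / dual - 1 / q)"
    by (simp add: Lp_norm_def)
qed

lemma Lp_dual_of_Lp:
  assumes "q > dual" "Lp U q f"
  shows "Lp U dual f"
proof -
  have "Lp U dual (\<lambda>x. f x * indicator U x)"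
    by (rule Lp_localized(1)[OF assms]) simp
  moreover have "integrable M (\<lambda>x. \<bar>f x * indicator U x\<bar> powr dual) = integrable M (\<lambda>x. \<bar>f x\<bar> powr dual)"
    by (rule Bochner_Integration.integrable_cong) auto
  ultimately show ?thesis using assms(2) by (simp add: Lp_def)
qed

lemma superlevel_set_sets:
  fixes u :: "real^'n \<Rightarrow> real"
  assumes [measurable]: "u \<in> borel_measurable M"
  shows "{x \<in> U. u x > t} \<in> sets M"
proof -
  have "{x \<in> space M. u x > t} \<in> sets M" by measurable
  then show ?thesis by simp
qed

lemma H0_minus:
  assumes "H0 U u Du"
  shows "H0 U (\<lambda>x. - u x) (\<lambda>x. - Du x)"
proof -
  obtain \<phi> where \<phi>: "\<And>n. test_fun U (\<phi> n)" "(\<lambda>n. L2dist M (\<phi> n) u) \<longlonglongrightarrow> 0"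
    "(\<lambda>n. L2dist M (grad (\<phi> n)) Du) \<longlonglongrightarrow> 0" and s: "sqint M u" "sqint M Du"
    using assms unfolding H0_iff by blast
  have eq: "L2n M (\<lambda>x. - 1 * \<phi> n x - - u x) = L2dist M (\<phi> n) u"
    "L2n M (\<lambda>x. grad (\<lambda>x. - 1 * \<phi> n x) x - - Du x) = L2dist M (grad (\<phi> n)) Du" for n
    unfolding grad_cmult[OF \<phi>(1)]
    using L2n_minus_commute[of M u "\<phi> n"] L2n_minus_commute[of M Du "grad (\<phi> n)"] by simp_all
  have sm: "sqint M (\<lambda>x. - u x)" "sqint M (\<lambda>x. - Du x)"
    using sqint_scaleR[OF s(1), of "-1"] sqint_scaleR[OF s(2), of "-1"] by simp_all
  show ?thesis
    unfolding H0_iff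
    by (intro conjI sm exI[of _ "\<lambda>n x. - 1 * \<phi> n x"] allI test_cmult \<phi>(1)) (simp_all only: eq \<phi>)
qed

end

section \<open>Truncations of weak solutions\<close>

context elliptic
begin

text \<open>Limit of the energy estimate over the bounded smooth truncations. These vanish at 0 and
  have Lipschitz constant 1, so \<open>\<bar>u\<bar>\<close> dominates all of them, and
  \<open>\<bar>u\<bar> powr sob\<close> and \<open>\<bar>f u\<bar>\<close> are majorants for the two
  sides.\<close>

lemma truncation_estimate:
  assumes u: "H0 U u Du" and weak: "weak_sol U A B c u Du f" and f: "Lp U dual f" and k: "k \<ge> 0"
  shows "sob_int (\<lambda>x. max 0 (u x - k))"
    and "(sob_norm (\<lambda>x. max 0 (u x - k)))\<^sup>2
      \<le> C_sob\<^sup>2 / lam * (\<integral>x. f x * max 0 (u x - k) \<partial>M)"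
proof -
  have um [measurable]: "u \<in> borel_measurable M" using u sqint_measurable by (auto simp: H0_iff)
  have fm [measurable]: "f \<in> borel_measurable M" using f by (simp add: Lp_def)
  have sob: "sob > 0" using sob_gt_2 by simp
  have intu: "sob_int u" by (rule sobolev_H0(1)[OF u])
  have P_le: "\<bar>soft_trunc k n s\<bar> \<le> \<bar>s\<bar>" for n s
  proof -
    obtain P' where P': "\<And>s. (soft_trunc k n has_real_derivative P' s) (at s)" "\<And>s. 0 \<le> P' s" "\<And>s. P' s \<le> 1"
      "soft_trunc k n 0 = 0" using soft_trunc_props[of k n] by metis
    show ?thesis
      using DERIV_01_lipschitz[OF P'(1-3), of 0 s] DERIV_01_lipschitz[OF P'(1-3), of s 0] P'(4)
      by (cases "s \<ge> 0") auto
  qed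
  have Pm [measurable]: "soft_trunc k n \<in> borel_measurable borel" for n
  proof -
    obtain P' where "\<And>s. (soft_trunc k n has_real_derivative P' s) (at s)" using soft_trunc_props[of k n] by metis
    then have "continuous_on UNIV (soft_trunc k n)" by (meson DERIV_isCont continuous_at_imp_continuous_on)
    then show ?thesis by (rule borel_measurable_continuous_onI)
  qed
  have est: "(sob_norm (\<lambda>x. soft_trunc k n (u x)))\<^sup>2
      \<le> C_sob\<^sup>2 / lam * (\<integral>x. f x * soft_trunc k n (u x) \<partial>M)" for n
    by (rule soft_trunc_props[of k n], rule energy_estimate[OF u weak f])
  have lim: "(\<lambda>n. soft_trunc k n (u x)) \<longlonglongrightarrow> max 0 (u x - k)" for x by (rule soft_trunc_lim[OF k])
  have pw: "(\<lambda>n. \<bar>soft_trunc k n (u x)\<bar> powr sob) \<longlonglongrightarrow> \<bar>max 0 (u x - k)\<bar> powr sob" for x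
    using sob by (intro tendsto_powr' tendsto_rabs lim tendsto_const) auto
  have pb: "\<bar>soft_trunc k n (u x)\<bar> powr sob \<le> \<bar>u x\<bar> powr sob" for n x
    using sob P_le by (intro powr_mono2) auto
  have l1: "(\<lambda>n. \<integral>x. \<bar>soft_trunc k n (u x)\<bar> powr sob \<partial>M) \<longlonglongrightarrow> (\<integral>x. \<bar>max 0 (u x - k)\<bar> powr sob \<partial>M)"
  proof (rule integral_dominated_convergence[OF _ _ intu])
    show "AE x in M. (\<lambda>n. \<bar>soft_trunc k n (u x)\<bar> powr sob) \<longlonglongrightarrow> \<bar>max 0 (u x - k)\<bar> powr sob"
      by (intro AE_I2 pw)
    show "AE x in M. norm (\<bar>soft_trunc k n (u x)\<bar> powr sob) \<le> \<bar>u x\<bar> powr sob" for n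
      by (rule AE_I2) (simp add: pb)
  qed measurable
  show "sob_int (\<lambda>x. max 0 (u x - k))"
  proof (rule Bochner_Integration.integrable_bound[OF intu])
    have "\<bar>max 0 (s - k)\<bar> powr sob \<le> \<bar>s\<bar> powr sob" for s
      using k sob by (intro powr_mono2) auto
    then show "AE x in M. norm (\<bar>max 0 (u x - k)\<bar> powr sob) \<le> norm (\<bar>u x\<bar> powr sob)"
      by (intro AE_I2) simp
  qed measurable
  have intfu: "integrable M (\<lambda>x. \<bar>f x * u x\<bar>)"
    using dual_pairing(1)[OF f um intu] by simp
  have l2: "(\<lambda>n. \<integral>x. f x * soft_trunc k n (u x) \<partial>M) \<longlonglongrightarrow> (\<integral>x. f x * max 0 (u x - k) \<partial>M)"
  proof (rule integral_dominated_convergence[OF _ _ intfu])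
    show "AE x in M. (\<lambda>n. f x * soft_trunc k n (u x)) \<longlonglongrightarrow> f x * max 0 (u x - k)"
      by (intro AE_I2 tendsto_mult tendsto_const lim)
    show "AE x in M. norm (f x * soft_trunc k n (u x)) \<le> \<bar>f x * u x\<bar>" for n
      by (rule AE_I2) (simp add: abs_mult mult_left_mono P_le)
  qed measurable
  have "(\<lambda>n. (sob_norm (\<lambda>x. soft_trunc k n (u x)))\<^sup>2)
      \<longlonglongrightarrow> (sob_norm (\<lambda>x. max 0 (u x - k)))\<^sup>2"
    using sob by (intro tendsto_power tendsto_powr' l1 tendsto_const) auto
  from LIMSEQ_le[OF this tendsto_mult[OF tendsto_const l2]] est
  show "(sob_norm (\<lambda>x. max 0 (u x - k)))\<^sup>2
      \<le> C_sob\<^sup>2 / lam * (\<integral>x. f x * max 0 (u x - k) \<partial>M)" by blast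
qed

lemma weak_sol_minus:
  assumes "weak_sol U A B c u Du f"
  shows "weak_sol U A B c (\<lambda>x. - u x) (\<lambda>x. - Du x) (\<lambda>x. - f x)"
proof -
  have mv: "A x *v (- Du x) = - (A x *v Du x)" for x
    using matrix_vector_mult_scaleR[of "A x" "-1" "Du x"] by simp
  show ?thesis
    using assms unfolding weak_sol_def by (simp add: mv) (smt (verit))
qed

lemma weak_sol_zero_nonpos:
  assumes u: "H0 U u Du" and weak: "weak_sol U A B c u Du (\<lambda>x. 0)"
  shows "AE x in M. u x \<le> 0"
proof -
  have f: "Lp U dual (\<lambda>x. 0)" by (simp add: Lp_def)
  note T = truncation_estimate[OF u weak f order_refl]
  have "sob_norm (\<lambda>x. max 0 (u x - 0)) = 0"
    using T(2) by simp
  then have "(\<integral>x. \<bar>max 0 (u x - 0)\<bar> powr sob \<partial>M) = 0" by simp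
  then have "AE x in M. \<bar>max 0 (u x - 0)\<bar> powr sob = 0"
    using integral_nonneg_eq_0_iff_AE[OF T(1)] by simp
  then show ?thesis by eventually_elim (auto simp: max_def split: if_splits)
qed

theorem uniqueness:
  assumes u: "H0 U u Du" and weak: "weak_sol U A B c u Du (\<lambda>x. 0)"
  shows "AE x in M. u x = 0"
proof -
  have "AE x in M. - u x \<le> 0"
    using weak_sol_zero_nonpos[OF H0_minus[OF u]] weak_sol_minus[OF weak] by simp
  with weak_sol_zero_nonpos[OF u weak] show ?thesis by eventually_elim simp
qed

text \<open>The truncation vanishes outside \<open>{u > k}\<close>, so only the restriction of
  \<open>f\<close> to that set counts, and its norm carries a power of the measure. One factor of
  the squared Sobolev norm cancels; Chebyshev's inequality on \<open>{u > h}\<close> bounds the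
  other from below.\<close>

lemma level_set_estimate:
  assumes u: "H0 U u Du" and weak: "weak_sol U A B c u Du f" and q: "q > dual" and f: "Lp U q f"
    and k: "0 \<le> k" "k < h"
  shows "(h - k) * measure M {x \<in> U. u x > h} powr (1 / sob)
    \<le> C_sob\<^sup>2 / lam * Lp_norm U q f * measure M {x \<in> U. u x > k} powr (1 / dual - 1 / q)"
proof -
  have um: "u \<in> borel_measurable M" using u sqint_measurable by (auto simp: H0_iff)
  note meas = superlevel_set_sets[OF um]
  have sob: "sob > 0" using sob_gt_2 by simp
  have fd: "Lp U dual f" by (rule Lp_dual_of_Lp[OF q f])
  note [measurable] = um
  define w where "w x = max 0 (u x - k)" for x
  have wm [measurable]: "w \<in> borel_measurable M" unfolding w_def[abs_def] by measurable
  note T = truncation_estimate[OF u weak fd k(1), folded w_def]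
  define X where "X = sob_norm w"
  define S where "S = {x \<in> U. u x > k}"
  define C where "C = C_sob\<^sup>2 / lam"
  have C: "C \<ge> 0" using lam_pos by (simp add: C_def)
  have "(\<integral>x. f x * w x \<partial>M) = (\<integral>x. (f x * indicator S x) * w x \<partial>M)"
    by (rule Bochner_Integration.integral_cong) (auto simp: S_def w_def indicator_def)
  also have "\<dots> \<le> Lp_norm U dual (\<lambda>x. f x * indicator S x) * X"
    using dual_pairing(2)[OF Lp_localized(1)[OF q f meas[of k]] wm T(1)] unfolding X_def S_def by linarith
  also have "\<dots> \<le> (Lp_norm U q f * measure M S powr (1 / dual - 1 / q)) * X"
    unfolding S_def by (intro mult_right_mono Lp_localized(2)[OF q f meas]) (simp add: X_def)
  finally have fw: "(\<integral>x. f x * w x \<partial>M) \<le> (Lp_norm U q f * measure M S powr (1 / dual - 1 / q)) * X" .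
  have "X\<^sup>2 \<le> C * (\<integral>x. f x * w x \<partial>M)" using T(2) by (simp add: X_def C_def)
  also have "\<dots> \<le> C * ((Lp_norm U q f * measure M S powr (1 / dual - 1 / q)) * X)"
    by (rule mult_left_mono[OF fw C])
  finally have X2: "X * X \<le> (C * Lp_norm U q f * measure M S powr (1 / dual - 1 / q)) * X"
    by (simp add: power2_eq_square mult_ac)
  have X: "X \<le> C * Lp_norm U q f * measure M S powr (1 / dual - 1 / q)"
  proof (cases "X = 0")
    case True
    then show ?thesis using C by (simp add: Lp_norm_def)
  next
    case False
    then have "X > 0" by (simp add: X_def)
    with X2 show ?thesis by simp
  qed
  have "(h - k) powr sob * measure M {x \<in> U. u x > h} = (\<integral>x. (h - k) powr sob * indicator {x \<in> U. u x > h} x \<partial>M)"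
  proof -
    have "{x \<in> U. u x > h} \<inter> U = {x \<in> U. u x > h}" by auto
    then show ?thesis using meas[of h] by simp
  qed
  also have "\<dots> \<le> (\<integral>x. \<bar>w x\<bar> powr sob \<partial>M)"
  proof (rule integral_mono)
    show "integrable M (\<lambda>x. (h - k) powr sob * indicator {x \<in> U. u x > h} x)"
      using meas[of h] by (simp add: emeasure_finite less_top[symmetric])
    show "(h - k) powr sob * indicator {x \<in> U. u x > h} x \<le> \<bar>w x\<bar> powr sob" for x
      using k sob by (auto simp: indicator_def w_def intro!: powr_mono2)
  qed (rule T(1))
  finally have "((h - k) powr sob * measure M {x \<in> U. u x > h}) powr (1 / sob) \<le> X"
    unfolding X_def using sob by (intro powr_mono2) auto
  moreover have "((h - k) powr sob * measure M {x \<in> U. u x > h}) powr (1 / sob) = (h - k) * measure M {x \<in> U. u x > h} powr (1 / sob)"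
    using k sob by (simp add: powr_mult powr_powr)
  ultimately show ?thesis using X by (simp add: C_def S_def)
qed

text \<open>Stampacchia's lemma for the measures of the superlevel sets, with exponents
  \<open>1 / sob\<close> and \<open>1 / dual - 1 / q\<close>. An upper bound \<open>m\<close>
  replaces the measure itself, so that it stays positive for empty \<open>U\<close>.\<close>

theorem sup_estimate:
  assumes u: "H0 U u Du" and weak: "weak_sol U A B c u Du f" and q: "q > dual" and f: "Lp U q f"
    and \<sigma>: "1 / sob < 1 / dual - 1 / q" and m: "m > 0" "measure lebesgue U \<le> m"
  shows "AE x in M. u x \<le> C_sob\<^sup>2 / lam * (m powr (1 / dual - 1 / q - 1 / sob)
      * 2 powr ((1 / dual - 1 / q) / (1 / dual - 1 / q - 1 / sob))) * Lp_norm U q f"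
proof -
  define T where "T = m powr (1 / dual - 1 / q - 1 / sob) * 2 powr ((1 / dual - 1 / q) / (1 / dual - 1 / q - 1 / sob))"
  define K where "K = C_sob\<^sup>2 / lam * Lp_norm U q f"
  have K: "K \<ge> 0" using lam_pos by (simp add: K_def Lp_norm_def)
  have sob: "1 / sob > 0" using sob_gt_2 by simp
  have um: "u \<in> borel_measurable M" using u sqint_measurable by (auto simp: H0_iff)
  note meas = superlevel_set_sets[OF um]
  \<comment> \<open>The iteration asks for a positive constant, but \<open>K = 0\<close> when
    \<open>f\<close> vanishes. Every \<open>K' > K\<close> is admissible, and taking
    \<open>K + 1 / (n + 1)\<close> recovers \<open>K\<close> in the limit.\<close>
  have zero: "measure M {x \<in> U. u x > K' * T} = 0" if K': "K' > K" for K'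
    unfolding T_def
  proof (rule stampacchia_iteration[OF _ _ sob \<sigma> _ m(1)])
    show "K' > 0" using K K' by simp
    show "measure M {x \<in> U. u x > h} \<le> measure M {x \<in> U. u x > k}" if "k \<le> h" for k h
      using that by (intro finite_measure_mono meas) auto
    have "measure M {x \<in> U. u x > 0} \<le> measure M (space M)" by (intro bounded_measure)
    also have "\<dots> = measure lebesgue U" using U_sets by (simp add: measure_restrict_space)
    finally show "measure M {x \<in> U. u x > 0} \<le> m" using m by simp
    show "(h - k) * measure M {x \<in> U. u x > h} powr (1 / sob) \<le> K' * measure M {x \<in> U. u x > k} powr (1 / dual - 1 / q)"
      if "0 \<le> k" "k < h" for k h
    proof -
      have "(h - k) * measure M {x \<in> U. u x > h} powr (1 / sob) \<le> K * measure M {x \<in> U. u x > k} powr (1 / dual - 1 / q)"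
        using level_set_estimate[OF u weak q f that] by (simp add: K_def)
      also have "\<dots> \<le> K' * measure M {x \<in> U. u x > k} powr (1 / dual - 1 / q)"
        using K' by (intro mult_right_mono) auto
      finally show ?thesis .
    qed
  qed simp
  have "AE x in M. u x \<le> (K + 1 / real (Suc n)) * T" for n
  proof (rule AE_I)
    show "{x \<in> space M. \<not> u x \<le> (K + 1 / real (Suc n)) * T} \<subseteq> {x \<in> U. u x > (K + 1 / real (Suc n)) * T}" by auto
    show "emeasure M {x \<in> U. u x > (K + 1 / real (Suc n)) * T} = 0"
      using zero[of "K + 1 / real (Suc n)"] by (simp add: emeasure_eq_measure)
  qed (rule meas)
  then have "AE x in M. \<forall>n. u x \<le> (K + 1 / real (Suc n)) * T" by (simp add: AE_all_countable)
  then have "AE x in M. u x \<le> K * T"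
  proof eventually_elim
    case (elim x)
    have "(\<lambda>n. (K + 1 / real (Suc n)) * T) \<longlonglongrightarrow> (K + 0) * T"
      by (intro tendsto_intros LIMSEQ_Suc[OF lim_1_over_n])
    from LIMSEQ_le_const[OF this] elim show ?case by auto
  qed
  then show ?thesis by (simp add: K_def T_def mult_ac)
qed

end

section \<open>Existence\<close>

context bounded_domain
begin

text \<open>Sobolev's inequality followed by Hoelder against the constant 1. The constant depends on
  the measure of \<open>U\<close>, which is harmless because it serves the convergence of sequences
  and not the estimates.\<close>

lemma poincare_test: "\<exists>K. \<forall>\<phi>. test_fun U \<phi> \<longrightarrow> L2n M \<phi> \<le> K * L2n M (grad \<phi>)"
proof -
  define \<rho> where "\<rho> = sob / (sob - 2)"
  have \<rho>: "sob / 2 > 1" "\<rho> > 1" "1 / (sob / 2) + 1 / \<rho> = 1"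
    using sob_gt_2 by (auto simp: \<rho>_def field_simps)
  define V where "V = measure M U powr (1 / \<rho>)"
  have "L2n M \<phi> \<le> (sqrt V * C_sob) * L2n M (grad \<phi>)" if \<phi>: "test_fun U \<phi>" for \<phi>
  proof -
    have [measurable]: "\<phi> \<in> borel_measurable M" by (rule test_measurable[OF \<phi>])
    have pw: "\<bar>(\<phi> x)\<^sup>2\<bar> powr (sob / 2) = \<bar>\<phi> x\<bar> powr sob" for x
    proof -
      have "\<bar>(\<phi> x)\<^sup>2\<bar> = \<bar>\<phi> x\<bar> powr 2" by (simp add: powr_numeral)
      then show ?thesis by (simp only: powr_powr) simp
    qed
    have int: "integrable M (\<lambda>x. \<bar>(\<phi> x)\<^sup>2\<bar> powr (sob / 2))"
      unfolding pw by (rule sobolev_test(1)[OF \<phi>])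
    have "(L2n M \<phi>)\<^sup>2 = (\<integral>x. \<bar>(\<phi> x)\<^sup>2 * 1\<bar> \<partial>M)" by (simp add: L2n_square)
    also have "\<dots> \<le> (\<integral>x. \<bar>(\<phi> x)\<^sup>2\<bar> powr (sob / 2) \<partial>M) powr (1 / (sob / 2)) * (\<integral>x. \<bar>1\<bar> powr \<rho> \<partial>M) powr (1 / \<rho>)"
      by (rule Holder_inequality(2)[OF \<rho> _ _ int]) auto
    also have "(\<integral>x. \<bar>1\<bar> powr \<rho> \<partial>M) powr (1 / \<rho>) = V" by (simp add: V_def)
    also have "(\<integral>x. \<bar>(\<phi> x)\<^sup>2\<bar> powr (sob / 2) \<partial>M) powr (1 / (sob / 2)) = (sob_norm \<phi>)\<^sup>2"
      unfolding pw by (simp add: power2_eq_square powr_add[symmetric])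
    also have "\<dots> * V \<le> (C_sob * L2n M (grad \<phi>))\<^sup>2 * V"
      by (intro mult_right_mono power_mono sobolev_test(2)[OF \<phi>]) (auto simp: V_def)
    also have "\<dots> = (sqrt V * C_sob * L2n M (grad \<phi>))\<^sup>2"
      by (simp add: power_mult_distrib V_def)
    finally show ?thesis
      by (rule power2_le_imp_le) (use C_sob_pos in \<open>simp add: V_def\<close>)
  qed
  then show ?thesis by blast
qed

text \<open>The projection theorem controls gradients alone. Poincare's inequality makes the
  functions a Cauchy sequence as well, and their limit has gradient \<open>D\<close> by the
  definition of \<open>H0\<close>.\<close>

lemma H0_complete:
  assumes w: "\<And>n. test_fun U (w n)" and D: "sqint M D"
    and lim: "(\<lambda>n. L2dist M (grad (w n)) D) \<longlonglongrightarrow> 0"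
  shows "\<exists>u. H0 U u D"
proof -
  obtain K where K: "\<And>\<phi>. test_fun U \<phi> \<Longrightarrow> L2n M \<phi> \<le> K * L2n M (grad \<phi>)"
    using poincare_test by blast
  have "\<exists>u. sqint M u \<and> (\<lambda>n. L2dist M (w n) u) \<longlonglongrightarrow> 0"
  proof (rule L2_complete[OF test_sqint[OF w]])
    fix e :: real assume e: "e > 0"
    \<comment> \<open>\<open>K\<close> carries no sign information, hence
      \<open>\<bar>K\<bar> + 1\<close>; each of the two terms of the triangle inequality then
      contributes \<open>e / 2\<close>.\<close>
    define e' where "e' = e / 2 / (\<bar>K\<bar> + 1)"
    have cancel: "r * (s / r) = s" if "r > 0" for r s :: real using that by simp
    have Ke': "(\<bar>K\<bar> + 1) * e' = e / 2" unfolding e'_def by (rule cancel) simp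
    have e': "e' > 0" using e by (simp add: e'_def)
    have "eventually (\<lambda>n. L2dist M (grad (w n)) D < e') sequentially"
      by (rule order_tendstoD(2)[OF lim e'])
    then obtain N where N: "\<And>n. n \<ge> N \<Longrightarrow> L2dist M (grad (w n)) D < e'"
      by (auto simp: eventually_sequentially)
    have "L2dist M (w m) (w n) < e" if mn: "m \<ge> N" "n \<ge> N" for m n
    proof -
      have "L2dist M (w m) (w n) \<le> K * L2dist M (grad (w m)) (grad (w n))"
        using K[OF test_diff[OF w w], of m n] by (simp only: ext[OF grad_diff[OF w w]])
      also have "\<dots> \<le> (\<bar>K\<bar> + 1) * L2dist M (grad (w m)) (grad (w n))"
        by (intro mult_right_mono) auto
      also have "\<dots> < (\<bar>K\<bar> + 1) * (e' + e')"
        using L2n_triangle_diff[OF grad_sqint[OF w] D grad_sqint[OF w], of m n]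
          N[OF mn(1)] N[OF mn(2)] L2n_minus_commute[of M D "grad (w n)"]
        by (intro mult_strict_left_mono) auto
      also have "\<dots> = e" using Ke' by (simp only: distrib_left)
      finally show ?thesis .
    qed
    then show "\<exists>N. \<forall>m\<ge>N. \<forall>n\<ge>N. L2dist M (w m) (w n) < e" by blast
  qed
  then obtain u where "sqint M u" "(\<lambda>n. L2dist M (w n) u) \<longlonglongrightarrow> 0" by blast
  with w D lim show ?thesis unfolding H0_iff by blast
qed

end

section \<open>The bilinear form and the solution\<close>

context elliptic
begin

text \<open>The gradient of the first argument is passed separately because elements of
  \<open>H0\<close> come as pairs; the second argument is a test function with its classical
  gradient.\<close>

definition form :: "(real^'n \<Rightarrow> real) \<Rightarrow> (real^'n \<Rightarrow> real^'n) \<Rightarrow> (real^'n \<Rightarrow> real) \<Rightarrow> real" where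
  "form v Dv \<phi> = (\<integral>x. (A x *v Dv x) \<bullet> grad \<phi> x \<partial>M) + (\<integral>x. (B x \<bullet> Dv x) * \<phi> x \<partial>M)
     + (\<integral>x. c x * v x * \<phi> x \<partial>M)"

lemma weak_sol_iff_form:
  "weak_sol U A B c u Du f \<longleftrightarrow> (\<forall>\<phi>. test_fun U \<phi> \<longrightarrow> form u Du \<phi> = (\<integral>x. f x * \<phi> x \<partial>M))"
  by (simp add: weak_sol_def form_def)

lemma B_test_sqint:
  assumes \<phi>: "test_fun U \<phi>"
  shows "sqint M (\<lambda>x. \<phi> x *\<^sub>R B x)"
proof -
  obtain K where K: "\<And>x. \<bar>\<phi> x\<bar> \<le> K" using test_bounded(1)[OF \<phi>] by blast
  have K0: "K \<ge> 0" using K[of undefined] by linarith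
  note [measurable] = test_measurable[OF \<phi>] sqint_measurable[OF B_sqint]
  have m: "(\<lambda>x. \<phi> x *\<^sub>R B x) \<in> borel_measurable M" by measurable
  have "AE x in M. norm (\<phi> x *\<^sub>R B x) \<le> K * norm (B x)"
    by (rule AE_I2) (simp add: K mult_right_mono)
  from L2n_mono_AE(1)[OF B_sqint m this K0] show ?thesis .
qed

lemma c_test_Lp:
  assumes \<phi>: "test_fun U \<phi>"
  shows "Lp U dual (\<lambda>x. c x * \<phi> x)"
proof -
  obtain K where K: "\<And>x. \<bar>\<phi> x\<bar> \<le> K" using test_bounded(1)[OF \<phi>] by blast
  note [measurable] = test_measurable[OF \<phi>]
  have [measurable]: "c \<in> borel_measurable M" using c_Lp by (simp add: Lp_def)
  have int: "integrable M (\<lambda>x. K powr dual * \<bar>c x\<bar> powr dual)"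
    using c_Lp by (simp add: Lp_def)
  have le: "\<bar>c x * \<phi> x\<bar> powr dual \<le> K powr dual * \<bar>c x\<bar> powr dual" for x
  proof -
    have "\<bar>c x * \<phi> x\<bar> powr dual = \<bar>\<phi> x\<bar> powr dual * \<bar>c x\<bar> powr dual"
      by (simp add: abs_mult powr_mult)
    also have "\<dots> \<le> K powr dual * \<bar>c x\<bar> powr dual"
      using K dual_gt_1 by (intro mult_right_mono powr_mono2) auto
    finally show ?thesis .
  qed
  have "integrable M (\<lambda>x. \<bar>c x * \<phi> x\<bar> powr dual)"
    by (rule Bochner_Integration.integrable_bound[OF int]) (use le in auto)
  then show ?thesis by (simp add: Lp_def)
qed

lemma form_integrable:
  assumes v: "H0 U v Dv" and \<phi>: "test_fun U \<phi>"
  shows "integrable M (\<lambda>x. (A x *v Dv x) \<bullet> grad \<phi> x)" "integrable M (\<lambda>x. (B x \<bullet> Dv x) * \<phi> x)"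
    "integrable M (\<lambda>x. c x * v x * \<phi> x)"
proof -
  have s: "sqint M v" "sqint M Dv" using v by (auto simp: H0_iff)
  show "integrable M (\<lambda>x. (A x *v Dv x) \<bullet> grad \<phi> x)"
    by (rule sqint_inner[OF A_sqint(1)[OF s(2)] grad_sqint[OF \<phi>]])
  show "integrable M (\<lambda>x. (B x \<bullet> Dv x) * \<phi> x)"
    using sqint_inner[OF B_test_sqint[OF \<phi>] s(2)] by (simp add: mult.commute)
  show "integrable M (\<lambda>x. c x * v x * \<phi> x)"
    using dual_pairing(1)[OF c_test_Lp[OF \<phi>] sqint_measurable[OF s(1)] sobolev_H0(1)[OF v]]
    by (simp add: mult_ac)
qed

text \<open>The constant depends on \<phi>, among others through the \<open>L^2\<close> norm of
  \<open>\<phi> B\<close>. Continuity in the first argument for each fixed test function is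
  precisely what the projection theorem asks for.\<close>

lemma form_bounded:
  assumes \<phi>: "test_fun U \<phi>"
  shows "\<exists>K. \<forall>v Dv. H0 U v Dv \<longrightarrow> \<bar>form v Dv \<phi>\<bar> \<le> K * L2n M Dv"
proof -
  define KA where "KA = real CARD('n) * (real CARD('n) * MA)"
  define K where "K = KA * L2n M (grad \<phi>) + L2n M (\<lambda>x. \<phi> x *\<^sub>R B x) + Lp_norm U dual (\<lambda>x. c x * \<phi> x) * C_sob"
  have "\<bar>form v Dv \<phi>\<bar> \<le> K * L2n M Dv" if v: "H0 U v Dv" for v Dv
  proof -
    have s: "sqint M v" "sqint M Dv" using v by (auto simp: H0_iff)
    have "\<bar>\<integral>x. (A x *v Dv x) \<bullet> grad \<phi> x \<partial>M\<bar> \<le> L2n M (\<lambda>x. A x *v Dv x) * L2n M (grad \<phi>)"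
      by (rule L2n_inner_le[OF A_sqint(1)[OF s(2)] grad_sqint[OF \<phi>]])
    also have "\<dots> \<le> (KA * L2n M Dv) * L2n M (grad \<phi>)"
      unfolding KA_def by (intro mult_right_mono A_sqint(2)[OF s(2)]) simp
    finally have 1: "\<bar>\<integral>x. (A x *v Dv x) \<bullet> grad \<phi> x \<partial>M\<bar> \<le> (KA * L2n M Dv) * L2n M (grad \<phi>)" .
    have "\<bar>\<integral>x. (\<phi> x *\<^sub>R B x) \<bullet> Dv x \<partial>M\<bar> \<le> L2n M (\<lambda>x. \<phi> x *\<^sub>R B x) * L2n M Dv"
      by (rule L2n_inner_le[OF B_test_sqint[OF \<phi>] s(2)])
    then have 2: "\<bar>\<integral>x. (B x \<bullet> Dv x) * \<phi> x \<partial>M\<bar> \<le> L2n M (\<lambda>x. \<phi> x *\<^sub>R B x) * L2n M Dv"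
      by (simp add: mult.commute)
    have "\<bar>\<integral>x. (c x * \<phi> x) * v x \<partial>M\<bar> \<le> Lp_norm U dual (\<lambda>x. c x * \<phi> x) * sob_norm v"
      by (rule dual_pairing(2)[OF c_test_Lp[OF \<phi>] sqint_measurable[OF s(1)] sobolev_H0(1)[OF v]])
    also have "\<dots> \<le> Lp_norm U dual (\<lambda>x. c x * \<phi> x) * (C_sob * L2n M Dv)"
      by (intro mult_left_mono sobolev_H0(2)[OF v]) (simp add: Lp_norm_def)
    finally have "\<bar>\<integral>x. (c x * \<phi> x) * v x \<partial>M\<bar> \<le> Lp_norm U dual (\<lambda>x. c x * \<phi> x) * (C_sob * L2n M Dv)" .
    then have 3: "\<bar>\<integral>x. c x * v x * \<phi> x \<partial>M\<bar> \<le> Lp_norm U dual (\<lambda>x. c x * \<phi> x) * (C_sob * L2n M Dv)"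
      by (simp add: mult_ac)
    have "\<bar>form v Dv \<phi>\<bar> \<le> (KA * L2n M Dv) * L2n M (grad \<phi>) + L2n M (\<lambda>x. \<phi> x *\<^sub>R B x) * L2n M Dv
        + Lp_norm U dual (\<lambda>x. c x * \<phi> x) * (C_sob * L2n M Dv)"
      unfolding form_def using 1 2 3 by linarith
    also have "\<dots> = K * L2n M Dv" by (simp add: K_def algebra_simps)
    finally show ?thesis .
  qed
  then show ?thesis by blast
qed

lemma form_lincomb_left:
  assumes v: "H0 U v Dv" and w: "H0 U w Dw" and \<phi>: "test_fun U \<phi>"
  shows "form (\<lambda>x. a * v x + b * w x) (\<lambda>x. a *\<^sub>R Dv x + b *\<^sub>R Dw x) \<phi> = a * form v Dv \<phi> + b * form w Dw \<phi>"
proof -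
  have 1: "(\<lambda>x. (A x *v (a *\<^sub>R Dv x + b *\<^sub>R Dw x)) \<bullet> grad \<phi> x)
      = (\<lambda>x. a * ((A x *v Dv x) \<bullet> grad \<phi> x) + b * ((A x *v Dw x) \<bullet> grad \<phi> x))"
    by (simp add: fun_eq_iff matrix_vector_right_distrib matrix_vector_mult_scaleR inner_add_left)
  have 2: "(\<lambda>x. (B x \<bullet> (a *\<^sub>R Dv x + b *\<^sub>R Dw x)) * \<phi> x) = (\<lambda>x. a * ((B x \<bullet> Dv x) * \<phi> x) + b * ((B x \<bullet> Dw x) * \<phi> x))"
    by (simp add: fun_eq_iff inner_add_right algebra_simps)
  have 3: "(\<lambda>x. c x * (a * v x + b * w x) * \<phi> x) = (\<lambda>x. a * (c x * v x * \<phi> x) + b * (c x * w x * \<phi> x))"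
    by (simp add: fun_eq_iff algebra_simps)
  show ?thesis
    unfolding form_def 1 2 3
    using form_integrable[OF v \<phi>] form_integrable[OF w \<phi>] by (simp add: algebra_simps)
qed

lemma form_lincomb_right:
  assumes v: "H0 U v Dv" and \<phi>: "test_fun U \<phi>" and \<psi>: "test_fun U \<psi>"
  shows "form v Dv (\<lambda>x. a * \<phi> x + b * \<psi> x) = a * form v Dv \<phi> + b * form v Dv \<psi>"
proof -
  have g: "grad (\<lambda>x. a * \<phi> x + b * \<psi> x) x = a *\<^sub>R grad \<phi> x + b *\<^sub>R grad \<psi> x" for x
    using grad_add[OF test_cmult[OF \<phi>, of a] test_cmult[OF \<psi>, of b]]
    by (simp add: grad_cmult[OF \<phi>] grad_cmult[OF \<psi>])
  have 1: "(\<lambda>x. (A x *v Dv x) \<bullet> grad (\<lambda>x. a * \<phi> x + b * \<psi> x) x)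
      = (\<lambda>x. a * ((A x *v Dv x) \<bullet> grad \<phi> x) + b * ((A x *v Dv x) \<bullet> grad \<psi> x))"
    by (simp add: fun_eq_iff g inner_add_right)
  have 2: "(\<lambda>x. (B x \<bullet> Dv x) * (a * \<phi> x + b * \<psi> x)) = (\<lambda>x. a * ((B x \<bullet> Dv x) * \<phi> x) + b * ((B x \<bullet> Dv x) * \<psi> x))"
    by (simp add: fun_eq_iff algebra_simps)
  have 3: "(\<lambda>x. c x * v x * (a * \<phi> x + b * \<psi> x)) = (\<lambda>x. a * (c x * v x * \<phi> x) + b * (c x * v x * \<psi> x))"
    by (simp add: fun_eq_iff algebra_simps)
  show ?thesis
    unfolding form_def 1 2 3
    using form_integrable[OF v \<phi>] form_integrable[OF v \<psi>] by (simp add: algebra_simps)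
qed

lemma form_coercive:
  assumes \<phi>: "test_fun U \<phi>"
  shows "lam * (L2n M (grad \<phi>))\<^sup>2 \<le> form \<phi> (grad \<phi>) \<phi>"
proof -
  have "lam * (L2n M (grad \<phi>))\<^sup>2 = (\<integral>x. lam * (norm (grad \<phi> x))\<^sup>2 \<partial>M)" by (simp add: L2n_square)
  also have "\<dots> \<le> (\<integral>x. (A x *v grad \<phi> x) \<bullet> grad \<phi> x \<partial>M)"
  proof (rule integral_mono_AE)
    show "integrable M (\<lambda>x. lam * (norm (grad \<phi> x))\<^sup>2)"
      using sqint_integrable[OF grad_sqint[OF \<phi>]] by simp
    show "integrable M (\<lambda>x. (A x *v grad \<phi> x) \<bullet> grad \<phi> x)"
      by (rule form_integrable(1)[OF H0_test[OF \<phi>] \<phi>])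
    show "AE x in M. lam * (norm (grad \<phi> x))\<^sup>2 \<le> (A x *v grad \<phi> x) \<bullet> grad \<phi> x"
      using A_elliptic by eventually_elim blast
  qed
  finally have 1: "lam * (L2n M (grad \<phi>))\<^sup>2 \<le> (\<integral>x. (A x *v grad \<phi> x) \<bullet> grad \<phi> x \<partial>M)" .
  have "test_fun U (\<lambda>x. (\<phi> x)\<^sup>2)"
    by (rule test_compose[OF \<phi> smooth_real_square]) simp
  then have "0 \<le> (\<integral>x. B x \<bullet> grad (\<lambda>x. (\<phi> x)\<^sup>2) x \<partial>M)"
    by (rule B_nonneg) simp
  also have "\<dots> = (\<integral>x. 2 * ((B x \<bullet> grad \<phi> x) * \<phi> x) \<partial>M)"
  proof (rule Bochner_Integration.integral_cong[OF refl])
    fix x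
    have "((\<lambda>s. s\<^sup>2) has_real_derivative 2 * \<phi> x) (at (\<phi> x))" by (auto intro!: derivative_eq_intros)
    from grad_compose[OF \<phi> this] show "B x \<bullet> grad (\<lambda>x. (\<phi> x)\<^sup>2) x = 2 * ((B x \<bullet> grad \<phi> x) * \<phi> x)" by simp
  qed
  finally have 2: "0 \<le> (\<integral>x. (B x \<bullet> grad \<phi> x) * \<phi> x \<partial>M)" by simp
  have 3: "0 \<le> (\<integral>x. c x * \<phi> x * \<phi> x \<partial>M)"
  proof (rule integral_nonneg_AE)
    show "AE x in M. 0 \<le> c x * \<phi> x * \<phi> x"
      using c_nonneg by eventually_elim (simp add: mult.assoc)
  qed
  show ?thesis unfolding form_def using 1 2 3 by linarith
qed

text \<open>By duality and Sobolev's inequality the right side is a functional of norm at most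
  \<open>Lp_norm U dual f * C_sob\<close> for the gradient seminorm, and the projection theorem
  divides this by the ellipticity constant.\<close>

theorem existence:
  assumes f: "Lp U dual f"
  shows "\<exists>u Du. H0 U u Du \<and> weak_sol U A B c u Du f \<and> L2n M Du \<le> C_sob / lam * Lp_norm U dual f"
proof -
  let ?V = "{\<phi>. test_fun U \<phi>}"
  define F where "F \<phi> = (\<integral>x. f x * \<phi> x \<partial>M)" for \<phi>
  interpret vector_ops "?V" "\<lambda>\<phi> \<psi> x. \<phi> x + \<psi> x" "\<lambda>r \<phi> x. r * \<phi> x"
  proof
    show "?V \<noteq> {}" using test_zero by blast
  qed (simp_all add: test_add test_cmult)
  have pairing: "integrable M (\<lambda>x. f x * \<phi> x)" "\<bar>F \<phi>\<bar> \<le> Lp_norm U dual f * C_sob * L2n M (grad \<phi>)"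
    if \<phi>: "test_fun U \<phi>" for \<phi>
  proof -
    note D = dual_pairing[OF f test_measurable[OF \<phi>] sobolev_test(1)[OF \<phi>]]
    show "integrable M (\<lambda>x. f x * \<phi> x)" by (rule D(1))
    have "\<bar>F \<phi>\<bar> \<le> Lp_norm U dual f * sob_norm \<phi>"
      unfolding F_def by (rule D(2))
    also have "\<dots> \<le> Lp_norm U dual f * (C_sob * L2n M (grad \<phi>))"
      by (intro mult_left_mono sobolev_test(2)[OF \<phi>]) (simp add: Lp_norm_def)
    finally show "\<bar>F \<phi>\<bar> \<le> Lp_norm U dual f * C_sob * L2n M (grad \<phi>)" by (simp add: mult.assoc)
  qed
  have C: "Lp_norm U dual f * C_sob \<ge> 0" using C_sob_pos by (simp add: Lp_norm_def)
  obtain w D where w: "\<And>n. w n \<in> ?V" and D: "sqint M D"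
    and lim: "(\<lambda>n. L2dist M (grad (w n)) D) \<longlonglongrightarrow> 0"
    and norm: "L2n M D \<le> Lp_norm U dual f * C_sob / lam"
    and sol: "\<And>\<phi>. \<phi> \<in> ?V \<Longrightarrow> (\<lambda>n. form (w n) (grad (w n)) \<phi>) \<longlonglongrightarrow> F \<phi>"
  proof (rule Lions_projection[of M grad "\<lambda>w \<phi>. form w (grad w) \<phi>" lam F "Lp_norm U dual f * C_sob"])
    show "sqint M (grad v)" if "v \<in> ?V" for v
      using that by (simp add: grad_sqint)
    show "grad (\<lambda>x. u x + v x) = (\<lambda>x. grad u x + grad v x)" if "u \<in> ?V" "v \<in> ?V" for u v
      using that by (auto simp: fun_eq_iff grad_add)
    show "grad (\<lambda>x. r * u x) = (\<lambda>x. r *\<^sub>R grad u x)" if "u \<in> ?V" for u r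
      using that by (auto simp: fun_eq_iff grad_cmult)
    show "functional (\<lambda>w. form w (grad w) \<phi>)" if "\<phi> \<in> ?V" for \<phi>
      unfolding functional_def
    proof (intro conjI ballI allI)
      fix u v assume "u \<in> ?V" "v \<in> ?V"
      then have u: "test_fun U u" and v: "test_fun U v" by auto
      have "grad (\<lambda>x. u x + v x) = (\<lambda>x. grad u x + grad v x)"
        by (rule ext) (rule grad_add[OF u v])
      then show "form (\<lambda>x. u x + v x) (grad (\<lambda>x. u x + v x)) \<phi> = form u (grad u) \<phi> + form v (grad v) \<phi>"
        using form_lincomb_left[OF H0_test[OF u] H0_test[OF v], of \<phi> 1 1] that by simp
    next
      fix u r assume "u \<in> ?V"
      then have u: "test_fun U u" by auto
      have "grad (\<lambda>x. r * u x) = (\<lambda>x. r *\<^sub>R grad u x)"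
        by (rule ext) (rule grad_cmult[OF u])
      then show "form (\<lambda>x. r * u x) (grad (\<lambda>x. r * u x)) \<phi> = r * form u (grad u) \<phi>"
        using form_lincomb_left[OF H0_test[OF u] H0_test[OF u], of \<phi> r 0] that by simp
    qed
    show "functional (\<lambda>\<phi>. form w (grad w) \<phi>)" if "w \<in> ?V" for w
      unfolding functional_def
    proof (intro conjI ballI allI)
      fix u v assume "u \<in> ?V" "v \<in> ?V"
      then show "form w (grad w) (\<lambda>x. u x + v x) = form w (grad w) u + form w (grad w) v"
        using form_lincomb_right[OF H0_test, of w u v 1 1] that by simp
    next
      fix u r assume "u \<in> ?V"
      then show "form w (grad w) (\<lambda>x. r * u x) = r * form w (grad w) u"
        using form_lincomb_right[OF H0_test, of w u u r 0] that by simp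
    qed
    show "\<exists>K. \<forall>w\<in>?V. \<bar>form w (grad w) \<phi>\<bar> \<le> K * L2n M (grad w)" if "\<phi> \<in> ?V" for \<phi>
      using form_bounded[of \<phi>] that H0_test by auto
    show "lam * (L2n M (grad \<phi>))\<^sup>2 \<le> form \<phi> (grad \<phi>) \<phi>" if "\<phi> \<in> ?V" for \<phi>
      using that by (simp add: form_coercive)
    show "functional F"
      unfolding functional_def F_def
    proof (intro conjI ballI allI)
      fix u v assume "u \<in> ?V" "v \<in> ?V"
      then show "(\<integral>x. f x * (u x + v x) \<partial>M) = (\<integral>x. f x * u x \<partial>M) + (\<integral>x. f x * v x \<partial>M)"
        using pairing(1)[of u] pairing(1)[of v] by (simp add: distrib_left)
    next
      fix u r
      show "(\<integral>x. f x * (r * u x) \<partial>M) = r * (\<integral>x. f x * u x \<partial>M)"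
        by (simp add: mult.left_commute)
    qed
    show "\<bar>F \<phi>\<bar> \<le> Lp_norm U dual f * C_sob * L2n M (grad \<phi>)" if "\<phi> \<in> ?V" for \<phi>
      using that pairing(2) by simp
  qed (use lam_pos C in auto)
  have wt: "test_fun U (w n)" for n using w by simp
  obtain u where u: "H0 U u D" using H0_complete[OF wt D lim] by blast
  have "form u D \<phi> = F \<phi>" if \<phi>: "test_fun U \<phi>" for \<phi>
  proof -
    obtain K where K: "\<And>v Dv. H0 U v Dv \<Longrightarrow> \<bar>form v Dv \<phi>\<bar> \<le> K * L2n M Dv"
      using form_bounded[OF \<phi>] by blast
    \<comment> \<open>The difference is the form evaluated at \<open>w n - u\<close>, which is again
      a pair in \<open>H0\<close>, so the bound for this fixed \<phi> applies.\<close>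
    have "norm (form (w n) (grad (w n)) \<phi> - form u D \<phi>) \<le> K * L2dist M (grad (w n)) D" for n
      using K[OF H0_diff_test[OF wt u], of n] form_lincomb_left[OF H0_test[OF wt[of n]] u \<phi>, of 1 "-1"] by simp
    then have "(\<lambda>n. form (w n) (grad (w n)) \<phi> - form u D \<phi>) \<longlonglongrightarrow> 0"
      by (rule tendsto_zero_bound) (rule tendsto_mult_right_zero[OF lim])
    then have "(\<lambda>n. form (w n) (grad (w n)) \<phi>) \<longlonglongrightarrow> form u D \<phi>" by (simp add: LIM_zero_iff)
    with sol[of \<phi>] \<phi> show ?thesis using LIMSEQ_unique by blast
  qed
  then have "weak_sol U A B c u D f" by (simp add: weak_sol_iff_form F_def)
  with u norm show ?thesis by (auto simp: mult.commute)
qed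

text \<open>With \<open>q = p * d / (d + p)\<close> one has \<open>1/q = 1/p + 1/d\<close>, while
  \<open>1/dual = 1/2 + 1/d\<close> and \<open>1/sob = 1/2 - 1/d\<close>. The iteration exponents
  are therefore \<open>1/2 - 1/p\<close> and \<open>1/2 - 1/d\<close>, and \<open>p > d\<close> is
  exactly the condition that their difference is positive. The lower bound is the same estimate for
  \<open>-u\<close>.\<close>

theorem sup_estimate_abs:
  assumes u: "H0 U u Du" and weak: "weak_sol U A B c u Du f" and p: "p > d" and f: "Lp U (p * d / (d + p)) f"
    and m: "m > 0" "measure lebesgue U \<le> m"
  shows "AE x in M. \<bar>u x\<bar> \<le> C_sob\<^sup>2 / lam * (m powr (1 / d - 1 / p) * 2 powr ((1 / 2 - 1 / p) / (1 / d - 1 / p)))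
    * Lp_norm U (p * d / (d + p)) f"
proof -
  let ?K = "C_sob\<^sup>2 / lam * (m powr (1 / d - 1 / p) * 2 powr ((1 / 2 - 1 / p) / (1 / d - 1 / p)))"
  define q where "q = p * d / (d + p)"
  have dp: "d > 0" "p > 0" "d \<noteq> 2" using d_ge p by auto
  have e1: "1 / dual - 1 / q = 1 / 2 - 1 / p"
    using dp by (simp add: dual_def q_def field_simps)
  have e2: "1 / sob = 1 / 2 - 1 / d"
    using d_ge by (simp add: sob_def field_simps)
  have e3: "1 / 2 - 1 / p - (1 / 2 - 1 / d) = 1 / d - 1 / p" by simp
  have lt: "1 / p < 1 / d" using dp p by (simp add: frac_less2)
  have "1 / p < 1 / 2" using d_ge p by (simp add: field_simps)
  then have "1 / q < 1 / dual" using e1 by linarith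
  moreover have "q > 0" using dp by (simp add: q_def)
  ultimately have q: "q > dual" using dual_gt_1 by (simp add: field_simps)
  have \<sigma>: "1 / sob < 1 / dual - 1 / q" unfolding e1 e2 using lt by simp
  have fq: "Lp U q f" using f by (simp add: q_def)
  have fq': "Lp U q (\<lambda>x. - f x)" using fq by (simp add: Lp_def)
  have norm: "Lp_norm U q (\<lambda>x. - f x) = Lp_norm U q f" by (simp add: Lp_norm_def)
  have "AE x in M. - u x \<le> ?K * Lp_norm U q f"
    using sup_estimate[OF H0_minus[OF u] weak_sol_minus[OF weak] q fq' \<sigma> m] unfolding e1 e2 e3 norm .
  moreover have "AE x in M. u x \<le> ?K * Lp_norm U q f"
    using sup_estimate[OF u weak q fq \<sigma> m] unfolding e1 e2 e3 .
  ultimately have "AE x in M. \<bar>u x\<bar> \<le> ?K * Lp_norm U q f"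
    by eventually_elim (simp add: abs_le_iff)
  then show ?thesis by (simp add: q_def)
qed

text \<open>With the locale constants unfolded, the bounds are visibly the same for all domains and
  coefficients.\<close>

lemmas existence_explicit = existence[unfolded dual_def C_sob_def d_def L2_vec_norm_eq[symmetric]]
lemmas sup_estimate_explicit = sup_estimate_abs[unfolded C_sob_def d_def]

end

section \<open>The three claims with uniform constants\<close>

theorem mainTheorem8:
  assumes "CARD('n::finite) \<ge> 3"
  shows
  "(\<forall>(U :: (real^'n) set) lam M A B c. admissible U lam M A B c \<longrightarrow>
      (\<forall>v Dv. H0 U v Dv \<and> weak_sol U A B c v Dv (\<lambda>x. 0) \<longrightarrow>
         (AE x in lebesgue_on U. v x = 0)))
   \<and> (\<forall>lam>0. \<exists>C1>0. \<forall>(U :: (real^'n) set) M A B c f.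
        admissible U lam M A B c \<and> Lp U (2 * real CARD('n) / (real CARD('n) + 2)) f \<longrightarrow>
        (\<exists>u Du. H0 U u Du \<and> weak_sol U A B c u Du f
           \<and> L2_vec_norm U Du \<le> C1 * Lp_norm U (2 * real CARD('n) / (real CARD('n) + 2)) f))
   \<and> (\<forall>lam>0. \<forall>p>real CARD('n). \<forall>m. \<exists>C2>0. \<forall>(U :: (real^'n) set) M A B c f.
        admissible U lam M A B c \<and> measure lebesgue U = m
        \<and> Lp U (p * real CARD('n) / (real CARD('n) + p)) f \<longrightarrow>
        (\<forall>u Du. H0 U u Du \<and> weak_sol U A B c u Du f \<longrightarrow>
           (AE x in lebesgue_on U. \<bar>u x\<bar> \<le> C2 * Lp_norm U (p * real CARD('n) / (real CARD('n) + p)) f)))"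
proof -
  define dd where "dd = real CARD('n)"
  \<comment> \<open>The value of \<open>C_sob\<close>, written outside the locale because the
    constants are fixed before the domain and the coefficients.\<close>
  define CC where "CC = 2 * (dd - 1) / (dd - 2)"
  have dd: "dd \<ge> 3" using assms by (simp add: dd_def)
  have CC: "CC > 0" using dd by (simp add: CC_def)
  have ell: "elliptic U lam M A B c" if "admissible U lam M A B c" for U :: "(real^'n) set" and lam M A B c
    using that assms by unfold_locales (auto simp: admissible_def)
  show ?thesis
  proof (intro conjI allI impI)
    fix U :: "(real^'n) set" and lam M A B c v Dv
    assume "admissible U lam M A B c" and v: "H0 U v Dv \<and> weak_sol U A B c v Dv (\<lambda>x. 0)"
    then interpret elliptic U lam M A B c by (intro ell)
    show "AE x in lebesgue_on U. v x = 0" using uniqueness v by blast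
  next
    fix lam :: real assume lam: "lam > 0"
    show "\<exists>C1>0. \<forall>(U :: (real^'n) set) M A B c f.
        admissible U lam M A B c \<and> Lp U (2 * real CARD('n) / (real CARD('n) + 2)) f \<longrightarrow>
        (\<exists>u Du. H0 U u Du \<and> weak_sol U A B c u Du f
           \<and> L2_vec_norm U Du \<le> C1 * Lp_norm U (2 * real CARD('n) / (real CARD('n) + 2)) f)"
    proof (intro exI[of _ "CC / lam"] conjI allI impI)
      show "CC / lam > 0" using CC lam by simp
      fix U :: "(real^'n) set" and M A B c f
      assume *: "admissible U lam M A B c \<and> Lp U (2 * real CARD('n) / (real CARD('n) + 2)) f"
      then interpret elliptic U lam M A B c by (intro ell) blast
      show "\<exists>u Du. H0 U u Du \<and> weak_sol U A B c u Du f
           \<and> L2_vec_norm U Du \<le> CC / lam * Lp_norm U (2 * real CARD('n) / (real CARD('n) + 2)) f"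
        using existence_explicit * unfolding CC_def dd_def by blast
    qed
  next
    fix lam p m :: real assume lam: "lam > 0" and p: "p > real CARD('n)"
    \<comment> \<open>The measure is 0 for empty \<open>U\<close>, while the sup estimate asks for a
      positive upper bound; the maximum still depends on \<open>m\<close> alone.\<close>
    define m' where "m' = max 1 m"
    define C2 where "C2 = CC\<^sup>2 / lam * (m' powr (1 / dd - 1 / p) * 2 powr ((1 / 2 - 1 / p) / (1 / dd - 1 / p)))"
    show "\<exists>C2>0. \<forall>(U :: (real^'n) set) M A B c f.
        admissible U lam M A B c \<and> measure lebesgue U = m
        \<and> Lp U (p * real CARD('n) / (real CARD('n) + p)) f \<longrightarrow>
        (\<forall>u Du. H0 U u Du \<and> weak_sol U A B c u Du f \<longrightarrow>
           (AE x in lebesgue_on U. \<bar>u x\<bar> \<le> C2 * Lp_norm U (p * real CARD('n) / (real CARD('n) + p)) f))"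
    proof (intro exI[of _ C2] conjI allI impI)
      show "C2 > 0" using CC lam by (simp add: C2_def m'_def)
      fix U :: "(real^'n) set" and M A B c f u Du
      assume *: "admissible U lam M A B c \<and> measure lebesgue U = m
        \<and> Lp U (p * real CARD('n) / (real CARD('n) + p)) f" and u: "H0 U u Du \<and> weak_sol U A B c u Du f"
      then interpret elliptic U lam M A B c by (intro ell) blast
      show "AE x in lebesgue_on U. \<bar>u x\<bar> \<le> C2 * Lp_norm U (p * real CARD('n) / (real CARD('n) + p)) f"
        unfolding C2_def CC_def dd_def
        by (rule sup_estimate_explicit) (use u * p in \<open>auto simp: m'_def\<close>)
    qed
  qed
qed

end
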